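(* Let $(\underline{\mathcal{M}},\underline{H},\underline{J})$ be a $(2m+1)$-dimensional oriented almost CR manifold and let $\varpi:\mathcal{M}:=\mathbb{R}\times\underline{\mathcal{M}}\to\underline{\mathcal{M}}$ be the trivial line bundle. Fix a triplet $\big((\underline\theta^0,\underline\theta^\alpha,\overline{\underline\theta}{}^{\bar\alpha}),h_{\alpha\bar\beta},\lambda\big)$ where $(\underline\theta^0,\underline\theta^\alpha,\overline{\underline\theta}{}^{\bar\alpha})$ is a CR coframe on $(\underline{\mathcal{M}},\underline{H},\underline{J})$, $h_{\alpha\bar\beta}$ is a positive-definite Hermitian matrix depending smoothly on $\mathcal{M}$, and $\lambda$ is a (real) $1$-form on $\mathcal{M}$ such that $\lambda\wedge\varpi^*\underline\varepsilon$ does not vanish at any point for any non-vanishing $(2m+1)$-form $\underline\varepsilon$ on $\underline{\mathcal{M}}$. Then $(\mathcal{M},g)$ is an oriented and time-oriented Lorentzian manifold with metric $$g=4\,\varpi^*\underline\theta^0\,\lambda+2\,h_{\alpha\bar\beta}\,\varpi^*\underline\theta^\alpha\,\varpi^*\overline{\underline\theta}{}^{\bar\beta},\qquad( * )$$ and $(N,K)$, where $N=\mathrm{Ann}(\varpi^*\underline\theta^0,\varpi^*\underline\theta^\alpha)$ and $K=\mathrm{Ann}(\varpi^*\underline\theta^0)^\perp$, defines a nearly Robinson structure on $(\mathcal{M},g)$. In particular, $\underline{\mathcal{M}}$ is the leaf space of the congruence of null geodesics tangent to $K$. Moreover, let $\big((\underline\theta^0,\underline\theta^\alpha,\overline{\underline\theta}{}^{\bar\alpha}),h_{\alpha\bar\beta},\lambda\big)$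 and $\big((\widehat{\underline\theta}{}^0,\widehat{\underline\theta}{}^\alpha,\overline{\widehat{\underline\theta}}{}^{\bar\alpha}),\widehat h_{\alpha\bar\beta},\widehat\lambda\big)$ be two such triplets whose CR coframes are related by $\widehat{\underline\theta}{}^0=e^{\underline\varphi}\underline\theta^0$, $\widehat{\underline\theta}{}^\alpha=\underline\psi_\beta{}^\alpha\underline\theta^\beta+\underline\phi^\alpha\underline\theta^0$. Then they define the same metric $( * )$ if and only if $$\widehat h_{\alpha\bar\beta}=h_{\gamma\bar\delta}(\underline\psi^{-1})_\alpha{}^\gamma\,\overline{(\underline\psi^{-1})}{}_{\bar\beta}{}^{\bar\delta}$$ (i.e. $\underline\psi$ is unitary at every point with respect to the two Hermitian forms) and $$\widehat\lambda=e^{-\underline\varphi}\Big(\lambda-\tfrac12\underline\psi_\alpha{}^\beta\underline\phi_\beta\,\underline\theta^\alpha-\tfrac12\overline{\underline\psi}{}_{\bar\alpha}{}^{\bar\beta}\underline\phi_{\bar\beta}\,\overline{\underline\theta}{}^{\bar\alpha}-\tfrac12\underline\phi_\beta\underline\phi^\beta\,\underline\theta^0\Big),$$ where $\underline\phi_\beta=\widehat h_{\beta\bar\gamma}\overline{\underline\phi}{}^{\bar\gamma}$, $\underline\phi_{\bar\beta}=\overline{\underline\phi_\beta}$, and pullback signs are omitted.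
   Context: An almost CR structure on a $(2m+1)$-dimensional manifold $\underline{\mathcal{M}}$ is a pair $(\underline{H},\underline{J})$ with $\underline{H}$ a rank-$2m$ distribution and $\underline{J}$ a bundle complex structure on $\underline{H}$, with $\mp i$-eigenbundles $\underline{H}^{(0,1)},\underline{H}^{(1,0)}$; $\mathrm{Ann}(\underline{H})$ is assumed oriented. A CR coframe consists of a real $1$-form $\underline\theta^0$ and $m$ complex $1$-forms $\underline\theta^\alpha$, with $\overline{\underline\theta}{}^{\bar\alpha}=\overline{\underline\theta^\alpha}$, together forming a coframe such that $\underline{H}=\mathrm{Ann}(\underline\theta^0)$ and $\underline{H}^{(0,1)}=\mathrm{Ann}(\underline\theta^0,\underline\theta^\alpha)$. Any two CR coframes are related as in the claim, with $\underline\varphi$ real, $\underline\phi^\alpha$ complex, and $\underline\psi_\beta{}^\alpha$ an invertible complex matrix of smooth functions on $\underline{\mathcal{M}}$. Juxtaposition of $1$-forms is the symmetric product $\alpha\beta=\tfrac12(\alpha\otimes\beta+\beta\otimes\alpha)$. On an oriented, time-oriented Lorentzian manifold $(\mathcal{M},g)$ of dimension $2m+2$, an almost Robinson structure $(N,K)$ is a complex rank-$(m+1)$ distribution $N\subset{}^{\mathbb{C}}T\mathcal{M}$ totally null for ${}^{\mathbb{C}}g$ together with a real line distribution $K$ with ${}^{\mathbb{C}}K=N\cap\overline N$. It is nearly Robinson if $[K,N]\subset N$. *)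

theory Defs
  imports "HOL-Analysis.Analysis"
begin

section \<open>Smooth manifolds\<close>

primrec ck_on :: "nat \<Rightarrow> 'a::real_normed_vector set \<Rightarrow> ('a \<Rightarrow> 'b::real_normed_vector) \<Rightarrow> bool" where
  "ck_on 0 S f \<longleftrightarrow> continuous_on S f"
| "ck_on (Suc n) S f \<longleftrightarrow> (\<forall>x\<in>S. f differentiable (at x)) \<and>
     (\<forall>v. ck_on n S (\<lambda>x. frechet_derivative f (at x) v))"

text \<open>Used for open \<open>S\<close> only.\<close>
definition smooth_on :: "'a::real_normed_vector set \<Rightarrow> ('a \<Rightarrow> 'b::real_normed_vector) \<Rightarrow> bool" where
  "smooth_on S f \<longleftrightarrow> (\<forall>n. ck_on n S f)"

text \<open>
  A smooth structure on the space \<open>'a\<close> is given by an atlas that is indexed by the points: it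
  assigns to \<open>p\<close> a chart \<open>(U\<^sub>p, \<phi>\<^sub>p)\<close> with \<open>p \<in> U\<^sub>p\<close>, and the charts are pairwise smoothly
  compatible. Every smooth structure arises in this way. The tangent space at \<open>p\<close> is identified
  with the model space \<open>'e\<close> by means of the chart \<open>\<phi>\<^sub>p\<close>; a vector field is a function
  \<open>'a \<Rightarrow> 'e\<close>, a 1-form a function \<open>'a \<Rightarrow> 'e \<Rightarrow> _\<close>, and so on.
\<close>
type_synonym ('a, 'e) atlas = "'a \<Rightarrow> 'a set \<times> ('a \<Rightarrow> 'e)"

abbreviation cdom :: "('a, 'e) atlas \<Rightarrow> 'a \<Rightarrow> 'a set" where
  "cdom c p \<equiv> fst (c p)"

abbreviation cmap :: "('a, 'e) atlas \<Rightarrow> 'a \<Rightarrow> 'a \<Rightarrow> 'e" where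
  "cmap c p \<equiv> snd (c p)"

definition cinv :: "('a, 'e) atlas \<Rightarrow> 'a \<Rightarrow> 'e \<Rightarrow> 'a" where
  "cinv c p = inv_into (cdom c p) (cmap c p)"

text \<open>Second countability and the Hausdorff property come from the type classes.\<close>
definition smooth_manifold ::
    "('a::{t2_space, second_countable_topology}, 'e::euclidean_space) atlas \<Rightarrow> bool" where
  "smooth_manifold c \<longleftrightarrow>
     (\<forall>p. p \<in> cdom c p \<and> open (cdom c p) \<and> open (cmap c p ` cdom c p) \<and>
          homeomorphism (cdom c p) (cmap c p ` cdom c p) (cmap c p) (cinv c p)) \<and>
     (\<forall>p q. smooth_on (cmap c p ` (cdom c p \<inter> cdom c q)) (cmap c q \<circ> cinv c p))"

definition euclidean_manifold :: "('e, 'e) atlas" where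
  "euclidean_manifold = (\<lambda>_. (UNIV, \<lambda>x. x))"

definition product_manifold ::
    "('a, 'e) atlas \<Rightarrow> ('b, 'f) atlas \<Rightarrow> ('a \<times> 'b, 'e \<times> 'f) atlas" where
  "product_manifold c d =
     (\<lambda>x. (cdom c (fst x) \<times> cdom d (snd x), map_prod (cmap c (fst x)) (cmap d (snd x))))"

definition smooth_map_on ::
    "('a::topological_space, 'e::real_normed_vector) atlas \<Rightarrow>
     ('b::topological_space, 'f::real_normed_vector) atlas \<Rightarrow> 'a set \<Rightarrow> ('a \<Rightarrow> 'b) \<Rightarrow> bool" where
  "smooth_map_on c d U f \<longleftrightarrow> continuous_on U f \<and>
     (\<forall>p q. smooth_on (cmap c p ` (cdom c p \<inter> U \<inter> f -` cdom d q)) (cmap d q \<circ> f \<circ> cinv c p))"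

abbreviation smooth_fun ::
    "('a::topological_space, 'e::real_normed_vector) atlas \<Rightarrow> ('a \<Rightarrow> 'v::real_normed_vector) \<Rightarrow> bool" where
  "smooth_fun c f \<equiv> smooth_map_on c euclidean_manifold UNIV f"

text \<open>The differential \<open>df\<^sub>x\<close>, in the identifications of the tangent spaces with the model spaces.\<close>
definition mderiv ::
    "('a, 'e::real_normed_vector) atlas \<Rightarrow> ('b, 'f::real_normed_vector) atlas \<Rightarrow>
     ('a \<Rightarrow> 'b) \<Rightarrow> 'a \<Rightarrow> 'e \<Rightarrow> 'f" where
  "mderiv c d f x = frechet_derivative (cmap d (f x) \<circ> f \<circ> cinv c x) (at (cmap c x x))"

text \<open>
  \<open>tchange c p q r v\<close> re-expresses a tangent vector at \<open>r\<close> with components \<open>v\<close> in the chart \<open>\<phi>\<^sub>p\<close>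
  in the chart \<open>\<phi>\<^sub>q\<close>. Thus \<open>tchange c r p r\<close> maps the tangent space at \<open>r\<close> to components in \<open>\<phi>\<^sub>p\<close>,
  and \<open>tchange c p r r\<close> is its inverse.
\<close>
definition tchange ::
    "('a, 'e::real_normed_vector) atlas \<Rightarrow> 'a \<Rightarrow> 'a \<Rightarrow> 'a \<Rightarrow> 'e \<Rightarrow> 'e" where
  "tchange c p q r = frechet_derivative (cmap c q \<circ> cinv c p) (at (cmap c p r))"


section \<open>Vector fields and forms\<close>

definition vloc ::
    "('a, 'e::real_normed_vector) atlas \<Rightarrow> 'a \<Rightarrow> ('a \<Rightarrow> 'e) \<Rightarrow> 'e \<Rightarrow> 'e" where
  "vloc c p X y = (let r = cinv c p y in tchange c r p r (X r))"

definition vector_field_on ::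
    "('a, 'e::real_normed_vector) atlas \<Rightarrow> 'a set \<Rightarrow> ('a \<Rightarrow> 'e) \<Rightarrow> bool" where
  "vector_field_on c U X \<longleftrightarrow> (\<forall>p. smooth_on (cmap c p ` (cdom c p \<inter> U)) (vloc c p X))"

text \<open>\<open>[X,Y] = DY(X) - DX(Y)\<close>, computed at \<open>q\<close> in the chart \<open>\<phi>\<^sub>q\<close>.\<close>
definition lie_bracket ::
    "('a, 'e::real_normed_vector) atlas \<Rightarrow> ('a \<Rightarrow> 'e) \<Rightarrow> ('a \<Rightarrow> 'e) \<Rightarrow> 'a \<Rightarrow> 'e" where
  "lie_bracket c X Y q =
     frechet_derivative (vloc c q Y) (at (cmap c q q)) (X q) -
     frechet_derivative (vloc c q X) (at (cmap c q q)) (Y q)"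

text \<open>Smooth 1-forms, real-valued or complex-valued according to \<open>'v\<close>.\<close>
definition one_form_on ::
    "('a, 'e::real_normed_vector) atlas \<Rightarrow> 'a set \<Rightarrow> ('a \<Rightarrow> 'e \<Rightarrow> 'v::real_normed_vector) \<Rightarrow> bool" where
  "one_form_on c U \<theta> \<longleftrightarrow> (\<forall>p\<in>U. linear (\<theta> p)) \<and>
     (\<forall>p u. smooth_on (cmap c p ` (cdom c p \<inter> U))
        (\<lambda>y. let r = cinv c p y in \<theta> r (tchange c p r r u)))"

definition pullback ::
    "('a, 'e::real_normed_vector) atlas \<Rightarrow> ('b, 'f::real_normed_vector) atlas \<Rightarrow> ('a \<Rightarrow> 'b) \<Rightarrow>
     ('b \<Rightarrow> 'f \<Rightarrow> 'v) \<Rightarrow> 'a \<Rightarrow> 'e \<Rightarrow> 'v" where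
  "pullback c d f \<theta> x v = \<theta> (f x) (mderiv c d f x v)"

text \<open>
  Alternating \<open>n\<close>-forms on a vector space. The arguments are given by a sequence of which only the
  first \<open>n\<close> entries matter.
\<close>
definition alternating_form :: "nat \<Rightarrow> ((nat \<Rightarrow> 'e::real_vector) \<Rightarrow> real) \<Rightarrow> bool" where
  "alternating_form n \<omega> \<longleftrightarrow>
     (\<forall>v w. (\<forall>i<n. v i = w i) \<longrightarrow> \<omega> v = \<omega> w) \<and>
     (\<forall>v. \<forall>i<n. linear (\<lambda>x. \<omega> (v(i := x)))) \<and>
     (\<forall>v. \<forall>i<n. \<forall>j<n. i \<noteq> j \<and> v i = v j \<longrightarrow> \<omega> v = 0)"

definition nform_on ::
    "('a, 'e::real_normed_vector) atlas \<Rightarrow> nat \<Rightarrow> 'a set \<Rightarrow> ('a \<Rightarrow> (nat \<Rightarrow> 'e) \<Rightarrow> real) \<Rightarrow> bool" where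
  "nform_on c n U \<omega> \<longleftrightarrow> (\<forall>p\<in>U. alternating_form n (\<omega> p)) \<and>
     (\<forall>p v. smooth_on (cmap c p ` (cdom c p \<inter> U))
        (\<lambda>y. let r = cinv c p y in \<omega> r (\<lambda>i. tchange c p r r (v i))))"

definition form_pullback ::
    "('a, 'e::real_normed_vector) atlas \<Rightarrow> ('b, 'f::real_normed_vector) atlas \<Rightarrow> ('a \<Rightarrow> 'b) \<Rightarrow> 'a \<Rightarrow>
     ((nat \<Rightarrow> 'f) \<Rightarrow> real) \<Rightarrow> (nat \<Rightarrow> 'e) \<Rightarrow> real" where
  "form_pullback c d f x \<omega> v = \<omega> (\<lambda>i. mderiv c d f x (v i))"

text \<open>The wedge product of a 1-form with an \<open>n\<close>-form at a point.\<close>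
definition wedge1 ::
    "nat \<Rightarrow> ('e \<Rightarrow> real) \<Rightarrow> ((nat \<Rightarrow> 'e) \<Rightarrow> real) \<Rightarrow> (nat \<Rightarrow> 'e) \<Rightarrow> real" where
  "wedge1 n lam \<omega> v = (\<Sum>i\<le>n. (-1) ^ i * lam (v i) * \<omega> (\<lambda>j. if j < i then v j else v (Suc j)))"

text \<open>
  An orientation is a smoothly varying choice of a ray in each of the lines of top-degree forms:
  \<open>ori p\<close> is the set of positive top-degree forms at \<open>p\<close>.
\<close>
definition orientation ::
    "('a::topological_space, 'e::euclidean_space) atlas \<Rightarrow> ('a \<Rightarrow> ((nat \<Rightarrow> 'e) \<Rightarrow> real) set) \<Rightarrow> bool" where
  "orientation c ori \<longleftrightarrow> (\<forall>p. \<exists>U \<omega>. open U \<and> p \<in> U \<and> nform_on c DIM('e) U \<omega> \<and>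
     (\<forall>q\<in>U. \<omega> q \<noteq> (\<lambda>_. 0) \<and> ori q = {(\<lambda>v. r * \<omega> q v) |r. r > 0}))"


section \<open>Complexified tangent spaces and distributions\<close>

text \<open>The complexification of \<open>'e\<close>: the pair \<open>(u, v)\<close> stands for \<open>u + \<i> v\<close>.\<close>
definition cscale :: "complex \<Rightarrow> 'e::real_vector \<times> 'e \<Rightarrow> 'e \<times> 'e" where
  "cscale z w = (Re z *\<^sub>R fst w - Im z *\<^sub>R snd w, Re z *\<^sub>R snd w + Im z *\<^sub>R fst w)"

interpretation cvec: vector_space "cscale :: complex \<Rightarrow> 'e::real_vector \<times> 'e \<Rightarrow> 'e \<times> 'e"
  by unfold_locales (auto simp: cscale_def algebra_simps)

definition cconj :: "'e::real_vector \<times> 'e \<Rightarrow> 'e \<times> 'e" where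
  "cconj w = (fst w, - snd w)"

text \<open>The complex linear extension of a complex-valued covector, and the complex bilinear
  extension of a real bilinear form.\<close>
definition cext :: "('e \<Rightarrow> complex) \<Rightarrow> 'e \<times> 'e \<Rightarrow> complex" where
  "cext \<theta> w = \<theta> (fst w) + \<i> * \<theta> (snd w)"

definition cext2 :: "('e \<Rightarrow> 'e \<Rightarrow> real) \<Rightarrow> 'e \<times> 'e \<Rightarrow> 'e \<times> 'e \<Rightarrow> complex" where
  "cext2 g w z = Complex (g (fst w) (fst z) - g (snd w) (snd z)) (g (fst w) (snd z) + g (snd w) (fst z))"

definition real_distribution ::
    "('a::topological_space, 'e::real_normed_vector) atlas \<Rightarrow> nat \<Rightarrow> ('a \<Rightarrow> 'e set) \<Rightarrow> bool" where
  "real_distribution c r D \<longleftrightarrow> (\<forall>p. subspace (D p) \<and> dim (D p) = r) \<and>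
     (\<forall>p. \<exists>U X. open U \<and> p \<in> U \<and> (\<forall>i<r. vector_field_on c U (X i)) \<and>
        (\<forall>q\<in>U. D q = span {X i q |i. i < r}))"

definition cvector_field_on ::
    "('a, 'e::real_normed_vector) atlas \<Rightarrow> 'a set \<Rightarrow> ('a \<Rightarrow> 'e \<times> 'e) \<Rightarrow> bool" where
  "cvector_field_on c U Z \<longleftrightarrow>
     vector_field_on c U (\<lambda>p. fst (Z p)) \<and> vector_field_on c U (\<lambda>p. snd (Z p))"

definition complex_distribution ::
    "('a::topological_space, 'e::real_normed_vector) atlas \<Rightarrow> nat \<Rightarrow> ('a \<Rightarrow> ('e \<times> 'e) set) \<Rightarrow> bool" where
  "complex_distribution c r D \<longleftrightarrow> (\<forall>p. cvec.subspace (D p) \<and> cvec.dim (D p) = r) \<and>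
     (\<forall>p. \<exists>U Z. open U \<and> p \<in> U \<and> (\<forall>i<r. cvector_field_on c U (Z i)) \<and>
        (\<forall>q\<in>U. D q = cvec.span {Z i q |i. i < r}))"


section \<open>Lorentzian manifolds\<close>

text \<open>Signature \<open>(+,\<dots>,+,-)\<close>.\<close>
definition lorentzian_form :: "('e::euclidean_space \<Rightarrow> 'e \<Rightarrow> real) \<Rightarrow> bool" where
  "lorentzian_form b \<longleftrightarrow> bilinear b \<and> (\<forall>u v. b u v = b v u) \<and>
     (\<exists>B t. independent B \<and> span B = UNIV \<and> t \<in> B \<and> b t t = -1 \<and>
        (\<forall>u\<in>B - {t}. b u u = 1) \<and> (\<forall>u\<in>B. \<forall>v\<in>B. u \<noteq> v \<longrightarrow> b u v = 0))"

definition gloc ::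
    "('a, 'e::real_normed_vector) atlas \<Rightarrow> ('a \<Rightarrow> 'e \<Rightarrow> 'e \<Rightarrow> real) \<Rightarrow> 'a \<Rightarrow> 'e \<Rightarrow> 'e \<Rightarrow> 'e \<Rightarrow> real" where
  "gloc c g p u v y = (let r = cinv c p y in g r (tchange c p r r u) (tchange c p r r v))"

definition lorentzian_metric ::
    "('a, 'e::euclidean_space) atlas \<Rightarrow> ('a \<Rightarrow> 'e \<Rightarrow> 'e \<Rightarrow> real) \<Rightarrow> bool" where
  "lorentzian_metric c g \<longleftrightarrow> (\<forall>p. lorentzian_form (g p)) \<and>
     (\<forall>p u v. smooth_on (cmap c p ` cdom c p) (gloc c g p u v))"

text \<open>A time-orientation is a smoothly varying choice \<open>\<tau> p\<close> of one of the two cones of timelike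
  vectors at each point \<open>p\<close>.\<close>
definition time_orientation ::
    "('a::topological_space, 'e::real_normed_vector) atlas \<Rightarrow> ('a \<Rightarrow> 'e \<Rightarrow> 'e \<Rightarrow> real) \<Rightarrow> ('a \<Rightarrow> 'e set) \<Rightarrow> bool" where
  "time_orientation c g \<tau> \<longleftrightarrow>
     (\<forall>p. \<exists>u. g p u u < 0 \<and> \<tau> p = {v. g p v v < 0 \<and> g p u v < 0}) \<and>
     (\<forall>p. \<exists>U X. open U \<and> p \<in> U \<and> vector_field_on c U X \<and> (\<forall>q\<in>U. X q \<in> \<tau> q))"

definition oriented_lorentzian_manifold ::
    "('a::{t2_space, second_countable_topology}, 'e::euclidean_space) atlas \<Rightarrow>
     ('a \<Rightarrow> 'e \<Rightarrow> 'e \<Rightarrow> real) \<Rightarrow> ('a \<Rightarrow> ((nat \<Rightarrow> 'e) \<Rightarrow> real) set) \<Rightarrow> ('a \<Rightarrow> 'e set) \<Rightarrow> bool" where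
  "oriented_lorentzian_manifold c g ori \<tau> \<longleftrightarrow>
     smooth_manifold c \<and> lorentzian_metric c g \<and> orientation c ori \<and> time_orientation c g \<tau>"

text \<open>The derivative \<open>\<partial>\<^sub>w g(u,v)\<close> and the Christoffel symbols \<open>\<Gamma>(u,v)\<close> of the Levi-Civita connection
  at \<open>q\<close>, in the chart \<open>\<phi>\<^sub>q\<close>.\<close>
definition metric_deriv ::
    "('a, 'e::real_normed_vector) atlas \<Rightarrow> ('a \<Rightarrow> 'e \<Rightarrow> 'e \<Rightarrow> real) \<Rightarrow> 'a \<Rightarrow> 'e \<Rightarrow> 'e \<Rightarrow> 'e \<Rightarrow> real" where
  "metric_deriv c g q w u v = frechet_derivative (gloc c g q u v) (at (cmap c q q)) w"

definition christoffel ::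
    "('a, 'e::real_normed_vector) atlas \<Rightarrow> ('a \<Rightarrow> 'e \<Rightarrow> 'e \<Rightarrow> real) \<Rightarrow> 'a \<Rightarrow> 'e \<Rightarrow> 'e \<Rightarrow> 'e" where
  "christoffel c g q u v = (THE z. \<forall>w. 2 * g q z w =
     metric_deriv c g q u v w + metric_deriv c g q v u w - metric_deriv c g q w u v)"

definition velocity :: "('a, 'e::real_normed_vector) atlas \<Rightarrow> (real \<Rightarrow> 'a) \<Rightarrow> real \<Rightarrow> 'e" where
  "velocity c \<gamma> t = mderiv euclidean_manifold c \<gamma> t 1"

text \<open>The covariant acceleration \<open>\<nabla>\<^bsub>\<gamma>'\<^esub> \<gamma>'\<close>.\<close>
definition acceleration ::
    "('a, 'e::real_normed_vector) atlas \<Rightarrow> ('a \<Rightarrow> 'e \<Rightarrow> 'e \<Rightarrow> real) \<Rightarrow> (real \<Rightarrow> 'a) \<Rightarrow> real \<Rightarrow> 'e" where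
  "acceleration c g \<gamma> t =
     vector_derivative (\<lambda>s. vector_derivative (cmap c (\<gamma> t) \<circ> \<gamma>) (at s)) (at t) +
     christoffel c g (\<gamma> t) (velocity c \<gamma> t) (velocity c \<gamma> t)"

definition regular_curve ::
    "('a::topological_space, 'e::real_normed_vector) atlas \<Rightarrow> real set \<Rightarrow> (real \<Rightarrow> 'a) \<Rightarrow> bool" where
  "regular_curve c I \<gamma> \<longleftrightarrow> open I \<and> is_interval I \<and> smooth_map_on euclidean_manifold c I \<gamma> \<and>
     (\<forall>t\<in>I. velocity c \<gamma> t \<noteq> 0)"

text \<open>Geodesics are unparametrised here, that is, the parameter need not be affine.\<close>
definition null_geodesic ::
    "('a::topological_space, 'e::real_normed_vector) atlas \<Rightarrow> ('a \<Rightarrow> 'e \<Rightarrow> 'e \<Rightarrow> real) \<Rightarrow>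
     real set \<Rightarrow> (real \<Rightarrow> 'a) \<Rightarrow> bool" where
  "null_geodesic c g I \<gamma> \<longleftrightarrow> regular_curve c I \<gamma> \<and>
     (\<forall>t\<in>I. g (\<gamma> t) (velocity c \<gamma> t) (velocity c \<gamma> t) = 0 \<and>
        (\<exists>f. acceleration c g \<gamma> t = f *\<^sub>R velocity c \<gamma> t))"

definition integral_curve ::
    "('a::topological_space, 'e::real_normed_vector) atlas \<Rightarrow> ('a \<Rightarrow> 'e set) \<Rightarrow>
     real set \<Rightarrow> (real \<Rightarrow> 'a) \<Rightarrow> bool" where
  "integral_curve c K I \<gamma> \<longleftrightarrow> regular_curve c I \<gamma> \<and> (\<forall>t\<in>I. velocity c \<gamma> t \<in> K (\<gamma> t))"

text \<open>The leaves of the foliation tangent to a line distribution.\<close>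
definition same_leaf ::
    "('a::topological_space, 'e::real_normed_vector) atlas \<Rightarrow> ('a \<Rightarrow> 'e set) \<Rightarrow> 'a \<Rightarrow> 'a \<Rightarrow> bool" where
  "same_leaf c K x y \<longleftrightarrow> (\<exists>I \<gamma>. integral_curve c K I \<gamma> \<and> x \<in> \<gamma> ` I \<and> y \<in> \<gamma> ` I)"

text \<open>The smooth structure of a leaf space is determined by the quotient map being a surjective
  submersion.\<close>
definition leaf_space ::
    "('a::topological_space, 'e::real_normed_vector) atlas \<Rightarrow> ('a \<Rightarrow> 'e set) \<Rightarrow>
     ('b::topological_space, 'f::real_normed_vector) atlas \<Rightarrow> ('a \<Rightarrow> 'b) \<Rightarrow> bool" where
  "leaf_space c K d f \<longleftrightarrow> smooth_map_on c d UNIV f \<and> surj f \<and> (\<forall>x. surj (mderiv c d f x)) \<and>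
     (\<forall>x y. f x = f y \<longleftrightarrow> same_leaf c K x y)"


section \<open>Almost Robinson structures\<close>

definition almost_robinson ::
    "('a::{t2_space, second_countable_topology}, 'e::euclidean_space) atlas \<Rightarrow> nat \<Rightarrow>
     ('a \<Rightarrow> 'e \<Rightarrow> 'e \<Rightarrow> real) \<Rightarrow> ('a \<Rightarrow> ((nat \<Rightarrow> 'e) \<Rightarrow> real) set) \<Rightarrow> ('a \<Rightarrow> 'e set) \<Rightarrow>
     ('a \<Rightarrow> ('e \<times> 'e) set) \<Rightarrow> ('a \<Rightarrow> 'e set) \<Rightarrow> bool" where
  "almost_robinson c m g ori \<tau> N K \<longleftrightarrow>
     oriented_lorentzian_manifold c g ori \<tau> \<and> DIM('e) = 2 * m + 2 \<and>
     complex_distribution c (m + 1) N \<and> (\<forall>p. \<forall>w\<in>N p. \<forall>z\<in>N p. cext2 (g p) w z = 0) \<and>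
     real_distribution c 1 K \<and> (\<forall>p. K p \<times> K p = N p \<inter> cconj ` N p)"

text \<open>The condition \<open>[K,N] \<subset> N\<close>, for all local sections.\<close>
definition nearly_robinson ::
    "('a::{t2_space, second_countable_topology}, 'e::euclidean_space) atlas \<Rightarrow> nat \<Rightarrow>
     ('a \<Rightarrow> 'e \<Rightarrow> 'e \<Rightarrow> real) \<Rightarrow> ('a \<Rightarrow> ((nat \<Rightarrow> 'e) \<Rightarrow> real) set) \<Rightarrow> ('a \<Rightarrow> 'e set) \<Rightarrow>
     ('a \<Rightarrow> ('e \<times> 'e) set) \<Rightarrow> ('a \<Rightarrow> 'e set) \<Rightarrow> bool" where
  "nearly_robinson c m g ori \<tau> N K \<longleftrightarrow> almost_robinson c m g ori \<tau> N K \<and>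
     (\<forall>U k Z. open U \<and> vector_field_on c U k \<and> (\<forall>q\<in>U. k q \<in> K q) \<and>
        cvector_field_on c U Z \<and> (\<forall>q\<in>U. Z q \<in> N q) \<longrightarrow>
        (\<forall>q\<in>U. (lie_bracket c k (\<lambda>p. fst (Z p)) q, lie_bracket c k (\<lambda>p. snd (Z p)) q) \<in> N q))"


section \<open>Almost CR structures\<close>

text \<open>\<open>J p\<close> is relevant on \<open>H p\<close> only.\<close>
definition almost_cr_structure ::
    "('a::topological_space, 'e::real_normed_vector) atlas \<Rightarrow> nat \<Rightarrow> ('a \<Rightarrow> 'e set) \<Rightarrow> ('a \<Rightarrow> 'e \<Rightarrow> 'e) \<Rightarrow> bool" where
  "almost_cr_structure c m H J \<longleftrightarrow> real_distribution c (2 * m) H \<and>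
     (\<forall>p. \<forall>u\<in>H p. J p u \<in> H p \<and> J p (J p u) = - u) \<and>
     (\<forall>p. \<forall>u\<in>H p. \<forall>v\<in>H p. \<forall>a b. J p (a *\<^sub>R u + b *\<^sub>R v) = a *\<^sub>R J p u + b *\<^sub>R J p v) \<and>
     (\<forall>U X. open U \<and> vector_field_on c U X \<and> (\<forall>q\<in>U. X q \<in> H q) \<longrightarrow>
        vector_field_on c U (\<lambda>q. J q (X q)))"

text \<open>The eigenbundle of \<open>J\<close> in the complexification of \<open>H\<close> for the eigenvalue \<open>-\<i>\<close>.\<close>
definition H01 :: "('a \<Rightarrow> 'e::real_vector set) \<Rightarrow> ('a \<Rightarrow> 'e \<Rightarrow> 'e) \<Rightarrow> 'a \<Rightarrow> ('e \<times> 'e) set" where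
  "H01 H J p = {w \<in> H p \<times> H p. map_prod (J p) (J p) w = cscale (- \<i>) w}"

text \<open>An orientation of the line bundle of 1-forms that annihilate \<open>H\<close>; \<open>A p\<close> is the set of
  positive annihilators of \<open>H p\<close>.\<close>
definition ann_orientation ::
    "('a::topological_space, 'e::real_normed_vector) atlas \<Rightarrow> ('a \<Rightarrow> 'e set) \<Rightarrow> ('a \<Rightarrow> ('e \<Rightarrow> real) set) \<Rightarrow> bool" where
  "ann_orientation c H A \<longleftrightarrow> (\<forall>p. \<exists>U \<eta>. open U \<and> p \<in> U \<and> one_form_on c U \<eta> \<and>
     (\<forall>q\<in>U. H q = {v. \<eta> q v = 0} \<and> \<eta> q \<noteq> (\<lambda>_. 0) \<and> A q = {(\<lambda>v. r * \<eta> q v) |r. r > 0}))"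

definition oriented_almost_cr_manifold ::
    "('a::{t2_space, second_countable_topology}, 'e::euclidean_space) atlas \<Rightarrow> nat \<Rightarrow>
     ('a \<Rightarrow> ((nat \<Rightarrow> 'e) \<Rightarrow> real) set) \<Rightarrow> ('a \<Rightarrow> 'e set) \<Rightarrow> ('a \<Rightarrow> 'e \<Rightarrow> 'e) \<Rightarrow> ('a \<Rightarrow> ('e \<Rightarrow> real) set) \<Rightarrow> bool" where
  "oriented_almost_cr_manifold c m ori H J A \<longleftrightarrow>
     smooth_manifold c \<and> DIM('e) = 2 * m + 1 \<and> orientation c ori \<and>
     almost_cr_structure c m H J \<and> ann_orientation c H A"

text \<open>\<open>\<theta>0\<close>, \<open>\<theta> \<alpha>\<close> and the conjugates of the \<open>\<theta> \<alpha>\<close>, for \<open>\<alpha> < m\<close>, form a basis of the complexified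
  dual space, i.e. of the space of real linear maps \<open>'e \<Rightarrow> complex\<close>.\<close>
definition coframe :: "nat \<Rightarrow> ('e::real_vector \<Rightarrow> real) \<Rightarrow> (nat \<Rightarrow> 'e \<Rightarrow> complex) \<Rightarrow> bool" where
  "coframe m \<theta>0 \<theta> \<longleftrightarrow>
     (\<forall>a b b'. (\<forall>v. a * complex_of_real (\<theta>0 v) + (\<Sum>\<alpha><m. b \<alpha> * \<theta> \<alpha> v) + (\<Sum>\<alpha><m. b' \<alpha> * cnj (\<theta> \<alpha> v)) = 0)
        \<longrightarrow> a = 0 \<and> (\<forall>\<alpha><m. b \<alpha> = 0 \<and> b' \<alpha> = 0)) \<and>
     (\<forall>\<xi>. linear \<xi> \<longrightarrow> (\<exists>a b b'. \<forall>v. \<xi> v =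
        a * complex_of_real (\<theta>0 v) + (\<Sum>\<alpha><m. b \<alpha> * \<theta> \<alpha> v) + (\<Sum>\<alpha><m. b' \<alpha> * cnj (\<theta> \<alpha> v))))"

definition cr_coframe ::
    "('a, 'e::real_normed_vector) atlas \<Rightarrow> nat \<Rightarrow> ('a \<Rightarrow> 'e set) \<Rightarrow> ('a \<Rightarrow> 'e \<Rightarrow> 'e) \<Rightarrow>
     ('a \<Rightarrow> ('e \<Rightarrow> real) set) \<Rightarrow> ('a \<Rightarrow> 'e \<Rightarrow> real) \<Rightarrow> (nat \<Rightarrow> 'a \<Rightarrow> 'e \<Rightarrow> complex) \<Rightarrow> bool" where
  "cr_coframe c m H J A \<theta>0 \<theta> \<longleftrightarrow>
     one_form_on c UNIV \<theta>0 \<and> (\<forall>\<alpha><m. one_form_on c UNIV (\<theta> \<alpha>)) \<and>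
     (\<forall>p. coframe m (\<theta>0 p) (\<lambda>\<alpha>. \<theta> \<alpha> p) \<and>
          H p = {v. \<theta>0 p v = 0} \<and> \<theta>0 p \<in> A p \<and>
          H01 H J p = {w. cext (\<lambda>v. complex_of_real (\<theta>0 p v)) w = 0 \<and> (\<forall>\<alpha><m. cext (\<theta> \<alpha> p) w = 0)})"

section \<open>The lift of an almost CR structure to the trivial line bundle\<close>

abbreviation line_bundle :: "('a, 'e) atlas \<Rightarrow> (real \<times> 'a, real \<times> 'e) atlas" where
  "line_bundle c \<equiv> product_manifold euclidean_manifold c"

abbreviation lift_form ::
    "('a, 'e::real_normed_vector) atlas \<Rightarrow> ('a \<Rightarrow> 'e \<Rightarrow> 'v) \<Rightarrow> real \<times> 'a \<Rightarrow> real \<times> 'e \<Rightarrow> 'v" where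
  "lift_form c \<equiv> pullback (line_bundle c) c snd"

text \<open>The matrix entry \<open>h \<alpha> \<beta>\<close> is \<open>h\<^bsub>\<alpha>\<beta>\<^esub>\<close> with the second index barred.\<close>
definition pos_def_hermitian :: "nat \<Rightarrow> (nat \<Rightarrow> nat \<Rightarrow> complex) \<Rightarrow> bool" where
  "pos_def_hermitian m h \<longleftrightarrow> (\<forall>\<alpha><m. \<forall>\<beta><m. h \<beta> \<alpha> = cnj (h \<alpha> \<beta>)) \<and>
     (\<forall>z. (\<exists>\<alpha><m. z \<alpha> \<noteq> 0) \<longrightarrow> 0 < Re (\<Sum>\<alpha><m. \<Sum>\<beta><m. h \<alpha> \<beta> * z \<alpha> * cnj (z \<beta>)))"

definition robinson_triplet ::
    "('a::{t2_space, second_countable_topology}, 'e::euclidean_space) atlas \<Rightarrow> nat \<Rightarrow> ('a \<Rightarrow> 'e set) \<Rightarrow>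
     ('a \<Rightarrow> 'e \<Rightarrow> 'e) \<Rightarrow> ('a \<Rightarrow> ('e \<Rightarrow> real) set) \<Rightarrow> ('a \<Rightarrow> 'e \<Rightarrow> real) \<Rightarrow> (nat \<Rightarrow> 'a \<Rightarrow> 'e \<Rightarrow> complex) \<Rightarrow>
     (nat \<Rightarrow> nat \<Rightarrow> real \<times> 'a \<Rightarrow> complex) \<Rightarrow> (real \<times> 'a \<Rightarrow> real \<times> 'e \<Rightarrow> real) \<Rightarrow> bool" where
  "robinson_triplet c m H J A \<theta>0 \<theta> h lam \<longleftrightarrow>
     cr_coframe c m H J A \<theta>0 \<theta> \<and>
     (\<forall>\<alpha><m. \<forall>\<beta><m. smooth_fun (line_bundle c) (h \<alpha> \<beta>)) \<and>
     (\<forall>x. pos_def_hermitian m (\<lambda>\<alpha> \<beta>. h \<alpha> \<beta> x)) \<and>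
     one_form_on (line_bundle c) UNIV lam \<and>
     (\<forall>\<epsilon>. nform_on c (2 * m + 1) UNIV \<epsilon> \<and> (\<forall>p. \<epsilon> p \<noteq> (\<lambda>_. 0)) \<longrightarrow>
        (\<forall>x. wedge1 (2 * m + 1) (lam x) (form_pullback (line_bundle c) c snd x (\<epsilon> (snd x))) \<noteq> (\<lambda>_. 0)))"

definition symm_prod :: "('e \<Rightarrow> complex) \<Rightarrow> ('e \<Rightarrow> complex) \<Rightarrow> 'e \<Rightarrow> 'e \<Rightarrow> complex" where
  "symm_prod a b u v = (a u * b v + b u * a v) / 2"

text \<open>The tensor \<open>4 \<theta>0 lam + 2 h\<^bsub>\<alpha>\<beta>\<^esub> \<theta>\<^sup>\<alpha> cnj \<theta>\<^sup>\<beta>\<close> as a complex-valued form. It is real-valued when \<open>h\<close> is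
  Hermitian, and \<open>robinson_metric\<close> is then this tensor as a real-valued form.\<close>
definition robinson_tensor ::
    "('a, 'e::real_normed_vector) atlas \<Rightarrow> nat \<Rightarrow> ('a \<Rightarrow> 'e \<Rightarrow> real) \<Rightarrow> (nat \<Rightarrow> 'a \<Rightarrow> 'e \<Rightarrow> complex) \<Rightarrow>
     (nat \<Rightarrow> nat \<Rightarrow> real \<times> 'a \<Rightarrow> complex) \<Rightarrow> (real \<times> 'a \<Rightarrow> real \<times> 'e \<Rightarrow> real) \<Rightarrow>
     real \<times> 'a \<Rightarrow> real \<times> 'e \<Rightarrow> real \<times> 'e \<Rightarrow> complex" where
  "robinson_tensor c m \<theta>0 \<theta> h lam x u v =
     4 * symm_prod (\<lambda>w. complex_of_real (lift_form c \<theta>0 x w)) (\<lambda>w. complex_of_real (lam x w)) u v +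
     2 * (\<Sum>\<alpha><m. \<Sum>\<beta><m. h \<alpha> \<beta> x * symm_prod (lift_form c (\<theta> \<alpha>) x) (\<lambda>w. cnj (lift_form c (\<theta> \<beta>) x w)) u v)"

definition robinson_metric ::
    "('a, 'e::real_normed_vector) atlas \<Rightarrow> nat \<Rightarrow> ('a \<Rightarrow> 'e \<Rightarrow> real) \<Rightarrow> (nat \<Rightarrow> 'a \<Rightarrow> 'e \<Rightarrow> complex) \<Rightarrow>
     (nat \<Rightarrow> nat \<Rightarrow> real \<times> 'a \<Rightarrow> complex) \<Rightarrow> (real \<times> 'a \<Rightarrow> real \<times> 'e \<Rightarrow> real) \<Rightarrow>
     real \<times> 'a \<Rightarrow> real \<times> 'e \<Rightarrow> real \<times> 'e \<Rightarrow> real" where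
  "robinson_metric c m \<theta>0 \<theta> h lam x u v = Re (robinson_tensor c m \<theta>0 \<theta> h lam x u v)"

definition robinson_N ::
    "('a, 'e::real_normed_vector) atlas \<Rightarrow> nat \<Rightarrow> ('a \<Rightarrow> 'e \<Rightarrow> real) \<Rightarrow> (nat \<Rightarrow> 'a \<Rightarrow> 'e \<Rightarrow> complex) \<Rightarrow>
     real \<times> 'a \<Rightarrow> ((real \<times> 'e) \<times> (real \<times> 'e)) set" where
  "robinson_N c m \<theta>0 \<theta> x =
     {w. cext (\<lambda>v. complex_of_real (lift_form c \<theta>0 x v)) w = 0 \<and>
         (\<forall>\<alpha><m. cext (lift_form c (\<theta> \<alpha>) x) w = 0)}"

text \<open>The orthogonal complement, with respect to \<open>g\<close>, of the annihilator of \<open>\<theta>0\<close>.\<close>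
definition robinson_K ::
    "('a, 'e::real_normed_vector) atlas \<Rightarrow> ('a \<Rightarrow> 'e \<Rightarrow> real) \<Rightarrow>
     (real \<times> 'a \<Rightarrow> real \<times> 'e \<Rightarrow> real \<times> 'e \<Rightarrow> real) \<Rightarrow> real \<times> 'a \<Rightarrow> (real \<times> 'e) set" where
  "robinson_K c \<theta>0 g x = {k. \<forall>w. lift_form c \<theta>0 x w = 0 \<longrightarrow> g x k w = 0}"

text \<open>The orientation of the total space in which \<open>lam \<and> \<epsilon>\<close> is positive for positive \<open>\<epsilon>\<close> on the base.\<close>
definition total_orientation ::
    "('a, 'e::euclidean_space) atlas \<Rightarrow> ('a \<Rightarrow> ((nat \<Rightarrow> 'e) \<Rightarrow> real) set) \<Rightarrow>
     (real \<times> 'a \<Rightarrow> real \<times> 'e \<Rightarrow> real) \<Rightarrow> real \<times> 'a \<Rightarrow> ((nat \<Rightarrow> real \<times> 'e) \<Rightarrow> real) set" where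
  "total_orientation c ori lam x =
     {wedge1 DIM('e) (lam x) (form_pullback (line_bundle c) c snd x \<epsilon>) |\<epsilon>. \<epsilon> \<in> ori (snd x)}"

text \<open>The matrix \<open>P \<beta> \<alpha>\<close> has lower index \<open>\<beta>\<close> (first) and upper index \<open>\<alpha>\<close> (second).\<close>
definition inverse_matrices :: "nat \<Rightarrow> (nat \<Rightarrow> nat \<Rightarrow> complex) \<Rightarrow> (nat \<Rightarrow> nat \<Rightarrow> complex) \<Rightarrow> bool" where
  "inverse_matrices m P Q \<longleftrightarrow>
     (\<forall>\<alpha><m. \<forall>\<beta><m. (\<Sum>\<gamma><m. P \<alpha> \<gamma> * Q \<gamma> \<beta>) = (if \<alpha> = \<beta> then 1 else 0)) \<and>
     (\<forall>\<alpha><m. \<forall>\<beta><m. (\<Sum>\<gamma><m. Q \<alpha> \<gamma> * P \<gamma> \<beta>) = (if \<alpha> = \<beta> then 1 else 0))"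

text \<open>\<open>\<theta>0' = exp \<phi>0 \<theta>0\<close> and \<open>\<theta>'\<^sup>\<alpha> = \<psi>\<^sub>\<beta>\<^sup>\<alpha> \<theta>\<^sup>\<beta> + \<phi>\<^sup>\<alpha> \<theta>0\<close>, where \<open>\<psi>i\<close> is the inverse of the matrix \<open>\<psi>\<close>.\<close>
definition coframes_related ::
    "('a::topological_space, 'e::real_normed_vector) atlas \<Rightarrow> nat \<Rightarrow> ('a \<Rightarrow> real) \<Rightarrow> (nat \<Rightarrow> 'a \<Rightarrow> complex) \<Rightarrow>
     (nat \<Rightarrow> nat \<Rightarrow> 'a \<Rightarrow> complex) \<Rightarrow> (nat \<Rightarrow> nat \<Rightarrow> 'a \<Rightarrow> complex) \<Rightarrow>
     ('a \<Rightarrow> 'e \<Rightarrow> real) \<Rightarrow> (nat \<Rightarrow> 'a \<Rightarrow> 'e \<Rightarrow> complex) \<Rightarrow>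
     ('a \<Rightarrow> 'e \<Rightarrow> real) \<Rightarrow> (nat \<Rightarrow> 'a \<Rightarrow> 'e \<Rightarrow> complex) \<Rightarrow> bool" where
  "coframes_related c m \<phi>0 \<phi> \<psi> \<psi>i \<theta>0 \<theta> \<theta>0' \<theta>' \<longleftrightarrow>
     smooth_fun c \<phi>0 \<and> (\<forall>\<alpha><m. smooth_fun c (\<phi> \<alpha>)) \<and> (\<forall>\<alpha><m. \<forall>\<beta><m. smooth_fun c (\<psi> \<beta> \<alpha>)) \<and>
     (\<forall>p. inverse_matrices m (\<lambda>\<beta> \<alpha>. \<psi> \<beta> \<alpha> p) (\<lambda>\<beta> \<alpha>. \<psi>i \<beta> \<alpha> p)) \<and>
     (\<forall>p v. \<theta>0' p v = exp (\<phi>0 p) * \<theta>0 p v) \<and>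
     (\<forall>\<alpha><m. \<forall>p v. \<theta>' \<alpha> p v =
        (\<Sum>\<beta><m. \<psi> \<beta> \<alpha> p * \<theta> \<beta> p v) + \<phi> \<alpha> p * complex_of_real (\<theta>0 p v))"

text \<open>The lowered index \<open>\<phi>\<^sub>\<beta>\<close>, with respect to the Hermitian matrix \<open>h\<close>, of the pullback of \<open>\<phi>\<close>.\<close>
definition lower_index ::
    "nat \<Rightarrow> (nat \<Rightarrow> nat \<Rightarrow> real \<times> 'a \<Rightarrow> complex) \<Rightarrow> (nat \<Rightarrow> 'a \<Rightarrow> complex) \<Rightarrow> nat \<Rightarrow> real \<times> 'a \<Rightarrow> complex" where
  "lower_index m h \<phi> \<beta> x = (\<Sum>\<gamma><m. h \<beta> \<gamma> x * cnj (\<phi> \<gamma> (snd x)))"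

end

theory Submission
  imports Defs
begin

text \<open>
  At a point of the total space write \<open>T0\<close> and \<open>T \<alpha>\<close> for the pullbacks of \<open>\<theta>0\<close> and \<open>\<theta> \<alpha>\<close>, and \<open>\<partial>\<^sub>t\<close> for the
  vertical vector \<open>(1, 0)\<close>. The forms \<open>T0\<close> and \<open>T \<alpha>\<close> vanish exactly on the multiples of \<open>\<partial>\<^sub>t\<close>. The
  coframe itself provides a nowhere vanishing form of top degree on the base, so the condition on
  \<open>lam\<close> is not vacuous, and it says that \<open>lam(\<partial>\<^sub>t) \<noteq> 0\<close> (\<open>lam_vertical\<close>). Hence the values of \<open>T0\<close>,
  \<open>T \<alpha>\<close> and \<open>lam\<close> can be prescribed freely and determine a vector. Everything that concerns a single
  point is linear algebra with these values, in the locale \<open>robinson_point\<close>. A vector \<open>t\<close> with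
  \<open>T0 t = 1\<close>, \<open>T \<alpha> t = 0\<close>, \<open>lam t = - 1/4\<close> has \<open>g(t,t) = - 1\<close>, and \<open>g\<close> is positive definite on its
  orthogonal complement, so \<open>g\<close> is Lorentzian (\<open>G_lorentzian\<close>); timelike vectors have \<open>T0 \<noteq> 0\<close>, and
  the sign of \<open>T0\<close> separates the two cones (\<open>cone_eq\<close>); as \<open>g(\<partial>\<^sub>t, w) = 2 lam(\<partial>\<^sub>t) T0(w)\<close>, the orthogonal
  complement of the kernel of \<open>T0\<close> is spanned by \<open>\<partial>\<^sub>t\<close> (\<open>orthogonal_annihilator\<close>); and every term of
  \<open>g\<close> has a factor that vanishes on \<open>N\<close> (\<open>annihilator_null\<close>).

  The global part uses that the forms that define \<open>N\<close> are pulled back from the base. A smooth frame of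
  \<open>N\<close> is obtained from a coordinate frame by elimination, one 1-form at a time
  (\<open>annihilator_frame\<close>). A section of \<open>K\<close> is \<open>f \<partial>\<^sub>t\<close>, and in a product chart the equations of \<open>N\<close> do not
  depend on \<open>t\<close>, whence \<open>[K, N] \<subseteq> N\<close> (\<open>bracket_K_N\<close>). In such a chart \<open>g(\<partial>\<^sub>t, \<partial>\<^sub>t) = 0\<close> and
  \<open>\<partial>\<^sub>t g(\<partial>\<^sub>t, w)\<close> is a multiple of \<open>g(\<partial>\<^sub>t, w)\<close>, so that \<open>\<nabla>\<close> of \<open>\<partial>\<^sub>t\<close> along itself is a multiple of \<open>\<partial>\<^sub>t\<close>
  (\<open>christoffel_vertical\<close>) and the integral curves of \<open>K\<close>, which stay in the fibres of the projection,
  are null geodesics.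

  For the comparison of two triplets, the metrics are evaluated on pairs of vectors in the kernel of
  \<open>T0\<close>, which gives the relation between \<open>h\<close> and \<open>h'\<close>, and on the pairs formed by a vector with
  \<open>T0 = 1\<close>, \<open>T \<alpha> = 0\<close> and an arbitrary vector, which gives the formula for \<open>lam'\<close>
  (\<open>robinson_form_eq_iff\<close>).
\<close>

section \<open>Smooth functions between normed spaces\<close>

lemma ck_on_subset: "ck_on n S f \<Longrightarrow> T \<subseteq> S \<Longrightarrow> ck_on n T f"
proof (induction n arbitrary: f)
  case 0
  then show ?case by (auto intro: continuous_on_subset)
qed auto

lemma ck_on_cong:
  assumes "open S" "\<And>x. x \<in> S \<Longrightarrow> f x = g x" "ck_on n S f"
  shows "ck_on n S g"
  using assms(2,3)
proof (induction n arbitrary: f g)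
  case 0
  then show ?case by (auto intro: continuous_on_eq)
next
  case (Suc n)
  have d: "f differentiable at x" if "x \<in> S" for x using Suc that by auto
  have "g differentiable at x" if "x \<in> S" for x
    using d[OF that] assms(1) Suc.prems(1) that unfolding differentiable_def
    by (metis has_derivative_transform_within_open)
  moreover have "ck_on n S (\<lambda>x. frechet_derivative g (at x) v)" for v
  proof (rule Suc.IH)
    show "frechet_derivative f (at x) v = frechet_derivative g (at x) v" if "x \<in> S" for x
      using frechet_derivative_transform_within_open[OF d[OF that] assms(1) that] Suc.prems(1) by metis
  qed (use Suc in auto)
  ultimately show ?case by auto
qed

lemma ck_on_SucD: "ck_on (Suc n) S f \<Longrightarrow> ck_on n S f"
proof (induction n arbitrary: f)
  case 0
  then show ?case
    by (auto intro!: continuous_at_imp_continuous_on differentiable_imp_continuous_within)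
next
  case (Suc n)
  then show ?case by (metis ck_on.simps(2))
qed

text \<open>It suffices to know some expression \<open>f'\<close> for the derivative.\<close>
lemma ck_on_SucI:
  assumes "open S" "\<And>x. x \<in> S \<Longrightarrow> (f has_derivative f' x) (at x)"
    "\<And>v. ck_on n S (\<lambda>x. f' x v)"
  shows "ck_on (Suc n) S f"
proof -
  have "ck_on n S (\<lambda>x. frechet_derivative f (at x) v)" for v
    using assms(1) _ assms(3)
    by (rule ck_on_cong) (simp add: frechet_derivative_at[OF assms(2), symmetric])
  then show ?thesis using assms(2) by (auto simp: differentiable_def)
qed

lemma ck_on_SucE:
  assumes "ck_on (Suc n) S f" "x \<in> S"
  shows "(f has_derivative frechet_derivative f (at x)) (at x)"
  using assms by (simp add: frechet_derivative_works)

lemma ck_on_const: "open S \<Longrightarrow> ck_on n S (\<lambda>x. a)"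
proof (induction n arbitrary: a)
  case (Suc n)
  show ?case by (rule ck_on_SucI[where f' = "\<lambda>_ _. 0"]) (use Suc in auto)
qed auto

lemma ck_on_bounded_linear:
  assumes "open S" "bounded_linear f"
  shows "ck_on n S f"
proof (cases n)
  case 0
  then show ?thesis using assms linear_continuous_on by auto
next
  case (Suc k)
  show ?thesis unfolding Suc
    by (rule ck_on_SucI[where f' = "\<lambda>_. f"])
       (use assms bounded_linear_imp_has_derivative ck_on_const in auto)
qed

lemma ck_on_add:
  assumes "open S" "ck_on n S f" "ck_on n S g"
  shows "ck_on n S (\<lambda>x. f x + g x)"
  using assms(2,3)
proof (induction n arbitrary: f g)
  case 0
  then show ?case by (auto intro: continuous_on_add)
next
  case (Suc n)
  show ?case
  proof (rule ck_on_SucI[OF assms(1)])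
    show "((\<lambda>x. f x + g x) has_derivative
        (\<lambda>v. frechet_derivative f (at x) v + frechet_derivative g (at x) v)) (at x)" if "x \<in> S" for x
      by (rule has_derivative_add[OF Suc.prems[THEN ck_on_SucE[OF _ that]]])
    show "ck_on n S (\<lambda>x. frechet_derivative f (at x) v + frechet_derivative g (at x) v)" for v
      by (rule Suc.IH) (use Suc.prems in auto)
  qed
qed

lemma ck_on_sum:
  assumes "open S" "\<And>i. i \<in> I \<Longrightarrow> ck_on n S (f i)"
  shows "ck_on n S (\<lambda>x. \<Sum>i\<in>I. f i x)"
  using assms(2)
proof (induction I rule: infinite_finite_induct)
  case (insert i I)
  have "ck_on n S (\<lambda>x. f i x + (\<Sum>i\<in>I. f i x))"
    by (rule ck_on_add[OF assms(1)]) (use insert in auto)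
  then show ?case using insert by simp
qed (simp_all add: ck_on_const[OF assms(1)])

lemma ck_on_bilinear:
  assumes "open S" "bounded_bilinear B" "ck_on n S f" "ck_on n S g"
  shows "ck_on n S (\<lambda>x. B (f x) (g x))"
  using assms(3,4)
proof (induction n arbitrary: f g)
  case 0
  then show ?case using bounded_bilinear.continuous_on[OF assms(2)] by auto
next
  case (Suc n)
  have f: "ck_on n S f" and g: "ck_on n S g" using Suc ck_on_SucD by blast+
  show ?case
  proof (rule ck_on_SucI[OF assms(1)])
    show "((\<lambda>x. B (f x) (g x)) has_derivative
        (\<lambda>v. B (f x) (frechet_derivative g (at x) v) + B (frechet_derivative f (at x) v) (g x))) (at x)"
      if "x \<in> S" for x
      by (rule bounded_bilinear.FDERIV[OF assms(2) Suc.prems[THEN ck_on_SucE[OF _ that]]])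
    have 1: "ck_on n S (\<lambda>x. B (f x) (frechet_derivative g (at x) v))" for v
      by (rule Suc.IH) (use Suc.prems f in auto)
    have 2: "ck_on n S (\<lambda>x. B (frechet_derivative f (at x) v) (g x))" for v
      by (rule Suc.IH) (use Suc.prems g in auto)
    show "ck_on n S (\<lambda>x. B (f x) (frechet_derivative g (at x) v) + B (frechet_derivative f (at x) v) (g x))" for v
      by (rule ck_on_add[OF assms(1) 1 2])
  qed
qed

lemma linear_euclidean_sum:
  fixes f :: "'a::euclidean_space \<Rightarrow> 'b::real_vector"
  assumes "linear f"
  shows "f v = (\<Sum>b\<in>Basis. (v \<bullet> b) *\<^sub>R f b)"
proof -
  have "f (\<Sum>b\<in>Basis. (v \<bullet> b) *\<^sub>R b) = (\<Sum>b\<in>Basis. (v \<bullet> b) *\<^sub>R f b)"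
    by (simp only: linear_sum[OF assms] linear_cmul[OF assms])
  then show ?thesis by (simp only: euclidean_representation)
qed

text \<open>The chain rule is expanded in the basis of the middle space: the directional derivatives of
  \<open>g \<circ> f\<close> are combinations of the partial derivatives of \<open>g\<close> composed with \<open>f\<close>, to which the induction
  hypothesis applies.\<close>
lemma ck_on_compose:
  fixes f :: "'a::real_normed_vector \<Rightarrow> 'b::euclidean_space" and g :: "'b \<Rightarrow> 'c::real_normed_vector"
  assumes "open S" "open T" "f ` S \<subseteq> T" "ck_on n S f" "ck_on n T g"
  shows "ck_on n S (\<lambda>x. g (f x))"
  using assms(4,5)
proof (induction n arbitrary: g)
  case 0
  then show ?case using assms(3) by (auto intro: continuous_on_compose2)
next
  case (Suc n)
  have f: "ck_on n S f" using Suc ck_on_SucD by blast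
  have d: "((\<lambda>x. g (f x)) has_derivative (\<lambda>v. frechet_derivative g (at (f x)) (frechet_derivative f (at x) v))) (at x)"
    if "x \<in> S" for x
    using has_derivative_compose[OF ck_on_SucE[OF Suc.prems(1) that] ck_on_SucE[OF Suc.prems(2)]]
      that assms(3) by auto
  have eq: "frechet_derivative g (at (f x)) w = (\<Sum>b\<in>Basis. (w \<bullet> b) *\<^sub>R frechet_derivative g (at (f x)) b)"
    if "x \<in> S" for x w
  proof -
    have "linear (frechet_derivative g (at (f x)))"
      using ck_on_SucE[OF Suc.prems(2)] that assms(3) has_derivative_linear by blast
    then show ?thesis by (rule linear_euclidean_sum)
  qed
  show ?case
  proof (rule ck_on_SucI[OF assms(1)])
    show "((\<lambda>x. g (f x)) has_derivative (\<lambda>v. \<Sum>b\<in>Basis. (frechet_derivative f (at x) v \<bullet> b) *\<^sub>R frechet_derivative g (at (f x)) b)) (at x)"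
      if "x \<in> S" for x
      by (subst eq[OF that, symmetric]) (rule d[OF that])
    show "ck_on n S (\<lambda>x. \<Sum>b\<in>Basis. (frechet_derivative f (at x) v \<bullet> b) *\<^sub>R frechet_derivative g (at (f x)) b)" for v
    proof (rule ck_on_sum[OF assms(1)], rule ck_on_bilinear[OF assms(1) bounded_bilinear_scaleR])
      fix b :: 'b
      show "ck_on n S (\<lambda>x. frechet_derivative f (at x) v \<bullet> b)"
        by (rule ck_on_bilinear[OF assms(1) bounded_bilinear_inner _ ck_on_const[OF assms(1)]])
          (use Suc.prems in auto)
      show "ck_on n S (\<lambda>x. frechet_derivative g (at (f x)) b)"
        using Suc.IH[OF f] Suc.prems(2) by auto
    qed
  qed
qed

lemma ck_on_inverse:
  fixes f :: "'a::real_normed_vector \<Rightarrow> 'b::real_normed_field"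
  assumes "open S" "ck_on n S f" "\<And>x. x \<in> S \<Longrightarrow> f x \<noteq> 0"
  shows "ck_on n S (\<lambda>x. inverse (f x))"
  using assms(2)
proof (induction n)
  case 0
  then show ?case using assms(3) by (auto intro: continuous_on_inverse)
next
  case (Suc n)
  have 1: "ck_on n S (\<lambda>x. inverse (f x))" using Suc ck_on_SucD by blast
  show ?case
  proof (rule ck_on_SucI[OF assms(1)])
    show "((\<lambda>x. inverse (f x)) has_derivative
        (\<lambda>v. (- 1) * ((inverse (f x) * frechet_derivative f (at x) v) * inverse (f x)))) (at x)" if "x \<in> S" for x
      unfolding mult_minus1
      by (rule Deriv.has_derivative_inverse[OF assms(3)[OF that] ck_on_SucE[OF Suc.prems that]])
    have 2: "ck_on n S (\<lambda>x. frechet_derivative f (at x) v)" for v using Suc.prems by auto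
    note mult = ck_on_bilinear[OF assms(1) bounded_bilinear_mult]
    show "ck_on n S (\<lambda>x. (- 1) * ((inverse (f x) * frechet_derivative f (at x) v) * inverse (f x)))" for v
      by (rule mult[OF ck_on_const[OF assms(1)] mult[OF mult[OF 1 2] 1]])
  qed
qed

lemma smooth_on_subset: "smooth_on S f \<Longrightarrow> T \<subseteq> S \<Longrightarrow> smooth_on T f"
  by (auto simp: smooth_on_def intro: ck_on_subset)

lemma smooth_on_cong:
  "open S \<Longrightarrow> (\<And>x. x \<in> S \<Longrightarrow> f x = g x) \<Longrightarrow> smooth_on S f \<Longrightarrow> smooth_on S g"
  unfolding smooth_on_def by (rule allI, rule ck_on_cong[of S f g]) auto

lemma smooth_on_const: "open S \<Longrightarrow> smooth_on S (\<lambda>x. a)"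
  by (simp add: smooth_on_def ck_on_const)

lemma smooth_on_bounded_linear: "open S \<Longrightarrow> bounded_linear f \<Longrightarrow> smooth_on S f"
  by (simp add: smooth_on_def ck_on_bounded_linear)

lemma smooth_on_add:
  "open S \<Longrightarrow> smooth_on S f \<Longrightarrow> smooth_on S g \<Longrightarrow> smooth_on S (\<lambda>x. f x + g x)"
  unfolding smooth_on_def by (rule allI, rule ck_on_add) auto

lemma smooth_on_sum:
  "open S \<Longrightarrow> (\<And>i. i \<in> I \<Longrightarrow> smooth_on S (f i)) \<Longrightarrow> smooth_on S (\<lambda>x. \<Sum>i\<in>I. f i x)"
  unfolding smooth_on_def by (rule allI, rule ck_on_sum) auto

lemma smooth_on_bilinear:
  "open S \<Longrightarrow> bounded_bilinear B \<Longrightarrow> smooth_on S f \<Longrightarrow> smooth_on S g \<Longrightarrow> smooth_on S (\<lambda>x. B (f x) (g x))"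
  unfolding smooth_on_def by (rule allI, rule ck_on_bilinear) auto

lemma smooth_on_scaleR:
  "open S \<Longrightarrow> smooth_on S f \<Longrightarrow> smooth_on S g \<Longrightarrow> smooth_on S (\<lambda>x. f x *\<^sub>R g x)"
  by (rule smooth_on_bilinear[OF _ bounded_bilinear_scaleR])

lemma smooth_on_mult:
  fixes f :: "'a::real_normed_vector \<Rightarrow> 'b::real_normed_algebra"
  shows "open S \<Longrightarrow> smooth_on S f \<Longrightarrow> smooth_on S g \<Longrightarrow> smooth_on S (\<lambda>x. f x * g x)"
  by (rule smooth_on_bilinear[OF _ bounded_bilinear_mult])

lemma smooth_on_compose:
  fixes f :: "'a::real_normed_vector \<Rightarrow> 'b::euclidean_space" and g :: "'b \<Rightarrow> 'c::real_normed_vector"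
  assumes "open S" "open T" "f ` S \<subseteq> T" "smooth_on S f" "smooth_on T g"
  shows "smooth_on S (\<lambda>x. g (f x))"
  unfolding smooth_on_def
proof
  show "ck_on n S (\<lambda>x. g (f x))" for n
    by (rule ck_on_compose[OF assms(1-3)]) (use assms(4,5) in \<open>simp_all add: smooth_on_def\<close>)
qed

text \<open>Composition with a linear map needs no finite-dimensional space in the middle.\<close>
lemma smooth_on_linear_compose:
  fixes f :: "'a::real_normed_vector \<Rightarrow> 'b::real_normed_vector"
  assumes "open S" "bounded_linear L" "smooth_on S f"
  shows "smooth_on S (\<lambda>x. L (f x))"
proof -
  have "ck_on n S (\<lambda>x. L (f x))" if "ck_on n S f" for n
    using that
  proof (induction n arbitrary: f)
    case 0
    then show ?case using bounded_linear.continuous_on[OF assms(2)] by auto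
  next
    case (Suc n)
    have "ck_on n S (\<lambda>x. L (frechet_derivative f (at x) v))" for v
      by (rule Suc.IH) (use Suc.prems in simp)
    then show ?case
      by (intro ck_on_SucI[OF assms(1) bounded_linear.has_derivative[OF assms(2) ck_on_SucE[OF Suc.prems]]])
  qed
  then show ?thesis using assms(3) by (auto simp: smooth_on_def)
qed

lemma smooth_on_inverse:
  fixes f :: "'a::real_normed_vector \<Rightarrow> 'b::real_normed_field"
  shows "open S \<Longrightarrow> smooth_on S f \<Longrightarrow> (\<And>x. x \<in> S \<Longrightarrow> f x \<noteq> 0) \<Longrightarrow> smooth_on S (\<lambda>x. inverse (f x))"
  unfolding smooth_on_def by (rule allI, rule ck_on_inverse) auto

lemmas smooth_on_Re = smooth_on_linear_compose[OF _ bounded_linear_Re]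
  and smooth_on_Im = smooth_on_linear_compose[OF _ bounded_linear_Im]
  and smooth_on_of_real = smooth_on_linear_compose[OF _ bounded_linear_of_real]

lemma smooth_on_Pair:
  fixes f :: "'a::real_normed_vector \<Rightarrow> 'b::real_normed_vector" and g :: "'a \<Rightarrow> 'c::real_normed_vector"
  assumes "open S" "smooth_on S f" "smooth_on S g"
  shows "smooth_on S (\<lambda>x. (f x, g x))"
proof -
  have "bounded_linear (\<lambda>u. (u, 0 :: 'c))" "bounded_linear (\<lambda>u. (0 :: 'b, u))"
    by (intro bounded_linear_Pair bounded_linear_ident bounded_linear_zero)+
  then have "smooth_on S (\<lambda>x. (f x, 0 :: 'c))" "smooth_on S (\<lambda>x. (0 :: 'b, g x))"
    using smooth_on_linear_compose[OF assms(1) _ assms(2), of "\<lambda>u. (u, 0 :: 'c)"]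
      smooth_on_linear_compose[OF assms(1) _ assms(3), of "\<lambda>u. (0 :: 'b, u)"] by blast+
  then have "smooth_on S (\<lambda>x. (f x, 0) + (0, g x))"
    by (rule smooth_on_add[OF assms(1)])
  then show ?thesis by simp
qed

lemma smooth_on_continuous: "smooth_on S f \<Longrightarrow> continuous_on S f"
  by (auto simp: smooth_on_def dest: spec[of _ 0])

lemma smooth_on_has_derivative:
  "smooth_on S f \<Longrightarrow> x \<in> S \<Longrightarrow> (f has_derivative frechet_derivative f (at x)) (at x)"
  by (rule ck_on_SucE[of 0 S f]) (auto simp: smooth_on_def)

lemma smooth_on_directional:
  "smooth_on S f \<Longrightarrow> smooth_on S (\<lambda>x. frechet_derivative f (at x) v)"
  unfolding smooth_on_def
proof
  fix n assume "\<forall>n. ck_on n S f"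
  then have "ck_on (Suc n) S f" ..
  then show "ck_on n S (\<lambda>x. frechet_derivative f (at x) v)" by simp
qed

section \<open>Charts and coordinate changes\<close>

text \<open>A smooth manifold, given by its atlas.\<close>
locale smooth_mfd =
  fixes c :: "('a::{t2_space, second_countable_topology}, 'e::euclidean_space) atlas"
  assumes mfd: "smooth_manifold c"
begin

lemma mem_cdom [simp]: "p \<in> cdom c p"
  and open_cdom: "open (cdom c p)"
  and homeo: "homeomorphism (cdom c p) (cmap c p ` cdom c p) (cmap c p) (cinv c p)"
  and open_cmap_cdom: "open (cmap c p ` cdom c p)"
  using mfd by (auto simp: smooth_manifold_def)

lemma cinv_cmap [simp]: "q \<in> cdom c p \<Longrightarrow> cinv c p (cmap c p q) = q"
  using homeo[of p] by (auto simp: homeomorphism_def)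

lemma open_cmap_image:
  assumes "open U"
  shows "open (cmap c p ` (cdom c p \<inter> U))"
proof -
  have "openin (top_of_set (cmap c p ` cdom c p)) (cmap c p ` (cdom c p \<inter> U))"
    using homeo[of p] assms by (intro homeomorphism_imp_open_map[where S = "cdom c p"])
      (auto simp: openin_open)
  then show ?thesis using open_cmap_cdom openin_open_trans by blast
qed

lemma transition_smooth:
  "smooth_on (cmap c p ` (cdom c p \<inter> cdom c q)) (\<lambda>y. cmap c q (cinv c p y))"
  using mfd by (auto simp: smooth_manifold_def o_def)

lemma transition_has_derivative:
  assumes "r \<in> cdom c p" "r \<in> cdom c q"
  shows "((\<lambda>y. cmap c q (cinv c p y)) has_derivative tchange c p q r) (at (cmap c p r))"
  using smooth_on_has_derivative[OF transition_smooth[of p q], of "cmap c p r"] assms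
  by (auto simp: tchange_def o_def)

lemma tchange_linear: "r \<in> cdom c p \<Longrightarrow> r \<in> cdom c q \<Longrightarrow> linear (tchange c p q r)"
  using transition_has_derivative has_derivative_linear by blast

lemma tchange_self: "r \<in> cdom c p \<Longrightarrow> tchange c p p r v = v"
proof -
  assume r: "r \<in> cdom c p"
  have "((\<lambda>y. y) has_derivative (\<lambda>v. v)) (at (cmap c p r))" by simp
  then have "((\<lambda>y. cmap c p (cinv c p y)) has_derivative (\<lambda>v. v)) (at (cmap c p r))"
    by (rule has_derivative_transform_within_open[where s = "cmap c p ` cdom c p"])
      (use r open_cmap_cdom in auto)
  from has_derivative_unique[OF this transition_has_derivative[OF r r]]
  show ?thesis by metis
qed

text \<open>The cocycle identity for the changes of components.\<close>
lemma tchange_trans: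
  assumes "r \<in> cdom c p" "r \<in> cdom c q" "r \<in> cdom c s"
  shows "tchange c q s r (tchange c p q r v) = tchange c p s r v"
proof -
  let ?S = "cmap c p ` (cdom c p \<inter> (cdom c q \<inter> cdom c s))"
  have "((\<lambda>y. cmap c s (cinv c q (cmap c q (cinv c p y)))) has_derivative
      (\<lambda>v. tchange c q s r (tchange c p q r v))) (at (cmap c p r))"
    by (rule has_derivative_compose[OF transition_has_derivative[OF assms(1,2)]])
      (use transition_has_derivative[OF assms(2,3)] assms in simp)
  then have "((\<lambda>y. cmap c s (cinv c p y)) has_derivative
      (\<lambda>v. tchange c q s r (tchange c p q r v))) (at (cmap c p r))"
    by (rule has_derivative_transform_within_open[where s = ?S])
      (use assms open_cmap_image[OF open_Int[OF open_cdom open_cdom]] in auto)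
  from has_derivative_unique[OF this transition_has_derivative[OF assms(1,3)]]
  show ?thesis by metis
qed

section \<open>Smooth functions, vector fields and 1-forms\<close>

text \<open>Smoothness in all charts, without the continuity that \<^const>\<open>smooth_map_on\<close> asks for in addition.\<close>
definition smooth_fun_on :: "'a set \<Rightarrow> ('a \<Rightarrow> 'v::real_normed_vector) \<Rightarrow> bool" where
  "smooth_fun_on U f \<longleftrightarrow> (\<forall>p. smooth_on (cmap c p ` (cdom c p \<inter> U)) (\<lambda>y. f (cinv c p y)))"

lemma smooth_fun_onD: "smooth_fun_on U f \<Longrightarrow> smooth_on (cmap c p ` (cdom c p \<inter> U)) (\<lambda>y. f (cinv c p y))"
  by (simp add: smooth_fun_on_def)

lemma smooth_fun_imp_on: "smooth_fun c f \<Longrightarrow> smooth_fun_on UNIV f"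
  by (simp add: smooth_map_on_def smooth_fun_on_def euclidean_manifold_def o_def)

lemma smooth_fun_on_subset: "smooth_fun_on U f \<Longrightarrow> V \<subseteq> U \<Longrightarrow> smooth_fun_on V f"
  unfolding smooth_fun_on_def using smooth_on_subset by (metis Int_mono image_mono order_refl)

lemma smooth_fun_on_add: "open U \<Longrightarrow> smooth_fun_on U f \<Longrightarrow> smooth_fun_on U g \<Longrightarrow> smooth_fun_on U (\<lambda>x. f x + g x)"
  by (simp add: smooth_fun_on_def smooth_on_add open_cmap_image)

lemma smooth_fun_on_sum: "open U \<Longrightarrow> (\<And>i. i \<in> I \<Longrightarrow> smooth_fun_on U (f i)) \<Longrightarrow> smooth_fun_on U (\<lambda>x. \<Sum>i\<in>I. f i x)"
  by (simp add: smooth_fun_on_def smooth_on_sum open_cmap_image)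

lemma smooth_fun_on_mult:
  fixes f :: "'a \<Rightarrow> 'b::real_normed_algebra"
  shows "open U \<Longrightarrow> smooth_fun_on U f \<Longrightarrow> smooth_fun_on U g \<Longrightarrow> smooth_fun_on U (\<lambda>x. f x * g x)"
  by (simp add: smooth_fun_on_def smooth_on_mult open_cmap_image)

lemma smooth_fun_on_linear:
  assumes "open U" "bounded_linear L" "smooth_fun_on U f"
  shows "smooth_fun_on U (\<lambda>x. L (f x))"
  using assms(3) smooth_on_linear_compose[OF open_cmap_image[OF assms(1)] assms(2)]
  unfolding smooth_fun_on_def by blast

lemma smooth_fun_on_inverse:
  fixes f :: "'a \<Rightarrow> 'b::real_normed_field"
  assumes "open U" "smooth_fun_on U f" "\<And>x. x \<in> U \<Longrightarrow> f x \<noteq> 0"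
  shows "smooth_fun_on U (\<lambda>x. inverse (f x))"
  unfolding smooth_fun_on_def
proof
  fix p
  show "smooth_on (cmap c p ` (cdom c p \<inter> U)) (\<lambda>y. inverse (f (cinv c p y)))"
    by (rule smooth_on_inverse[OF open_cmap_image[OF assms(1)] smooth_fun_onD[OF assms(2)]])
      (use assms(3) in auto)
qed

lemma smooth_fun_on_continuous:
  assumes "open U" "smooth_fun_on U f"
  shows "continuous_on U f"
proof (rule continuous_at_imp_continuous_on, rule ballI)
  fix x assume x: "x \<in> U"
  have "continuous_on (cdom c x \<inter> U) (\<lambda>z. f (cinv c x (cmap c x z)))"
    by (rule continuous_on_compose2[OF smooth_on_continuous[OF smooth_fun_onD[OF assms(2), of x]]])
      (use homeo[of x] in \<open>auto simp: homeomorphism_def intro: continuous_on_subset\<close>)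
  then have "continuous_on (cdom c x \<inter> U) f"
    by (rule continuous_on_eq) auto
  then show "isCont f x"
    using x assms(1) open_cdom[of x] by (metis IntI continuous_on_eq_continuous_at mem_cdom open_Int)
qed

lemma vloc_eq: "r \<in> cdom c p \<Longrightarrow> vloc c p X (cmap c p r) = tchange c r p r (X r)"
  by (simp add: vloc_def)

lemma vector_field_onD:
  "vector_field_on c U X \<Longrightarrow> smooth_on (cmap c p ` (cdom c p \<inter> U)) (vloc c p X)"
  by (simp add: vector_field_on_def)

lemma vector_field_on_subset: "vector_field_on c U X \<Longrightarrow> V \<subseteq> U \<Longrightarrow> vector_field_on c V X"
  unfolding vector_field_on_def using smooth_on_subset by (metis Int_mono image_mono order_refl)

lemma vector_field_on_add:
  assumes "open U" "vector_field_on c U X" "vector_field_on c U Y"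
  shows "vector_field_on c U (\<lambda>r. X r + Y r)"
  unfolding vector_field_on_def
proof
  fix p
  show "smooth_on (cmap c p ` (cdom c p \<inter> U)) (vloc c p (\<lambda>r. X r + Y r))"
    by (rule smooth_on_cong[OF open_cmap_image[OF assms(1)] _
          smooth_on_add[OF open_cmap_image[OF assms(1)] assms(2,3)[THEN vector_field_onD]]])
      (auto simp: vloc_eq linear_add[OF tchange_linear])
qed

lemma vector_field_on_scaleR:
  assumes "open U" "smooth_fun_on U f" "vector_field_on c U X"
  shows "vector_field_on c U (\<lambda>r. f r *\<^sub>R X r)"
  unfolding vector_field_on_def
proof
  fix p
  show "smooth_on (cmap c p ` (cdom c p \<inter> U)) (vloc c p (\<lambda>r. f r *\<^sub>R X r))"
    by (rule smooth_on_cong[OF open_cmap_image[OF assms(1)] _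
          smooth_on_scaleR[OF open_cmap_image[OF assms(1)] smooth_fun_onD[OF assms(2)] vector_field_onD[OF assms(3)]]])
      (auto simp: vloc_eq linear_cmul[OF tchange_linear])
qed

text \<open>The field with constant components \<open>u\<close> in the chart at \<open>p\<close>.\<close>
lemma constant_vector_field: "vector_field_on c (cdom c p) (\<lambda>r. tchange c p r r u)"
  unfolding vector_field_on_def
proof
  fix q
  let ?S = "cmap c q ` (cdom c q \<inter> cdom c p)" and ?T = "cmap c p ` (cdom c p \<inter> cdom c q)"
  have op: "open ?S" "open ?T" using open_cmap_image open_cdom by auto
  have "smooth_on ?S (\<lambda>y. frechet_derivative (\<lambda>y. cmap c q (cinv c p y)) (at (cmap c p (cinv c q y))) u)"
    by (rule smooth_on_compose[OF op _ transition_smooth smooth_on_directional[OF transition_smooth]]) auto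
  then show "smooth_on ?S (vloc c q (\<lambda>r. tchange c p r r u))"
    by (rule smooth_on_cong[OF op(1), rotated])
      (auto simp: vloc_eq tchange_trans, simp add: tchange_def o_def)
qed

lemma one_form_on_subset: "one_form_on c U \<theta> \<Longrightarrow> V \<subseteq> U \<Longrightarrow> one_form_on c V \<theta>"
  unfolding one_form_on_def by (blast intro: smooth_on_subset)

lemma one_form_on_linear: "one_form_on c U \<theta> \<Longrightarrow> p \<in> U \<Longrightarrow> linear (\<theta> p)"
  by (simp add: one_form_on_def)

lemma one_form_on_of_real:
  assumes U: "open U" and \<theta>: "one_form_on c U \<theta>"
  shows "one_form_on c U (\<lambda>p v. complex_of_real (\<theta> p v))"
  unfolding one_form_on_def
proof (intro conjI ballI allI)
  fix p assume "p \<in> U"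
  from linear_compose[OF one_form_on_linear[OF \<theta> this] bounded_linear.linear[OF bounded_linear_of_real]]
  show "linear (\<lambda>v. complex_of_real (\<theta> p v))" by (simp add: o_def)
next
  fix p u
  show "smooth_on (cmap c p ` (cdom c p \<inter> U)) (\<lambda>y. let r = cinv c p y in complex_of_real (\<theta> r (tchange c p r r u)))"
    unfolding Let_def using \<theta>
    by (intro smooth_on_of_real[OF open_cmap_image[OF U]]) (simp add: one_form_on_def Let_def)
qed

text \<open>In a chart, \<open>\<theta>(X)\<close> is the sum of the products of the components of \<open>\<theta>\<close> and of \<open>X\<close>.\<close>
lemma one_form_apply_smooth:
  fixes \<theta> :: "'a \<Rightarrow> 'e \<Rightarrow> 'v::real_normed_vector"
  assumes "open U" "one_form_on c U \<theta>" "vector_field_on c U X"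
  shows "smooth_fun_on U (\<lambda>r. \<theta> r (X r))"
  unfolding smooth_fun_on_def
proof
  fix p
  let ?S = "cmap c p ` (cdom c p \<inter> U)"
  have op: "open ?S" using open_cmap_image assms(1) .
  have 1: "smooth_on ?S (\<lambda>y. \<Sum>b\<in>Basis. (vloc c p X y \<bullet> b) *\<^sub>R \<theta> (cinv c p y) (tchange c p (cinv c p y) (cinv c p y) b))"
  proof (rule smooth_on_sum[OF op], rule smooth_on_scaleR[OF op])
    show "smooth_on ?S (\<lambda>y. vloc c p X y \<bullet> b)" for b
      by (rule smooth_on_linear_compose[OF op bounded_linear_inner_left vector_field_onD[OF assms(3)]])
    show "smooth_on ?S (\<lambda>y. \<theta> (cinv c p y) (tchange c p (cinv c p y) (cinv c p y) b))" for b
      using assms(2) by (simp add: one_form_on_def Let_def)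
  qed
  show "smooth_on ?S (\<lambda>y. \<theta> (cinv c p y) (X (cinv c p y)))"
  proof (rule smooth_on_cong[OF op _ 1])
    fix y assume "y \<in> ?S"
    then obtain r where r: "r \<in> cdom c p" "r \<in> U" "y = cmap c p r" by auto
    have lin: "linear (\<lambda>v. \<theta> r (tchange c p r r v))"
      using linear_compose[OF tchange_linear[OF r(1) mem_cdom] one_form_on_linear[OF assms(2) r(2)]]
      by (simp add: o_def)
    have "\<theta> r (X r) = \<theta> r (tchange c p r r (vloc c p X y))"
      using r by (simp add: vloc_eq tchange_trans tchange_self)
    also have "\<dots> = (\<Sum>b\<in>Basis. (vloc c p X y \<bullet> b) *\<^sub>R \<theta> r (tchange c p r r b))"
      by (rule linear_euclidean_sum[OF lin])
    finally show "(\<Sum>b\<in>Basis. (vloc c p X y \<bullet> b) *\<^sub>R \<theta> (cinv c p y) (tchange c p (cinv c p y) (cinv c p y) b))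
        = \<theta> (cinv c p y) (X (cinv c p y))"
      using r by simp
  qed
qed

end

section \<open>The product with the real line\<close>

lemma cdom_product [simp]: "cdom (product_manifold c d) x = cdom c (fst x) \<times> cdom d (snd x)"
  and cmap_product [simp]: "cmap (product_manifold c d) x = map_prod (cmap c (fst x)) (cmap d (snd x))"
  by (simp_all add: product_manifold_def)

lemma cdom_euclidean [simp]: "cdom euclidean_manifold x = UNIV"
  and cmap_euclidean [simp]: "cmap euclidean_manifold x = (\<lambda>y. y)"
  by (simp_all add: euclidean_manifold_def)

lemma cinv_euclidean [simp]: "cinv euclidean_manifold x = (\<lambda>y. y)"
  by (rule ext) (simp add: cinv_def inv_into_f_eq)

lemma line_image:
  "map_prod (\<lambda>y. y) f ` ((UNIV \<times> S) \<inter> (UNIV \<times> T)) = UNIV \<times> f ` (S \<inter> T)"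
  by force

context smooth_mfd
begin

lemma cinv_line [simp]:
  assumes "q \<in> cdom c (snd x)"
  shows "cinv (line_bundle c) x (s, cmap c (snd x) q) = (s, q)"
proof -
  have "inj_on (cmap c (snd x)) (cdom c (snd x))"
    by (rule inj_on_inverseI[where g = "cinv c (snd x)"]) simp
  then have "inj_on (map_prod (\<lambda>y. y) (cmap c (snd x)) :: real \<times> 'a \<Rightarrow> _) (UNIV \<times> cdom c (snd x))"
    by (auto simp: inj_on_def)
  then show ?thesis
    unfolding cinv_def by (intro inv_into_f_eq) (use assms in auto)
qed

lemma smooth_manifold_line: "smooth_manifold (line_bundle c)"
  unfolding smooth_manifold_def
proof (intro conjI allI)
  fix p q :: "real \<times> 'a"
  let ?U = "cdom c (snd p)" and ?f = "cmap c (snd p)" and ?L = "line_bundle c"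
  have im: "cmap ?L p ` cdom ?L p = UNIV \<times> ?f ` ?U"
    using line_image[of ?f ?U UNIV] by simp
  show "p \<in> cdom ?L p" by (simp add: mem_Times_iff)
  show "open (cdom ?L p)" by (simp add: open_Times open_cdom)
  show "open (cmap ?L p ` cdom ?L p)" unfolding im by (simp add: open_Times open_cmap_cdom)
  have cont: "continuous_on ?U ?f" "continuous_on (?f ` ?U) (cinv c (snd p))"
    using homeo[of "snd p"] by (auto simp: homeomorphism_def)
  show "homeomorphism (cdom ?L p) (cmap ?L p ` cdom ?L p) (cmap ?L p) (cinv ?L p)"
  proof (rule homeomorphismI)
    show "continuous_on (cdom ?L p) (cmap ?L p)"
      unfolding cmap_product map_prod_def case_prod_unfold cdom_product cmap_euclidean
      by (intro continuous_on_Pair continuous_on_compose2[OF cont(1)] continuous_on_fst continuous_on_snd continuous_on_id) auto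
    have "continuous_on (UNIV \<times> ?f ` ?U) (\<lambda>z. (fst z, cinv c (snd p) (snd z)) :: real \<times> 'a)"
      by (intro continuous_on_Pair continuous_on_compose2[OF cont(2)] continuous_on_fst continuous_on_snd continuous_on_id) auto
    then show "continuous_on (cmap ?L p ` cdom ?L p) (cinv ?L p)"
      unfolding im by (rule continuous_on_eq) auto
  qed auto
  let ?S = "?f ` (?U \<inter> cdom c (snd q))"
  have op: "open (UNIV \<times> ?S :: (real \<times> 'e) set)" by (simp add: open_Times open_cmap_image open_cdom)
  have eq: "cmap ?L p ` (cdom ?L p \<inter> cdom ?L q) = UNIV \<times> ?S"
    using line_image[of ?f ?U "cdom c (snd q)"] by simp
  have op': "open ?S" by (simp add: open_cmap_image open_cdom)
  have "smooth_on (UNIV \<times> ?S) (\<lambda>z :: real \<times> 'e. (fst z, cmap c (snd q) (cinv c (snd p) (snd z))))"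
    by (rule smooth_on_Pair[OF op smooth_on_bounded_linear[OF op bounded_linear_fst]
        smooth_on_compose[OF op op' _ smooth_on_bounded_linear[OF op bounded_linear_snd] transition_smooth]]) auto
  then show "smooth_on (cmap ?L p ` (cdom ?L p \<inter> cdom ?L q)) (cmap ?L q \<circ> cinv ?L p)"
    unfolding eq by (rule smooth_on_cong[OF op, rotated]) auto
qed

end

text \<open>A smooth manifold together with the trivial line bundle over it. The second instance is a
  consequence of the first (lemma \<open>line_mfd\<close> below).\<close>
locale line_mfd = smooth_mfd c + line: smooth_mfd "line_bundle c"
  for c :: "('a::{t2_space, second_countable_topology}, 'e::euclidean_space) atlas"
begin

lemma tchange_line:
  assumes "snd z \<in> cdom c (snd x)" "snd z \<in> cdom c (snd x')"
  shows "tchange (line_bundle c) x x' z v = (fst v, tchange c (snd x) (snd x') (snd z) (snd v))"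
proof -
  let ?L = "line_bundle c" and ?z = "map_prod (\<lambda>y. y) (cmap c (snd x)) z"
  let ?S = "UNIV \<times> cmap c (snd x) ` (cdom c (snd x) \<inter> cdom c (snd x'))"
  have "((\<lambda>w. (fst w, cmap c (snd x') (cinv c (snd x) (snd w)))) has_derivative
     (\<lambda>v. (fst v, tchange c (snd x) (snd x') (snd z) (snd v)))) (at ?z)"
  proof (rule has_derivative_Pair)
    show "((\<lambda>w. fst w) has_derivative (\<lambda>v. fst v)) (at ?z)"
      by (rule has_derivative_fst[OF has_derivative_ident])
    have "((\<lambda>y. cmap c (snd x') (cinv c (snd x) y)) has_derivative tchange c (snd x) (snd x') (snd z)) (at (snd ?z))"
      using transition_has_derivative[OF assms] by simp
    from has_derivative_compose[OF has_derivative_snd[OF has_derivative_ident] this]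
    show "((\<lambda>w. cmap c (snd x') (cinv c (snd x) (snd w))) has_derivative
        (\<lambda>v. tchange c (snd x) (snd x') (snd z) (snd v))) (at ?z)" .
  qed
  then have "((\<lambda>w. cmap ?L x' (cinv ?L x w)) has_derivative
     (\<lambda>v. (fst v, tchange c (snd x) (snd x') (snd z) (snd v)))) (at ?z)"
    by (rule has_derivative_transform_within_open[where s = ?S])
      (use assms in \<open>auto simp: open_Times open_cmap_image open_cdom mem_Times_iff\<close>)
  moreover have "((\<lambda>w. cmap ?L x' (cinv ?L x w)) has_derivative tchange ?L x x' z) (at ?z)"
    using line.transition_has_derivative[of z x x'] assms by (simp add: mem_Times_iff)
  ultimately have "tchange ?L x x' z = (\<lambda>v. (fst v, tchange c (snd x) (snd x') (snd z) (snd v)))"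
    using has_derivative_unique by blast
  then show ?thesis by simp
qed

lemma mderiv_snd: "mderiv (line_bundle c) c snd x = snd"
proof -
  let ?L = "line_bundle c" and ?x = "cmap (line_bundle c) x x"
  have "(snd has_derivative snd) (at ?x)"
    by (rule bounded_linear_imp_has_derivative[OF bounded_linear_snd])
  then have "(cmap c (snd x) \<circ> snd \<circ> cinv ?L x has_derivative snd) (at ?x)"
    by (rule has_derivative_transform_within_open[where s = "UNIV \<times> cmap c (snd x) ` cdom c (snd x)"])
      (auto simp: open_Times open_cmap_cdom mem_Times_iff)
  then show ?thesis unfolding mderiv_def by (rule frechet_derivative_at[symmetric])
qed

lemma lift_form_apply: "lift_form c \<theta> x v = \<theta> (snd x) (snd v)"
  by (simp add: pullback_def mderiv_snd)

lemma line_chart_image: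
  "cmap (line_bundle c) p ` (cdom (line_bundle c) p \<inter> (UNIV \<times> U)) = UNIV \<times> cmap c (snd p) ` (cdom c (snd p) \<inter> U)"
  using line_image[of "cmap c (snd p)" "cdom c (snd p)" U] by simp

text \<open>A function of the base point, smooth in the chart at \<open>snd p\<close>, is smooth in the chart at \<open>p\<close>.\<close>
lemma smooth_on_line:
  fixes f :: "'e \<Rightarrow> 'v::real_normed_vector"
  assumes "open U" "smooth_on (cmap c (snd p) ` (cdom c (snd p) \<inter> U)) f"
  shows "smooth_on (cmap (line_bundle c) p ` (cdom (line_bundle c) p \<inter> (UNIV \<times> U))) (\<lambda>y. f (snd y))"
  unfolding line_chart_image
  by (rule smooth_on_compose[OF _ _ _ smooth_on_bounded_linear[OF _ bounded_linear_snd] assms(2)])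
    (auto intro!: open_Times open_cmap_image assms(1))

lemma one_form_on_lift:
  assumes "open U" "one_form_on c U \<theta>"
  shows "one_form_on (line_bundle c) (UNIV \<times> U) (lift_form c \<theta>)"
  unfolding one_form_on_def
proof (intro conjI allI ballI)
  fix p :: "real \<times> 'a" assume "p \<in> UNIV \<times> U"
  then have "linear (\<theta> (snd p))" using assms(2) by (auto simp: one_form_on_def)
  from linear_compose[OF bounded_linear.linear[OF bounded_linear_snd] this]
  show "linear (lift_form c \<theta> p)" by (simp add: lift_form_apply[abs_def] o_def)
next
  fix p :: "real \<times> 'a" and u
  let ?L = "line_bundle c"
  show "smooth_on (cmap ?L p ` (cdom ?L p \<inter> (UNIV \<times> U)))
      (\<lambda>y. let r = cinv ?L p y in lift_form c \<theta> r (tchange ?L p r r u))"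
    by (rule smooth_on_cong[OF _ _ smooth_on_line[OF assms(1),
          of p "\<lambda>y. let r = cinv c (snd p) y in \<theta> r (tchange c (snd p) r r (snd u))"]])
      (use assms in \<open>auto intro!: open_cmap_image open_Times simp: line_chart_image one_form_on_def
        lift_form_apply tchange_line simp del: cdom_product cmap_product\<close>)
qed

end

lemma (in smooth_mfd) line_mfd: "line_mfd c"
  by unfold_locales (rule smooth_manifold_line)

section \<open>Coframes and their dual vectors\<close>

text \<open>Linearly independent 1-forms take arbitrary prescribed values on a suitable vector: represented as
  inner products, they are independent vectors, on which a linear function can be prescribed.\<close>
lemma dual_vectors:
  fixes \<eta> :: "nat \<Rightarrow> 'e::euclidean_space \<Rightarrow> real"
  assumes lin: "\<And>i. i < n \<Longrightarrow> linear (\<eta> i)"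
    and ind: "\<And>r. (\<forall>v. (\<Sum>i<n. r i * \<eta> i v) = 0) \<Longrightarrow> \<forall>i<n. r i = 0"
  shows "\<exists>v. \<forall>i<n. \<eta> i v = a i"
proof -
  define w where "w i = (\<Sum>b\<in>Basis. \<eta> i b *\<^sub>R b)" for i
  have \<eta>: "\<eta> i v = v \<bullet> w i" if "i < n" for i v
    using linear_euclidean_sum[OF lin[OF that], of v]
    by (simp add: w_def inner_sum_right mult.commute)
  have inj: "inj_on w {..<n}"
  proof (rule inj_onI, rule ccontr)
    fix i j assume ij: "i \<in> {..<n}" "j \<in> {..<n}" "w i = w j" "i \<noteq> j"
    let ?r = "\<lambda>k. (if k = i then 1 else 0) - (if k = j then 1 else 0 :: real)"
    have "(\<Sum>k<n. ?r k * \<eta> k v) = 0" for v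
    proof -
      have "(\<Sum>k<n. ?r k * \<eta> k v) = (\<Sum>k<n. (if k = i then \<eta> k v else 0)) - (\<Sum>k<n. (if k = j then \<eta> k v else 0))"
        unfolding sum_subtractf[symmetric] by (rule sum.cong) auto
      then show ?thesis using ij by (simp add: \<eta>)
    qed
    from ind[of ?r] this ij show False by force
  qed
  have "independent (w ` {..<n})"
  proof (subst independent_explicit_finite_subsets, intro allI impI ballI)
    fix S u x
    assume S: "S \<subseteq> w ` {..<n}" "finite S" "(\<Sum>v\<in>S. u v *\<^sub>R v) = 0" "x \<in> S"
    define r where "r i = (if w i \<in> S then u (w i) else 0)" for i
    have "(\<Sum>i<n. r i * \<eta> i v) = v \<bullet> (\<Sum>v\<in>S. u v *\<^sub>R v)" for v
    proof -
      have "(\<Sum>i<n. r i * \<eta> i v) = (\<Sum>i<n. v \<bullet> ((if w i \<in> S then u (w i) else 0) *\<^sub>R w i))"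
        by (rule sum.cong) (auto simp: \<eta> r_def)
      also have "\<dots> = (\<Sum>x\<in>w ` {..<n}. v \<bullet> ((if x \<in> S then u x else 0) *\<^sub>R x))"
        by (simp add: sum.reindex[OF inj])
      also have "\<dots> = (\<Sum>x\<in>S. v \<bullet> (u x *\<^sub>R x))"
        by (rule sum.mono_neutral_cong_right) (use S in auto)
      finally show ?thesis by (simp add: inner_sum_right)
    qed
    then have "\<forall>i<n. r i = 0" by (intro ind) (simp add: S)
    moreover obtain i where "i < n" "x = w i" using S by auto
    ultimately show "u x = 0" using S(4) by (auto simp: r_def)
  qed
  then obtain f where f: "linear f" "\<forall>x\<in>w ` {..<n}. f x = a (inv_into {..<n} w x)"
    using linear_independent_extend[of "w ` {..<n}" "\<lambda>x. a (inv_into {..<n} w x)"] by blast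
  define v where "v = (\<Sum>b\<in>Basis. f b *\<^sub>R b)"
  have "\<eta> i v = a i" if i: "i < n" for i
  proof -
    have "\<eta> i v = f (w i)"
      using linear_euclidean_sum[OF f(1), of "w i"]
      by (simp add: \<eta>[OF i] v_def inner_sum_left inner_commute[of "w i"] mult.commute)
    then show ?thesis using f(2) i by (simp add: inv_into_f_f[OF inj])
  qed
  then show ?thesis by blast
qed

text \<open>The real and imaginary parts of a coframe, as a sequence of \<open>2 m + 1\<close> real 1-forms.\<close>
definition real_coframe :: "('e \<Rightarrow> real) \<Rightarrow> (nat \<Rightarrow> 'e \<Rightarrow> complex) \<Rightarrow> nat \<Rightarrow> 'e \<Rightarrow> real" where
  "real_coframe \<theta>0 \<theta> i v =
     (if i = 0 then \<theta>0 v else if odd i then Re (\<theta> ((i - 1) div 2) v) else Im (\<theta> ((i - 1) div 2) v))"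

lemma sum_odd_even: "(\<Sum>i<2 * m + 1. f i) = f 0 + (\<Sum>\<alpha><m. f (2 * \<alpha> + 1) + f (2 * \<alpha> + 2))"
  for f :: "nat \<Rightarrow> 'b::comm_monoid_add"
  by (induction m) (auto simp: algebra_simps)

text \<open>The values of a coframe determine the vector, since inner products with \<open>v\<close> are combinations of the
  coframe.\<close>
lemma coframe_inj:
  fixes \<theta>0 :: "'e::euclidean_space \<Rightarrow> real"
  assumes "coframe m \<theta>0 \<theta>" "\<theta>0 v = 0" "\<forall>\<alpha><m. \<theta> \<alpha> v = 0"
  shows "v = 0"
proof -
  have "linear (\<lambda>w. complex_of_real (w \<bullet> v))"
    by (rule linearI) (simp_all add: inner_left_distrib scaleR_conv_of_real)
  then obtain a b b' where *: "\<forall>w. complex_of_real (w \<bullet> v) =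
      a * complex_of_real (\<theta>0 w) + (\<Sum>\<alpha><m. b \<alpha> * \<theta> \<alpha> w) + (\<Sum>\<alpha><m. b' \<alpha> * cnj (\<theta> \<alpha> w))"
    using assms(1) unfolding coframe_def by blast
  have "complex_of_real (v \<bullet> v) = 0" using *[rule_format, of v] assms(2,3) by simp
  then show ?thesis by simp
qed

lemma real_coframe_linear:
  fixes \<theta>0 :: "'e::real_vector \<Rightarrow> real"
  assumes "linear \<theta>0" "\<And>\<alpha>. \<alpha> < m \<Longrightarrow> linear (\<theta> \<alpha>)" "i < 2 * m + 1"
  shows "linear (real_coframe \<theta>0 \<theta> i)"
proof (cases "i = 0")
  case True
  then show ?thesis using assms by (simp add: real_coframe_def[abs_def])
next
  case False
  define k where "k = (i - 1) div 2"
  have "k < m" using assms(3) False by (auto simp: k_def)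
  then have l: "linear (\<theta> k)" by (rule assms(2))
  have "linear (\<lambda>v. Re (\<theta> k v))" "linear (\<lambda>v. Im (\<theta> k v))"
    using linear_compose[OF l bounded_linear.linear[OF bounded_linear_Re]]
      linear_compose[OF l bounded_linear.linear[OF bounded_linear_Im]] by (simp_all add: o_def)
  then show ?thesis using False unfolding real_coframe_def[abs_def] k_def[symmetric]
    by (cases "odd i") simp_all
qed

lemma real_coframe_dual:
  fixes \<theta>0 :: "'e::euclidean_space \<Rightarrow> real"
  assumes co: "coframe m \<theta>0 \<theta>" and "linear \<theta>0" "\<And>\<alpha>. \<alpha> < m \<Longrightarrow> linear (\<theta> \<alpha>)"
  shows "\<exists>v. \<forall>i<2 * m + 1. real_coframe \<theta>0 \<theta> i v = a i"
proof (rule dual_vectors)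
  show "linear (real_coframe \<theta>0 \<theta> i)" if "i < 2 * m + 1" for i
    by (rule real_coframe_linear) (use assms that in auto)
  fix r :: "nat \<Rightarrow> real" assume r: "\<forall>v. (\<Sum>i<2 * m + 1. r i * real_coframe \<theta>0 \<theta> i v) = 0"
  (* Re z = (z + cnj z) / 2 and Im z = (z - cnj z) / (2 i) turn a real relation into a complex one. *)
  define b where "b \<alpha> = (complex_of_real (r (2 * \<alpha> + 1)) - \<i> * complex_of_real (r (2 * \<alpha> + 2))) / 2" for \<alpha>
  have split: "complex_of_real (r (2 * \<alpha> + 1) * Re z + r (2 * \<alpha> + 2) * Im z) = b \<alpha> * z + cnj (b \<alpha>) * cnj z" for \<alpha> z
    by (simp add: b_def complex_eq_iff field_simps)
  have "complex_of_real (r 0) * complex_of_real (\<theta>0 v) + (\<Sum>\<alpha><m. b \<alpha> * \<theta> \<alpha> v) + (\<Sum>\<alpha><m. cnj (b \<alpha>) * cnj (\<theta> \<alpha> v)) = 0" for v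
  proof -
    have "(\<Sum>i<2 * m + 1. r i * real_coframe \<theta>0 \<theta> i v) =
        r 0 * \<theta>0 v + (\<Sum>\<alpha><m. r (2 * \<alpha> + 1) * Re (\<theta> \<alpha> v) + r (2 * \<alpha> + 2) * Im (\<theta> \<alpha> v))"
      unfolding sum_odd_even by (simp add: real_coframe_def)
    then have "0 = complex_of_real (r 0 * \<theta>0 v + (\<Sum>\<alpha><m. r (2 * \<alpha> + 1) * Re (\<theta> \<alpha> v) + r (2 * \<alpha> + 2) * Im (\<theta> \<alpha> v)))"
      using r by simp
    also have "\<dots> = complex_of_real (r 0) * complex_of_real (\<theta>0 v) +
        (\<Sum>\<alpha><m. complex_of_real (r (2 * \<alpha> + 1) * Re (\<theta> \<alpha> v) + r (2 * \<alpha> + 2) * Im (\<theta> \<alpha> v)))"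
      by (simp only: of_real_add of_real_mult of_real_sum)
    also have "\<dots> = complex_of_real (r 0) * complex_of_real (\<theta>0 v) + (\<Sum>\<alpha><m. b \<alpha> * \<theta> \<alpha> v) + (\<Sum>\<alpha><m. cnj (b \<alpha>) * cnj (\<theta> \<alpha> v))"
      by (simp only: split sum.distrib add.assoc)
    finally show ?thesis by simp
  qed
  then have 0: "complex_of_real (r 0) = 0 \<and> (\<forall>\<alpha><m. b \<alpha> = 0 \<and> cnj (b \<alpha>) = 0)"
    using co[unfolded coframe_def, THEN conjunct1, rule_format, of "complex_of_real (r 0)" b "\<lambda>\<alpha>. cnj (b \<alpha>)"]
    by blast
  have "r i = 0" if i: "i < 2 * m + 1" for i
  proof (cases "i = 0")
    case False
    define \<alpha> where "\<alpha> = (i - 1) div 2"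
    have "\<alpha> < m" "i = 2 * \<alpha> + 1 \<or> i = 2 * \<alpha> + 2" using False i unfolding \<alpha>_def by presburger+
    moreover have "r (2 * \<alpha> + 1) = 0 \<and> r (2 * \<alpha> + 2) = 0" if "b \<alpha> = 0" for \<alpha>
      using that by (simp add: b_def complex_eq_iff)
    ultimately show ?thesis using 0 by blast
  qed (use 0 in simp)
  then show "\<forall>i<2 * m + 1. r i = 0" by blast
qed

lemma coframe_solve:
  fixes \<theta>0 :: "'e::euclidean_space \<Rightarrow> real"
  assumes "coframe m \<theta>0 \<theta>" "linear \<theta>0" "\<And>\<alpha>. \<alpha> < m \<Longrightarrow> linear (\<theta> \<alpha>)"
  shows "\<exists>v. \<theta>0 v = a0 \<and> (\<forall>\<alpha><m. \<theta> \<alpha> v = a \<alpha>)"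
proof -
  obtain v where v: "\<forall>i<2 * m + 1. real_coframe \<theta>0 \<theta> i v =
      (if i = 0 then a0 else if odd i then Re (a ((i - 1) div 2)) else Im (a ((i - 1) div 2)))"
    using real_coframe_dual[OF assms, of "\<lambda>i. if i = 0 then a0 else if odd i
      then Re (a ((i - 1) div 2)) else Im (a ((i - 1) div 2))"] by (rule exE)
  have "\<theta> \<alpha> v = a \<alpha>" if "\<alpha> < m" for \<alpha>
    using v[rule_format, of "2 * \<alpha> + 1"] v[rule_format, of "2 * \<alpha> + 2"] that
    by (simp add: real_coframe_def complex_eq_iff)
  moreover have "\<theta>0 v = a0" using v[rule_format, of 0] by (simp add: real_coframe_def)
  ultimately show ?thesis by blast
qed

section \<open>A criterion for Lorentzian signature\<close>

lemma bilinear_sum_left: "bilinear b \<Longrightarrow> b (\<Sum>i\<in>I. f i) v = (\<Sum>i\<in>I. b (f i) v)"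
  using linear_sum[of "\<lambda>x. b x v"] by (simp add: bilinear_def)

text \<open>Gram--Schmidt orthonormalisation for a form that is positive definite on a subspace.\<close>
lemma gram_schmidt:
  fixes b :: "'v::real_vector \<Rightarrow> 'v \<Rightarrow> real"
  assumes bil: "bilinear b" and sym: "\<And>u v. b u v = b v u"
    and W: "subspace W" and pos: "\<And>v. v \<in> W \<Longrightarrow> v \<noteq> 0 \<Longrightarrow> b v v > 0"
    and S: "finite S" "S \<subseteq> W"
  shows "\<exists>B. finite B \<and> B \<subseteq> W \<and> span B = span S \<and> (\<forall>u\<in>B. b u u = 1) \<and>
           (\<forall>u\<in>B. \<forall>v\<in>B. u \<noteq> v \<longrightarrow> b u v = 0)"
  using S
proof (induction S rule: finite_induct)
  case empty
  then show ?case by (intro exI[of _ "{}"]) auto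
next
  case (insert a S)
  then obtain B where B: "finite B" "B \<subseteq> W" "span B = span S" "\<forall>u\<in>B. b u u = 1"
    "\<forall>u\<in>B. \<forall>v\<in>B. u \<noteq> v \<longrightarrow> b u v = 0" by auto
  define p where "p = (\<Sum>u\<in>B. b a u *\<^sub>R u)"
  define a' where "a' = a - p"
  have p: "p \<in> span B" unfolding p_def by (intro span_sum span_scale span_base)
  have "p \<in> W" using p span_minimal[OF B(2) W] by auto
  then have aW: "a' \<in> W" unfolding a'_def using insert.prems W by (intro subspace_diff) auto
  have orth: "b a' v = 0" if v: "v \<in> B" for v
  proof -
    have "b p v = (\<Sum>u\<in>B. b a u * b u v)"
      unfolding p_def by (simp add: bilinear_sum_left[OF bil] bilinear_lmul[OF bil])
    also have "\<dots> = (\<Sum>u\<in>{v}. b a u * b u v)"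
      by (rule sum.mono_neutral_right) (use B v in auto)
    finally show ?thesis using B(4) v by (simp add: a'_def bilinear_lsub[OF bil])
  qed
  have "span (insert a' B) = span (insert a B)"
  proof (rule eq_span_insert_eq)
    have "a' - a = - p" by (simp add: a'_def)
    then show "a' - a \<in> span B" using p by (simp add: span_neg)
  qed
  also have "\<dots> = span (insert a S)" by (simp add: span_insert B(3))
  finally have sp: "span (insert a' B) = span (insert a S)" .
  show ?case
  proof (cases "a' = 0")
    case True
    then show ?thesis using B sp by (intro exI[of _ B]) (auto simp: span_insert_0)
  next
    case False
    define s where "s = sqrt (b a' a')"
    have s: "s > 0" "s * s = b a' a'" using pos[OF aW False] by (simp_all add: s_def)
    define e where "e = inverse s *\<^sub>R a'"
    have e1: "b e e = 1"
      using s(1) by (simp add: e_def bilinear_lmul[OF bil] bilinear_rmul[OF bil] s(2)[symmetric] field_simps)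
    have e0: "b e v = 0" "b v e = 0" if "v \<in> B" for v
      using orth[OF that] sym[of v e] by (simp_all add: e_def bilinear_lmul[OF bil])
    have a': "a' = s *\<^sub>R e" using s by (simp add: e_def)
    have "e \<in> span (insert a' B)" unfolding e_def by (intro span_scale span_base) simp
    moreover have "a' \<in> span (insert e B)" by (subst a') (intro span_scale span_base, simp)
    ultimately have "span (insert e B) = span (insert a' B)"
      unfolding span_eq by (auto intro: span_base)
    moreover have "e \<in> W" using aW W by (simp add: e_def subspace_scale)
    ultimately show ?thesis using B e1 e0 sp by (intro exI[of _ "insert e B"]) auto
  qed
qed

lemma orthogonal_imp_independent:
  fixes b :: "'v::real_vector \<Rightarrow> 'v \<Rightarrow> real"
  assumes bil: "bilinear b" and "\<And>u. u \<in> B \<Longrightarrow> b u u \<noteq> 0"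
    and "\<And>u v. u \<in> B \<Longrightarrow> v \<in> B \<Longrightarrow> u \<noteq> v \<Longrightarrow> b u v = 0"
  shows "independent B"
proof (subst independent_explicit_finite_subsets, intro allI impI ballI)
  fix S u x assume S: "S \<subseteq> B" "finite S" "(\<Sum>v\<in>S. u v *\<^sub>R v) = 0" "x \<in> S"
  have "0 = b (\<Sum>v\<in>S. u v *\<^sub>R v) x" using bilinear_lzero[OF bil] S by simp
  also have "\<dots> = (\<Sum>v\<in>S. u v * b v x)" by (simp add: bilinear_sum_left[OF bil] bilinear_lmul[OF bil])
  also have "\<dots> = (\<Sum>v\<in>{x}. u v * b v x)"
    by (rule sum.mono_neutral_right) (use S assms(3) in auto)
  finally show "u x = 0" using assms(2) S by auto
qed

text \<open>A symmetric form that is negative on \<open>t\<close> and positive definite on the orthogonal complement of \<open>t\<close> is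
  Lorentzian.\<close>
lemma lorentzian_formI:
  fixes b :: "'e::euclidean_space \<Rightarrow> 'e \<Rightarrow> real"
  assumes bil: "bilinear b" and sym: "\<And>u v. b u v = b v u"
    and t: "b t t = -1" and pos: "\<And>v. b t v = 0 \<Longrightarrow> v \<noteq> 0 \<Longrightarrow> b v v > 0"
  shows "lorentzian_form b"
proof -
  (* the orthogonal projection along t; the sign is due to b t t = -1 *)
  define P where "P v = v + b t v *\<^sub>R t" for v
  have W: "subspace {v. b t v = 0}"
    using bil by (auto simp: subspace_def bilinear_radd bilinear_rmul bilinear_rzero)
  have "b t (P v) = 0" for v by (simp add: P_def bilinear_radd[OF bil] bilinear_rmul[OF bil] t)
  then have "P ` Basis \<subseteq> {v. b t v = 0}" by auto
  moreover have "b v v > 0" if "v \<in> {v. b t v = 0}" "v \<noteq> 0" for v using pos that by auto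
  ultimately obtain B where B: "finite B" "B \<subseteq> {v. b t v = 0}"
    "span B = span (P ` Basis)" "\<forall>u\<in>B. b u u = 1" "\<forall>u\<in>B. \<forall>v\<in>B. u \<noteq> v \<longrightarrow> b u v = 0"
    using gram_schmidt[OF bil sym W _ finite_imageI[OF finite_Basis], of P] by auto
  have tB: "t \<notin> B" using B t by force
  have t0: "b t v = 0" "b v t = 0" if "v \<in> B" for v using B that sym[of v t] by auto
  have "Basis \<subseteq> span (insert t B)"
  proof
    fix e :: 'e assume "e \<in> Basis"
    then have "P e \<in> span B" using B(3) by (auto intro: span_base)
    then have "P e \<in> span (insert t B)" using span_mono[of B "insert t B"] by auto
    then have "P e - b t e *\<^sub>R t \<in> span (insert t B)" by (intro span_diff span_scale) (auto intro: span_base)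
    then show "e \<in> span (insert t B)" by (simp add: P_def)
  qed
  then have "span (insert t B) = UNIV" using span_minimal[OF _ subspace_span] span_Basis by blast
  moreover have "independent (insert t B)"
    by (rule orthogonal_imp_independent[OF bil]) (use B t t0 in auto)
  ultimately show ?thesis
    unfolding lorentzian_form_def using bil sym t B tB t0
    by (intro conjI allI exI[of _ "insert t B"] exI[of _ t]) auto
qed

section \<open>Alternating forms\<close>

text \<open>It suffices that the form vanishes when two adjacent arguments agree: it then changes sign when
  adjacent arguments are swapped, and equal arguments can be moved next to each other.\<close>
lemma alternating_form_adjacentI:
  fixes \<omega> :: "(nat \<Rightarrow> 'e::real_vector) \<Rightarrow> real"
  assumes ext: "\<And>v w. (\<And>i. i < n \<Longrightarrow> v i = w i) \<Longrightarrow> \<omega> v = \<omega> w"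
    and lin: "\<And>v i. i < n \<Longrightarrow> linear (\<lambda>x. \<omega> (v(i := x)))"
    and adj: "\<And>v i. Suc i < n \<Longrightarrow> v i = v (Suc i) \<Longrightarrow> \<omega> v = 0"
  shows "alternating_form n \<omega>"
proof -
  have swap: "\<omega> (v(i := a, Suc i := b)) = - \<omega> (v(i := b, Suc i := a))" if i: "Suc i < n" for v i a b
  proof -
    have l1: "\<omega> (v(i := x + y, Suc i := z)) = \<omega> (v(i := x, Suc i := z)) + \<omega> (v(i := y, Suc i := z))" for x y z
      using linear_add[OF lin[of i "v(Suc i := z)"], of x y] i by (simp add: fun_upd_twist)
    have l2: "\<omega> (v(i := z, Suc i := x + y)) = \<omega> (v(i := z, Suc i := x)) + \<omega> (v(i := z, Suc i := y))" for x y z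
      using linear_add[OF lin[of "Suc i" "v(i := z)"], of x y] i by simp
    have z: "\<omega> (v(i := x, Suc i := x)) = 0" for x by (rule adj[OF i]) simp
    show ?thesis
      using l1[of a b "a + b"] l2[of a a b] l2[of b a b] z[of a] z[of b] z[of "a + b"] by simp
  qed
  have gap: "\<omega> v = 0" if "i + Suc d < n" "v i = v (i + Suc d)" for v i d
    using that
  proof (induction d arbitrary: v)
    case 0
    then show ?case by (intro adj[of i]) auto
  next
    case (Suc d)
    let ?k = "i + Suc d"
    have "\<omega> v = \<omega> (v(?k := v ?k, Suc ?k := v (Suc ?k)))" by simp
    also have "\<dots> = - \<omega> (v(?k := v (Suc ?k), Suc ?k := v ?k))" by (rule swap) (use Suc in simp)
    also have "\<omega> (v(?k := v (Suc ?k), Suc ?k := v ?k)) = 0" by (rule Suc.IH) (use Suc.prems in auto)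
    finally show ?case by simp
  qed
  have "\<omega> v = 0" if "i < n" "j < n" "i \<noteq> j" "v i = v j" for v i j
    using gap[of i "j - i - 1" v] gap[of j "i - j - 1" v] that
    by (cases "i < j") auto
  then show ?thesis unfolding alternating_form_def using ext lin by blast
qed

lemma alternating_form_ext: "alternating_form n \<omega> \<Longrightarrow> (\<And>i. i < n \<Longrightarrow> v i = w i) \<Longrightarrow> \<omega> v = \<omega> w"
  and alternating_form_linear: "alternating_form n \<omega> \<Longrightarrow> i < n \<Longrightarrow> linear (\<lambda>x. \<omega> (v(i := x)))"
  and alternating_form_eq: "alternating_form n \<omega> \<Longrightarrow> i < n \<Longrightarrow> j < n \<Longrightarrow> i \<noteq> j \<Longrightarrow> v i = v j \<Longrightarrow> \<omega> v = 0"
  unfolding alternating_form_def by simp_all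

lemma wedge1_alternating:
  fixes \<omega> :: "(nat \<Rightarrow> 'e::real_vector) \<Rightarrow> real"
  assumes lam: "linear lam" and alt: "alternating_form n \<omega>"
  shows "alternating_form (Suc n) (wedge1 n lam \<omega>)"
proof (rule alternating_form_adjacentI)
  (* omission of the argument number i *)
  define del where "del i v = (\<lambda>j. if j < i then v j else v (Suc j))" for i :: nat and v :: "nat \<Rightarrow> 'e"
  have W: "wedge1 n lam \<omega> v = (\<Sum>k\<le>n. (-1) ^ k * lam (v k) * \<omega> (del k v))" for v
    by (simp add: wedge1_def del_def)
  {
    fix v w :: "nat \<Rightarrow> 'e" assume vw: "\<And>i. i < Suc n \<Longrightarrow> v i = w i"
    have "\<omega> (del k v) = \<omega> (del k w)" for k
      by (rule alternating_form_ext[OF alt]) (simp add: del_def vw)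
    then show "wedge1 n lam \<omega> v = wedge1 n lam \<omega> w"
      unfolding W using vw by (intro sum.cong) auto
  next
    fix v :: "nat \<Rightarrow> 'e" and i assume i: "i < Suc n"
    show "linear (\<lambda>x. wedge1 n lam \<omega> (v(i := x)))"
      unfolding W
    proof (rule linear_compose_sum, rule ballI)
      fix k assume k: "k \<in> {..n}"
      show "linear (\<lambda>x. (-1) ^ k * lam ((v(i := x)) k) * \<omega> (del k (v(i := x))))"
      proof (cases "k = i")
        case True
        have "del k (v(i := x)) = del k v" for x using True by (auto simp: del_def)
        then show ?thesis using True
          by (intro linearI) (simp_all add: linear_add[OF lam] linear_cmul[OF lam] algebra_simps)
      next
        case False
        define i' where "i' = (if i < k then i else i - 1)"
        have "del k (v(i := x)) = (del k v)(i' := x)" for x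
          using False by (auto simp: del_def i'_def fun_eq_iff)
        moreover have "i' < n" using False i k by (auto simp: i'_def)
        note l = alternating_form_linear[OF alt this, of "del k v"]
        ultimately show ?thesis using False
          by (intro linearI) (simp_all add: linear_add[OF l] linear_cmul[OF l] algebra_simps)
      qed
    qed
  next
    fix v :: "nat \<Rightarrow> 'e" and i assume i: "Suc i < Suc n" "v i = v (Suc i)"
    have "wedge1 n lam \<omega> v = (\<Sum>k\<in>{i, Suc i}. (-1) ^ k * lam (v k) * \<omega> (del k v))"
      unfolding W
    proof (rule sum.mono_neutral_right, goal_cases)
      case 3
      have "\<omega> (del k v) = 0" if "k \<le> n" "k \<noteq> i" "k \<noteq> Suc i" for k
      proof (cases "k < i")
        case True
        have "del k v (i - 1) = del k v i" using True i by (auto simp: del_def)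
        then show ?thesis using True i by (intro alternating_form_eq[OF alt, of "i - 1" i]) auto
      next
        case False
        then have "del k v i = del k v (Suc i)" "Suc i < n" using that i by (auto simp: del_def)
        then show ?thesis by (intro alternating_form_eq[OF alt, of i "Suc i"]) auto
      qed
      then show ?case by auto
    qed (use i in auto)
    (* the two remaining terms have opposite signs and agree otherwise *)
    moreover have "del i v = del (Suc i) v" using i by (auto simp: del_def fun_eq_iff less_Suc_eq)
    ultimately show "wedge1 n lam \<omega> v = 0" using i(2) by simp
  }
qed

lemma alternating_form_above_dim:
  fixes \<omega> :: "(nat \<Rightarrow> 'e::euclidean_space) \<Rightarrow> real"
  assumes alt: "alternating_form n \<omega>" and n: "n > DIM('e)"
  shows "\<omega> v = 0"
proof (cases "inj_on v {..<n}")
  case False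
  then show ?thesis using alternating_form_eq[OF alt] by (auto simp: inj_on_def)
next
  case True
  then have "card (v ` {..<n}) = n" by (simp add: card_image)
  then have "dependent (v ` {..<n})" using n independent_card_le[of "v ` {..<n}"] by auto
  then obtain x where "x \<in> v ` {..<n}" "x \<in> span (v ` {..<n} - {x})" by (auto simp: dependent_def)
  then obtain i where i: "i < n" "v i \<in> span (v ` {..<n} - {v i})" by auto
  have lin: "linear (\<lambda>x. \<omega> (v(i := x)))" by (rule alternating_form_linear[OF alt i(1)])
  have "subspace {x. \<omega> (v(i := x)) = 0}"
    by (auto simp: subspace_def linear_add[OF lin] linear_cmul[OF lin] linear_0[OF lin])
  moreover have "v ` {..<n} - {v i} \<subseteq> {x. \<omega> (v(i := x)) = 0}"
  proof clarify
    fix j assume j: "v j \<noteq> v i" "j < n"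
    then have "i \<noteq> j" by auto
    then show "\<omega> (v(i := v j)) = 0" by (intro alternating_form_eq[OF alt i(1) j(2)]) auto
  qed
  ultimately have "v i \<in> {x. \<omega> (v(i := x)) = 0}" using i(2) span_minimal by blast
  then show ?thesis by simp
qed

text \<open>The form \<open>\<eta>\<^bsub>k-1\<^esub> \<and> \<dots> \<and> \<eta>\<^sub>0\<close>. The factors are added on the left, because \<^const>\<open>wedge1\<close> multiplies
  by a 1-form on the left.\<close>
primrec iterated_wedge :: "nat \<Rightarrow> (nat \<Rightarrow> 'e \<Rightarrow> real) \<Rightarrow> (nat \<Rightarrow> 'e) \<Rightarrow> real" where
  "iterated_wedge 0 \<eta> = (\<lambda>_. 1)"
| "iterated_wedge (Suc k) \<eta> = wedge1 k (\<eta> k) (iterated_wedge k \<eta>)"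

text \<open>The dual vectors are inserted in the order of the factors; then only the first term of each
  expansion of a wedge product survives.\<close>
lemma iterated_wedge_dual:
  assumes "\<And>i j. i < k \<Longrightarrow> j < k \<Longrightarrow> \<eta> i (f j) = (if i = j then 1 else 0)"
  shows "iterated_wedge k \<eta> (\<lambda>i. f (k - 1 - i)) = 1"
  using assms
proof (induction k)
  case (Suc k)
  let ?t = "\<lambda>i. (-1) ^ i * \<eta> k (f (k - i)) * iterated_wedge k \<eta> (\<lambda>j. if j < i then f (k - j) else f (k - Suc j))"
  have "iterated_wedge (Suc k) \<eta> (\<lambda>i. f (Suc k - 1 - i)) = (\<Sum>i\<le>k. ?t i)"
    by (simp add: wedge1_def)
  also have "\<dots> = (\<Sum>i\<in>{0}. ?t i)"
    by (rule sum.mono_neutral_right) (use Suc.prems in auto)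
  also have "\<dots> = iterated_wedge k \<eta> (\<lambda>j. f (k - 1 - j))" using Suc.prems by simp
  also have "\<dots> = 1" by (rule Suc.IH) (use Suc.prems in auto)
  finally show ?case .
qed simp

context smooth_mfd
begin

lemma nform_on_wedge1:
  assumes U: "open U" and lam: "one_form_on c U lam" and \<omega>: "nform_on c n U \<omega>"
  shows "nform_on c (Suc n) U (\<lambda>p. wedge1 n (lam p) (\<omega> p))"
  unfolding nform_on_def
proof (intro conjI ballI allI)
  show "alternating_form (Suc n) (wedge1 n (lam p) (\<omega> p))" if "p \<in> U" for p
    using that lam \<omega> by (intro wedge1_alternating) (auto simp: one_form_on_def nform_on_def)
  fix p v
  let ?S = "cmap c p ` (cdom c p \<inter> U)"
  have op: "open ?S" by (rule open_cmap_image[OF U])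
  have eq: "(\<lambda>j. if j < i then T (v j) else T (v (Suc j))) = (\<lambda>j. T (if j < i then v j else v (Suc j)))"
    for i :: nat and T :: "'e \<Rightarrow> 'e" by auto
  have 1: "smooth_on ?S (\<lambda>y. (-1) ^ i * lam (cinv c p y) (tchange c p (cinv c p y) (cinv c p y) (v i)))" for i
    by (rule smooth_on_mult[OF op smooth_on_const[OF op]]) (use lam in \<open>simp add: one_form_on_def Let_def\<close>)
  have 2: "smooth_on ?S (\<lambda>y. \<omega> (cinv c p y) (\<lambda>j. if j < i
      then tchange c p (cinv c p y) (cinv c p y) (v j) else tchange c p (cinv c p y) (cinv c p y) (v (Suc j))))" for i
    unfolding eq using \<omega> by (simp add: nform_on_def Let_def)
  show "smooth_on ?S (\<lambda>y. let r = cinv c p y in wedge1 n (lam r) (\<omega> r) (\<lambda>i. tchange c p r r (v i)))"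
    unfolding wedge1_def Let_def by (rule smooth_on_sum[OF op], rule smooth_on_mult[OF op 1 2])
qed

lemma nform_on_iterated_wedge:
  assumes "open U" "\<And>i. i < n \<Longrightarrow> one_form_on c U (\<eta> i)"
  shows "nform_on c n U (\<lambda>p. iterated_wedge n (\<lambda>i. \<eta> i p))"
  using assms(2)
proof (induction n)
  case 0
  then show ?case by (auto simp: nform_on_def alternating_form_def intro!: smooth_on_const open_cmap_image assms(1))
next
  case (Suc n)
  then show ?case using nform_on_wedge1[OF assms(1), of "\<eta> n"] by simp
qed

end

context line_mfd
begin

lemma form_pullback_line: "form_pullback (line_bundle c) c snd x \<omega> v = \<omega> (\<lambda>i. snd (v i))"
  by (simp add: form_pullback_def mderiv_snd)

lemma nform_on_lift:
  assumes U: "open U" and \<omega>: "nform_on c n U \<omega>"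
  shows "nform_on (line_bundle c) n (UNIV \<times> U) (\<lambda>x. form_pullback (line_bundle c) c snd x (\<omega> (snd x)))"
  unfolding nform_on_def
proof (intro conjI ballI allI)
  fix p :: "real \<times> 'a" assume "p \<in> UNIV \<times> U"
  then have alt: "alternating_form n (\<omega> (snd p))" using \<omega> by (auto simp: nform_on_def)
  have "linear (\<lambda>x. \<omega> (snd p) (\<lambda>k. snd ((v(i := x)) k)))" if "i < n" for v :: "nat \<Rightarrow> real \<times> 'e" and i
  proof -
    have "(\<lambda>k. snd ((v(i := x)) k)) = (\<lambda>k. snd (v k))(i := snd x)" for x by auto
    then show ?thesis
      using linear_compose[OF bounded_linear.linear[OF bounded_linear_snd] alternating_form_linear[OF alt that]]
      by (simp add: o_def)
  qed
  moreover have "\<omega> (snd p) (\<lambda>i. snd (v i)) = \<omega> (snd p) (\<lambda>i. snd (w i))"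
    if "\<forall>i<n. v i = w i" for v w :: "nat \<Rightarrow> real \<times> 'e"
    by (rule alternating_form_ext[OF alt]) (use that in simp)
  moreover have "\<omega> (snd p) (\<lambda>i. snd (v i)) = 0"
    if "i < n" "j < n" "i \<noteq> j" "v i = v j" for v :: "nat \<Rightarrow> real \<times> 'e" and i j
    by (rule alternating_form_eq[OF alt that(1-3)]) (use that in simp)
  ultimately show "alternating_form n (form_pullback (line_bundle c) c snd p (\<omega> (snd p)))"
    unfolding alternating_form_def form_pullback_line by simp
next
  fix p :: "real \<times> 'a" and v :: "nat \<Rightarrow> real \<times> 'e"
  let ?L = "line_bundle c"
  show "smooth_on (cmap ?L p ` (cdom ?L p \<inter> (UNIV \<times> U)))
      (\<lambda>y. let r = cinv ?L p y in form_pullback ?L c snd r (\<omega> (snd r)) (\<lambda>i. tchange ?L p r r (v i)))"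
    by (rule smooth_on_cong[OF _ _ smooth_on_line[OF U,
          of p "\<lambda>y. let r = cinv c (snd p) y in \<omega> r (\<lambda>i. tchange c (snd p) r r (snd (v i)))"]])
      (use U \<omega> in \<open>auto intro!: open_cmap_image open_Times simp: line_chart_image nform_on_def
        form_pullback_line tchange_line simp del: cdom_product cmap_product\<close>)
qed

end

section \<open>Hermitian forms\<close>

text \<open>The sesquilinear form with matrix \<open>h\<close>, conjugate linear in the second argument. Only the first \<open>m\<close>
  entries of the arguments matter.\<close>
definition hform :: "nat \<Rightarrow> (nat \<Rightarrow> nat \<Rightarrow> complex) \<Rightarrow> (nat \<Rightarrow> complex) \<Rightarrow> (nat \<Rightarrow> complex) \<Rightarrow> complex" where
  "hform m h z w = (\<Sum>\<alpha><m. \<Sum>\<beta><m. h \<alpha> \<beta> * z \<alpha> * cnj (w \<beta>))"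

lemma hform_cong: "(\<And>\<alpha>. \<alpha> < m \<Longrightarrow> z \<alpha> = z' \<alpha>) \<Longrightarrow> (\<And>\<alpha>. \<alpha> < m \<Longrightarrow> w \<alpha> = w' \<alpha>) \<Longrightarrow> hform m h z w = hform m h z' w'"
  unfolding hform_def by (intro sum.cong) auto

lemma hform_add_left: "hform m h (\<lambda>\<alpha>. z \<alpha> + z' \<alpha>) w = hform m h z w + hform m h z' w"
  and hform_add_right: "hform m h z (\<lambda>\<alpha>. w \<alpha> + w' \<alpha>) = hform m h z w + hform m h z w'"
  by (simp_all add: hform_def algebra_simps sum.distrib)

lemma hform_scale_left: "hform m h (\<lambda>\<alpha>. a * z \<alpha>) w = a * hform m h z w"
  and hform_scale_right: "hform m h z (\<lambda>\<alpha>. a * w \<alpha>) = cnj a * hform m h z w"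
  by (simp_all add: hform_def algebra_simps sum_distrib_left)

lemma hform_zero_left: "(\<And>\<alpha>. \<alpha> < m \<Longrightarrow> z \<alpha> = 0) \<Longrightarrow> hform m h z w = 0"
  by (simp add: hform_def)

lemma hform_commute:
  assumes "pos_def_hermitian m h"
  shows "hform m h w z = cnj (hform m h z w)"
proof -
  have "hform m h w z = (\<Sum>\<beta><m. \<Sum>\<alpha><m. h \<alpha> \<beta> * w \<alpha> * cnj (z \<beta>))"
    unfolding hform_def by (rule sum.swap)
  also have "\<dots> = (\<Sum>\<beta><m. \<Sum>\<alpha><m. cnj (h \<beta> \<alpha> * z \<beta> * cnj (w \<alpha>)))"
  proof (intro sum.cong refl)
    fix \<alpha> \<beta> assume "\<beta> \<in> {..<m}" "\<alpha> \<in> {..<m}"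
    then have "h \<alpha> \<beta> = cnj (h \<beta> \<alpha>)" using assms unfolding pos_def_hermitian_def by blast
    then show "h \<alpha> \<beta> * w \<alpha> * cnj (z \<beta>) = cnj (h \<beta> \<alpha> * z \<beta> * cnj (w \<alpha>))" by simp
  qed
  finally show ?thesis by (simp add: hform_def)
qed

lemma hform_self_real: "pos_def_hermitian m h \<Longrightarrow> complex_of_real (Re (hform m h z z)) = hform m h z z"
  using hform_commute[of m h z z] by (simp add: complex_eq_iff)

lemma hform_pos: "pos_def_hermitian m h \<Longrightarrow> \<alpha> < m \<Longrightarrow> z \<alpha> \<noteq> 0 \<Longrightarrow> 0 < Re (hform m h z z)"
  unfolding pos_def_hermitian_def hform_def by blast

lemma hform_nonneg: "pos_def_hermitian m h \<Longrightarrow> 0 \<le> Re (hform m h z z)"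
  using hform_pos[of m h _ z] hform_zero_left[of m z h z] by (cases "\<exists>\<alpha><m. z \<alpha> \<noteq> 0") (auto intro: less_imp_le)

text \<open>The matrix of the form that \<open>h\<close> becomes under the change of basis \<open>P\<close>.\<close>
definition transform :: "nat \<Rightarrow> (nat \<Rightarrow> nat \<Rightarrow> complex) \<Rightarrow> (nat \<Rightarrow> nat \<Rightarrow> complex) \<Rightarrow> nat \<Rightarrow> nat \<Rightarrow> complex" where
  "transform m P h \<alpha> \<beta> = (\<Sum>\<gamma><m. \<Sum>\<delta><m. h \<gamma> \<delta> * P \<alpha> \<gamma> * cnj (P \<beta> \<delta>))"

lemma sum_swap4:
  "(\<Sum>a\<in>A. \<Sum>b\<in>B. \<Sum>c\<in>C. \<Sum>d\<in>D. f a b c d) = (\<Sum>c\<in>C. \<Sum>d\<in>D. \<Sum>a\<in>A. \<Sum>b\<in>B. f a b c d)"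
proof -
  have "(\<Sum>a\<in>A. \<Sum>b\<in>B. \<Sum>c\<in>C. \<Sum>d\<in>D. f a b c d) = (\<Sum>a\<in>A. \<Sum>c\<in>C. \<Sum>b\<in>B. \<Sum>d\<in>D. f a b c d)"
    by (rule sum.cong[OF refl]) (rule sum.swap)
  also have "\<dots> = (\<Sum>c\<in>C. \<Sum>a\<in>A. \<Sum>b\<in>B. \<Sum>d\<in>D. f a b c d)" by (rule sum.swap)
  also have "\<dots> = (\<Sum>c\<in>C. \<Sum>a\<in>A. \<Sum>d\<in>D. \<Sum>b\<in>B. f a b c d)"
    by (rule sum.cong[OF refl], rule sum.cong[OF refl], rule sum.swap)
  also have "\<dots> = (\<Sum>c\<in>C. \<Sum>d\<in>D. \<Sum>a\<in>A. \<Sum>b\<in>B. f a b c d)"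
    by (rule sum.cong[OF refl], rule sum.swap)
  finally show ?thesis .
qed

lemma transform_cong: "(\<And>\<gamma> \<delta>. \<gamma> < m \<Longrightarrow> \<delta> < m \<Longrightarrow> h \<gamma> \<delta> = h' \<gamma> \<delta>) \<Longrightarrow> transform m P h \<alpha> \<beta> = transform m P h' \<alpha> \<beta>"
  unfolding transform_def by (intro sum.cong refl) auto

lemma transform_inverse:
  assumes PQ: "\<And>\<alpha> \<beta>. \<alpha> < m \<Longrightarrow> \<beta> < m \<Longrightarrow> (\<Sum>\<gamma><m. P \<alpha> \<gamma> * Q \<gamma> \<beta>) = (if \<alpha> = \<beta> then 1 else 0)"
    and "\<alpha> < m" "\<beta> < m"
  shows "transform m P (transform m Q h) \<alpha> \<beta> = h \<alpha> \<beta>"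
proof -
  have "transform m P (transform m Q h) \<alpha> \<beta> =
      (\<Sum>\<gamma><m. \<Sum>\<delta><m. \<Sum>\<mu><m. \<Sum>\<nu><m. h \<mu> \<nu> * (P \<alpha> \<gamma> * Q \<gamma> \<mu>) * cnj (P \<beta> \<delta> * Q \<delta> \<nu>))"
    by (simp add: transform_def sum_distrib_left sum_distrib_right algebra_simps)
  also have "\<dots> = (\<Sum>\<mu><m. \<Sum>\<nu><m. \<Sum>\<gamma><m. \<Sum>\<delta><m. h \<mu> \<nu> * (P \<alpha> \<gamma> * Q \<gamma> \<mu>) * cnj (P \<beta> \<delta> * Q \<delta> \<nu>))"
    by (rule sum_swap4)
  also have "\<dots> = (\<Sum>\<mu><m. \<Sum>\<nu><m. h \<mu> \<nu> * (\<Sum>\<gamma><m. P \<alpha> \<gamma> * Q \<gamma> \<mu>) * cnj (\<Sum>\<delta><m. P \<beta> \<delta> * Q \<delta> \<nu>))"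
    by (simp add: sum_distrib_left sum_distrib_right algebra_simps)
  also have "\<dots> = (\<Sum>\<mu><m. \<Sum>\<nu><m. h \<mu> \<nu> * (if \<alpha> = \<mu> then 1 else 0) * cnj (if \<beta> = \<nu> then 1 else 0))"
    using assms by (intro sum.cong refl) simp
  also have "\<dots> = (\<Sum>\<mu><m. \<Sum>\<nu><m. if \<nu> = \<beta> then (if \<mu> = \<alpha> then h \<mu> \<nu> else 0) else 0)"
    by (intro sum.cong refl) auto
  also have "\<dots> = h \<alpha> \<beta>" using assms by simp
  finally show ?thesis .
qed

lemma hform_transform:
  "hform m h (\<lambda>\<alpha>. \<Sum>\<beta><m. P \<beta> \<alpha> * z \<beta>) (\<lambda>\<alpha>. \<Sum>\<beta><m. P \<beta> \<alpha> * w \<beta>) = hform m (transform m P h) z w"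
proof -
  have "hform m h (\<lambda>\<alpha>. \<Sum>\<beta><m. P \<beta> \<alpha> * z \<beta>) (\<lambda>\<alpha>. \<Sum>\<beta><m. P \<beta> \<alpha> * w \<beta>) =
      (\<Sum>\<alpha><m. \<Sum>\<beta><m. \<Sum>\<gamma><m. \<Sum>\<delta><m. h \<alpha> \<beta> * P \<gamma> \<alpha> * cnj (P \<delta> \<beta>) * z \<gamma> * cnj (w \<delta>))"
    by (simp add: hform_def sum_distrib_left sum_distrib_right algebra_simps)
  also have "\<dots> = (\<Sum>\<gamma><m. \<Sum>\<delta><m. \<Sum>\<alpha><m. \<Sum>\<beta><m. h \<alpha> \<beta> * P \<gamma> \<alpha> * cnj (P \<delta> \<beta>) * z \<gamma> * cnj (w \<delta>))"
    by (rule sum_swap4)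
  also have "\<dots> = hform m (transform m P h) z w"
    by (simp add: hform_def transform_def sum_distrib_right)
  finally show ?thesis .
qed

lemma hform_basis:
  assumes "\<alpha> < m" "\<beta> < m"
  shows "hform m h (\<lambda>\<gamma>. if \<gamma> = \<alpha> then a else 0) (\<lambda>\<gamma>. if \<gamma> = \<beta> then 1 else 0) = h \<alpha> \<beta> * a"
proof -
  have "hform m h (\<lambda>\<gamma>. if \<gamma> = \<alpha> then a else 0) (\<lambda>\<gamma>. if \<gamma> = \<beta> then 1 else 0) =
      (\<Sum>\<gamma><m. \<Sum>\<delta><m. if \<delta> = \<beta> then (if \<gamma> = \<alpha> then h \<gamma> \<delta> * a else 0) else 0)"
    unfolding hform_def by (intro sum.cong refl) auto
  also have "\<dots> = h \<alpha> \<beta> * a" using assms by simp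
  finally show ?thesis .
qed

section \<open>The metric at a point\<close>

text \<open>The tensor \<open>4 T0 L + 2 h\<^bsub>\<alpha>\<beta>\<^esub> T\<^sup>\<alpha> cnj T\<^sup>\<beta>\<close> on a vector space, written as a real form.\<close>
definition robinson_form :: "nat \<Rightarrow> ('v \<Rightarrow> real) \<Rightarrow> (nat \<Rightarrow> 'v \<Rightarrow> complex) \<Rightarrow> ('v \<Rightarrow> real) \<Rightarrow>
    (nat \<Rightarrow> nat \<Rightarrow> complex) \<Rightarrow> 'v \<Rightarrow> 'v \<Rightarrow> real" where
  "robinson_form m T0 T L h u v =
     2 * (T0 u * L v + L u * T0 v) + 2 * Re (hform m h (\<lambda>\<alpha>. T \<alpha> u) (\<lambda>\<alpha>. T \<alpha> v))"

lemma robinson_form_tensor: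
  assumes "pos_def_hermitian m h"
  shows "4 * symm_prod (\<lambda>w. complex_of_real (T0 w)) (\<lambda>w. complex_of_real (L w)) u v +
     2 * (\<Sum>\<alpha><m. \<Sum>\<beta><m. h \<alpha> \<beta> * symm_prod (T \<alpha>) (\<lambda>w. cnj (T \<beta> w)) u v) =
     complex_of_real (robinson_form m T0 T L h u v)"
proof -
  let ?H = "hform m h (\<lambda>\<alpha>. T \<alpha> u) (\<lambda>\<alpha>. T \<alpha> v)" and ?H' = "hform m h (\<lambda>\<alpha>. T \<alpha> v) (\<lambda>\<alpha>. T \<alpha> u)"
  have "2 * (a * symm_prod f k u v) = a * f u * k v + a * f v * k u" for a f k
    by (simp add: symm_prod_def algebra_simps)
  then have "2 * (\<Sum>\<alpha><m. \<Sum>\<beta><m. h \<alpha> \<beta> * symm_prod (T \<alpha>) (\<lambda>w. cnj (T \<beta> w)) u v) = ?H + ?H'"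
    by (simp only: hform_def sum_distrib_left sum.distrib)
  also have "\<dots> = complex_of_real (2 * Re ?H)"
    using hform_commute[OF assms, of "\<lambda>\<alpha>. T \<alpha> v" "\<lambda>\<alpha>. T \<alpha> u"] by (simp add: complex_eq_iff)
  finally show ?thesis by (simp add: robinson_form_def symm_prod_def field_simps)
qed

text \<open>
  The data at one point of the total space: \<open>T0\<close>, \<open>T \<alpha>\<close> and \<open>L\<close> are the values of the pulled back coframe
  and of \<open>lam\<close>, \<open>h\<close> is the Hermitian matrix, and \<open>e\<close> is the vertical vector. The last two assumptions
  say that the coframe on the base, seen as a real linear map, is injective and surjective.
\<close>
locale robinson_point =
  fixes m :: nat and T0 :: "'v::euclidean_space \<Rightarrow> real" and T :: "nat \<Rightarrow> 'v \<Rightarrow> complex"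
    and L :: "'v \<Rightarrow> real" and h :: "nat \<Rightarrow> nat \<Rightarrow> complex" and e :: 'v
  assumes lin_T0: "linear T0" and lin_T: "\<And>\<alpha>. \<alpha> < m \<Longrightarrow> linear (T \<alpha>)" and lin_L: "linear L"
    and herm: "pos_def_hermitian m h"
    and T0_e: "T0 e = 0" and T_e: "\<And>\<alpha>. \<alpha> < m \<Longrightarrow> T \<alpha> e = 0" and L_e: "L e \<noteq> 0"
    and kernel: "\<And>v. T0 v = 0 \<Longrightarrow> (\<And>\<alpha>. \<alpha> < m \<Longrightarrow> T \<alpha> v = 0) \<Longrightarrow> \<exists>s. v = s *\<^sub>R e"
    and solve0: "\<And>a0 a. \<exists>v. T0 v = a0 \<and> (\<forall>\<alpha><m. T \<alpha> v = a \<alpha>)"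
begin

text \<open>The metric at the point.\<close>
abbreviation "G \<equiv> robinson_form m T0 T L h"

lemma solve: "\<exists>v. T0 v = a0 \<and> (\<forall>\<alpha><m. T \<alpha> v = a \<alpha>) \<and> L v = l"
proof -
  obtain v where v: "T0 v = a0" "\<forall>\<alpha><m. T \<alpha> v = a \<alpha>" using solve0 by blast
  let ?v = "v + ((l - L v) / L e) *\<^sub>R e"
  have "T0 ?v = a0" using v by (simp add: linear_add[OF lin_T0] linear_cmul[OF lin_T0] T0_e)
  moreover have "T \<alpha> ?v = a \<alpha>" if "\<alpha> < m" for \<alpha>
    using v that by (simp add: linear_add[OF lin_T] linear_cmul[OF lin_T] T_e)
  moreover have "L ?v = l" using L_e by (simp add: linear_add[OF lin_L] linear_cmul[OF lin_L])
  ultimately show ?thesis by blast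
qed

lemma G_commute: "G u v = G v u"
  using hform_commute[OF herm, of "\<lambda>\<alpha>. T \<alpha> v" "\<lambda>\<alpha>. T \<alpha> u"] by (simp add: robinson_form_def algebra_simps)

lemma G_add: "G (u + u') v = G u v + G u' v"
proof -
  have "hform m h (\<lambda>\<alpha>. T \<alpha> (u + u')) w = hform m h (\<lambda>\<alpha>. T \<alpha> u) w + hform m h (\<lambda>\<alpha>. T \<alpha> u') w" for w
    unfolding hform_add_left[symmetric] by (rule hform_cong) (simp_all add: linear_add[OF lin_T])
  then show ?thesis
    by (simp add: robinson_form_def linear_add[OF lin_T0] linear_add[OF lin_L] algebra_simps)
qed

lemma G_scale: "G (r *\<^sub>R u) v = r * G u v"
proof -
  have "hform m h (\<lambda>\<alpha>. T \<alpha> (r *\<^sub>R u)) w = complex_of_real r * hform m h (\<lambda>\<alpha>. T \<alpha> u) w" for w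
    unfolding hform_scale_left[symmetric]
    by (rule hform_cong) (simp_all add: linear_cmul[OF lin_T] scaleR_conv_of_real)
  then show ?thesis
    by (simp add: robinson_form_def linear_cmul[OF lin_T0] linear_cmul[OF lin_L] algebra_simps)
qed

lemma G_add_right: "G v (u + u') = G v u + G v u'"
  and G_scale_right: "G v (r *\<^sub>R u) = r * G v u"
  using G_add[of u u' v] G_scale[of r u v] by (simp_all only: G_commute[of v])

lemma G_bilinear: "bilinear G"
  unfolding bilinear_def by (auto intro!: linearI simp: G_add G_scale G_add_right G_scale_right)

lemma G_e: "G e v = 2 * L e * T0 v"
  using T_e by (simp add: robinson_form_def T0_e hform_zero_left)

lemma G_self: "G v v = 4 * T0 v * L v + 2 * Re (hform m h (\<lambda>\<alpha>. T \<alpha> v) (\<lambda>\<alpha>. T \<alpha> v))"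
  by (simp add: robinson_form_def)

lemma G_lorentzian: "lorentzian_form G"
proof -
  (* the value of L is chosen such that G t t = 4 * T0 t * L t = -1 *)
  obtain t where t: "T0 t = 1" "\<forall>\<alpha><m. T \<alpha> t = 0" "L t = -1/4" using solve[of 1 "\<lambda>_. 0"] by blast
  have Gt: "G t v = 2 * L v - T0 v / 2" for v
    using t by (simp add: robinson_form_def hform_zero_left algebra_simps)
  show ?thesis
  proof (rule lorentzian_formI[OF G_bilinear G_commute])
    show "G t t = -1" unfolding Gt using t by simp
    fix v assume v: "G t v = 0" "v \<noteq> 0"
    then have Lv: "L v = T0 v / 4" by (simp add: Gt)
    let ?H = "Re (hform m h (\<lambda>\<alpha>. T \<alpha> v) (\<lambda>\<alpha>. T \<alpha> v))"
    have Gv: "G v v = T0 v * T0 v + 2 * ?H" by (simp add: G_self Lv)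
    have H: "?H \<ge> 0" by (rule hform_nonneg[OF herm])
    show "G v v > 0"
    proof (cases "T0 v = 0")
      case True
      have "\<exists>\<alpha><m. T \<alpha> v \<noteq> 0"
      proof (rule ccontr)
        assume "\<not> ?thesis"
        then obtain s where "v = s *\<^sub>R e" using kernel[of v] True by blast
        then show False using v(2) Lv True L_e by (simp add: linear_cmul[OF lin_L])
      qed
      then show ?thesis using hform_pos[OF herm, of _ "\<lambda>\<alpha>. T \<alpha> v"] Gv True by auto
    next
      case False
      then have "T0 v * T0 v > 0" by (metis not_real_square_gt_zero)
      then show ?thesis using Gv H by simp
    qed
  qed
qed

lemma timelike_exists: "\<exists>t. T0 t = 1 \<and> G t t < 0"
proof -
  obtain t where t: "T0 t = 1" "\<forall>\<alpha><m. T \<alpha> t = 0" "L t = -1" using solve[of 1 "\<lambda>_. 0"] by blast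
  then show ?thesis by (intro exI[of _ t]) (simp add: G_self hform_zero_left)
qed

text \<open>Once both vectors are normalised by \<open>T0 = 1\<close>, their difference lies in the kernel of \<open>T0\<close>, where \<open>G\<close>
  is positive semidefinite.\<close>
lemma G_timelike_neg:
  assumes u: "G u u < 0" "T0 u > 0" and v: "G v v < 0" "T0 v > 0"
  shows "G u v < 0"
proof -
  have norm: "G (inverse (T0 w) *\<^sub>R w) (inverse (T0 w) *\<^sub>R w) < 0" if "G w w < 0" "T0 w > 0" for w
    using that by (simp add: G_scale G_scale_right mult_pos_neg)
  let ?u = "inverse (T0 u) *\<^sub>R u" and ?v = "inverse (T0 v) *\<^sub>R v"
  have "T0 (?u + (-1) *\<^sub>R ?v) = 0"
    using u v by (simp only: linear_add[OF lin_T0] linear_cmul[OF lin_T0]) simp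
  then have "0 \<le> G (?u + (-1) *\<^sub>R ?v) (?u + (-1) *\<^sub>R ?v)"
    unfolding G_self using hform_nonneg[OF herm] by simp
  also have "\<dots> = G ?u ?u + G ?v ?v - 2 * G ?u ?v"
    unfolding G_add G_add_right G_scale[of "-1"] G_scale_right[of _ "-1"] using G_commute[of ?u ?v] by simp
  finally have "G ?u ?v < 0" using norm[OF u] norm[OF v] by linarith
  moreover have "G ?u ?v = inverse (T0 u) * inverse (T0 v) * G u v"
    by (simp add: G_scale G_scale_right)
  moreover have "inverse (T0 u) * inverse (T0 v) > 0" using u v by simp
  ultimately show ?thesis by (metis mult_less_0_iff not_less_iff_gr_or_eq)
qed

lemma timelike_T0: "G v v < 0 \<Longrightarrow> T0 v \<noteq> 0"
  using hform_nonneg[OF herm, of "\<lambda>\<alpha>. T \<alpha> v"] by (auto simp: G_self)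

text \<open>The sign of \<open>T0\<close> tells the two cones of timelike vectors apart.\<close>
lemma cone_eq:
  assumes u: "G u u < 0" "T0 u > 0"
  shows "{v. G v v < 0 \<and> T0 v > 0} = {v. G v v < 0 \<and> G u v < 0}"
proof -
  have "T0 v > 0" if v: "G v v < 0" "G u v < 0" for v
  proof (rule ccontr)
    assume "\<not> T0 v > 0"
    then have "T0 v < 0" using timelike_T0[OF v(1)] by auto
    then have "T0 ((-1) *\<^sub>R v) > 0" by (simp only: linear_cmul[OF lin_T0]) simp
    moreover have "G ((-1) *\<^sub>R v) ((-1) *\<^sub>R v) < 0"
      using v(1) by (simp only: G_scale G_scale_right)
    ultimately have "G u ((-1) *\<^sub>R v) < 0" using G_timelike_neg[OF u] by blast
    then show False using v(2) by (simp only: G_scale_right)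
  qed
  then show ?thesis using G_timelike_neg[OF u] by blast
qed

lemma orthogonal_annihilator: "(\<forall>w. T0 w = 0 \<longrightarrow> G k w = 0) \<longleftrightarrow> (\<exists>s. k = s *\<^sub>R e)"
proof
  assume k: "\<forall>w. T0 w = 0 \<longrightarrow> G k w = 0"
  then have "G e k = 0" using T0_e by (simp add: G_commute[of e])
  then have k0: "T0 k = 0" using L_e by (simp add: G_e)
  then have "Re (hform m h (\<lambda>\<alpha>. T \<alpha> k) (\<lambda>\<alpha>. T \<alpha> k)) = 0" using k G_self[of k] by simp
  then have "T \<alpha> k = 0" if "\<alpha> < m" for \<alpha> using hform_pos[OF herm that, of "\<lambda>\<alpha>. T \<alpha> k"] by auto
  then show "\<exists>s. k = s *\<^sub>R e" using kernel k0 by blast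
qed (auto simp: G_scale G_e)

lemma nondegenerate: "(\<And>w. G z w = 0) \<Longrightarrow> z = 0"
proof -
  assume z: "\<And>w. G z w = 0"
  then obtain s where s: "z = s *\<^sub>R e" using orthogonal_annihilator[of z] by blast
  obtain w where "T0 w = 1" using timelike_exists by blast
  then have "s * (2 * L e) = 0" using z[of w] by (simp add: s G_scale G_e)
  then show "z = 0" using L_e s by simp
qed

text \<open>Every term of the complexified metric has a factor that vanishes on the common kernel of
  \<open>T0\<close> and the \<open>T \<alpha>\<close>.\<close>
lemma annihilator_null:
  assumes "cext (\<lambda>v. complex_of_real (T0 v)) w = 0" "\<And>\<alpha>. \<alpha> < m \<Longrightarrow> cext (T \<alpha>) w = 0"
    and "cext (\<lambda>v. complex_of_real (T0 v)) z = 0" "\<And>\<alpha>. \<alpha> < m \<Longrightarrow> cext (T \<alpha>) z = 0"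
  shows "cext2 G w z = 0"
proof -
  obtain w1 w2 z1 z2 where wz: "w = (w1, w2)" "z = (z1, z2)" by (cases w, cases z)
  have T0: "T0 w1 = 0" "T0 w2 = 0" "T0 z1 = 0" "T0 z2 = 0"
    using assms(1,3) by (simp_all add: wz cext_def complex_eq_iff)
  let ?H = "\<lambda>u v. hform m h (\<lambda>\<alpha>. T \<alpha> u) (\<lambda>\<alpha>. T \<alpha> v)"
  have 1: "T \<alpha> w1 = - \<i> * T \<alpha> w2" "T \<alpha> z1 = - \<i> * T \<alpha> z2" if "\<alpha> < m" for \<alpha>
    using assms(2,4)[OF that] by (simp_all add: wz cext_def add_eq_0_iff)
  have "?H w1 v = hform m h (\<lambda>\<alpha>. - \<i> * T \<alpha> w2) (\<lambda>\<alpha>. T \<alpha> v)"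
    "?H v z1 = hform m h (\<lambda>\<alpha>. T \<alpha> v) (\<lambda>\<alpha>. - \<i> * T \<alpha> z2)" for v
    by (rule hform_cong; simp add: 1)+
  then have "?H w1 v = - \<i> * ?H w2 v" "?H v z1 = \<i> * ?H v z2" for v
    by (simp_all only: hform_scale_left hform_scale_right complex_cnj_minus complex_cnj_i minus_minus)
  then show ?thesis
    by (simp add: cext2_def wz robinson_form_def T0 complex_eq_iff)
qed

text \<open>Evaluating both metrics on vectors in the kernel of \<open>T0\<close> compares the Hermitian forms, and
  evaluating them on a vector with \<open>T0 = 1\<close>, \<open>T \<alpha> = 0\<close> and an arbitrary vector compares \<open>L\<close> and \<open>L'\<close>.\<close>
lemma robinson_form_eq_iff:
  fixes \<phi> :: "nat \<Rightarrow> complex"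
  assumes herm': "pos_def_hermitian m h'" and inv: "inverse_matrices m \<psi> \<psi>i"
    and T0': "\<And>v. T0' v = exp p * T0 v"
    and T': "\<And>\<alpha> v. \<alpha> < m \<Longrightarrow> T' \<alpha> v = (\<Sum>\<beta><m. \<psi> \<beta> \<alpha> * T \<beta> v) + \<phi> \<alpha> * complex_of_real (T0 v)"
  shows "(\<forall>u v. G u v = robinson_form m T0' T' L' h' u v) \<longleftrightarrow>
     (\<forall>\<alpha><m. \<forall>\<beta><m. h' \<alpha> \<beta> = (\<Sum>\<gamma><m. \<Sum>\<delta><m. h \<gamma> \<delta> * \<psi>i \<alpha> \<gamma> * cnj (\<psi>i \<beta> \<delta>))) \<and>
     (\<forall>v. complex_of_real (L' v) = complex_of_real (exp (- p)) * (complex_of_real (L v)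
        - 1/2 * (\<Sum>\<alpha><m. \<Sum>\<beta><m. \<psi> \<alpha> \<beta> * (\<Sum>\<gamma><m. h' \<beta> \<gamma> * cnj (\<phi> \<gamma>)) * T \<alpha> v)
        - 1/2 * (\<Sum>\<alpha><m. \<Sum>\<beta><m. cnj (\<psi> \<alpha> \<beta>) * cnj (\<Sum>\<gamma><m. h' \<beta> \<gamma> * cnj (\<phi> \<gamma>)) * cnj (T \<alpha> v))
        - 1/2 * (\<Sum>\<beta><m. (\<Sum>\<gamma><m. h' \<beta> \<gamma> * cnj (\<phi> \<gamma>)) * \<phi> \<beta>) * complex_of_real (T0 v)))"
    (is "?eq \<longleftrightarrow> ?A \<and> ?B")
proof -
  (* T' = y + T0 * \<phi>, and S and F collect the mixed and the pure terms in \<phi> *)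
  define y where "y v \<alpha> = (\<Sum>\<beta><m. \<psi> \<beta> \<alpha> * T \<beta> v)" for v \<alpha>
  let ?h = "hform m h'"
  define F where "F = Re (?h \<phi> \<phi>)"
  define S where "S v = Re (?h (y v) \<phi>)" for v
  have G': "robinson_form m T0' T' L' h' u v = 2 * exp p * (T0 u * L' v + L' u * T0 v) +
      2 * Re (?h (y u) (y v)) + 2 * T0 v * S u + 2 * T0 u * S v + 2 * T0 u * T0 v * F" for u v
  proof -
    have "?h (\<lambda>\<alpha>. T' \<alpha> u) (\<lambda>\<alpha>. T' \<alpha> v) =
        ?h (\<lambda>\<alpha>. y u \<alpha> + complex_of_real (T0 u) * \<phi> \<alpha>) (\<lambda>\<alpha>. y v \<alpha> + complex_of_real (T0 v) * \<phi> \<alpha>)"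
      by (rule hform_cong) (simp_all add: T' y_def mult.commute)
    also have "\<dots> = ?h (y u) (y v) + complex_of_real (T0 v) * ?h (y u) \<phi> +
        complex_of_real (T0 u) * cnj (?h (y v) \<phi>) + complex_of_real (T0 u * T0 v) * ?h \<phi> \<phi>"
      by (simp only: hform_add_left hform_add_right hform_scale_left hform_scale_right
        hform_commute[OF herm', of \<phi> "y v"]) (simp add: algebra_simps)
    finally show ?thesis
      by (simp add: robinson_form_def T0' S_def F_def algebra_simps)
  qed
  have yy: "?h (y u) (y v) = hform m (transform m \<psi> h') (\<lambda>\<alpha>. T \<alpha> u) (\<lambda>\<alpha>. T \<alpha> v)" for u v
    unfolding y_def by (rule hform_transform)
  have inv1: "(\<Sum>\<gamma><m. \<psi> \<alpha> \<gamma> * \<psi>i \<gamma> \<beta>) = (if \<alpha> = \<beta> then 1 else 0)"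
    and inv2: "(\<Sum>\<gamma><m. \<psi>i \<alpha> \<gamma> * \<psi> \<gamma> \<beta>) = (if \<alpha> = \<beta> then 1 else 0)"
    if "\<alpha> < m" "\<beta> < m" for \<alpha> \<beta>
    using inv that by (auto simp: inverse_matrices_def)
  have A: "?A \<longleftrightarrow> (\<forall>\<alpha><m. \<forall>\<beta><m. h \<alpha> \<beta> = transform m \<psi> h' \<alpha> \<beta>)"
  proof
    assume "?A"
    then have "transform m \<psi> h' \<alpha> \<beta> = transform m \<psi> (transform m \<psi>i h) \<alpha> \<beta>" for \<alpha> \<beta>
      by (intro transform_cong) (simp add: transform_def)
    then show "\<forall>\<alpha><m. \<forall>\<beta><m. h \<alpha> \<beta> = transform m \<psi> h' \<alpha> \<beta>"
      using transform_inverse[of m \<psi> \<psi>i] inv1 by simp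
  next
    assume *: "\<forall>\<alpha><m. \<forall>\<beta><m. h \<alpha> \<beta> = transform m \<psi> h' \<alpha> \<beta>"
    have "transform m \<psi>i h \<alpha> \<beta> = transform m \<psi>i (transform m \<psi> h') \<alpha> \<beta>" for \<alpha> \<beta>
      using * by (intro transform_cong) simp
    then show ?A
      using transform_inverse[of m \<psi>i \<psi>] inv2 by (simp add: transform_def[symmetric])
  qed
  have B: "?B \<longleftrightarrow> (\<forall>v. L v = exp p * L' v + S v + F * T0 v / 2)"
  proof -
    have "(\<Sum>\<alpha><m. \<Sum>\<beta><m. \<psi> \<alpha> \<beta> * (\<Sum>\<gamma><m. h' \<beta> \<gamma> * cnj (\<phi> \<gamma>)) * T \<alpha> v) = ?h (y v) \<phi>" for v
    proof -
      have "(\<Sum>\<alpha><m. \<Sum>\<beta><m. \<psi> \<alpha> \<beta> * (\<Sum>\<gamma><m. h' \<beta> \<gamma> * cnj (\<phi> \<gamma>)) * T \<alpha> v) =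
          (\<Sum>\<beta><m. \<Sum>\<alpha><m. \<psi> \<alpha> \<beta> * (\<Sum>\<gamma><m. h' \<beta> \<gamma> * cnj (\<phi> \<gamma>)) * T \<alpha> v)"
        by (rule sum.swap)
      also have "\<dots> = (\<Sum>\<beta><m. (\<Sum>\<gamma><m. h' \<beta> \<gamma> * cnj (\<phi> \<gamma>)) * y v \<beta>)"
        by (simp add: y_def sum_distrib_left mult.commute mult.left_commute)
      also have "\<dots> = ?h (y v) \<phi>"
        by (simp add: hform_def sum_distrib_left algebra_simps)
      finally show ?thesis .
    qed
    note 1 = this
    have 2: "(\<Sum>\<alpha><m. \<Sum>\<beta><m. cnj (\<psi> \<alpha> \<beta>) * cnj (\<Sum>\<gamma><m. h' \<beta> \<gamma> * cnj (\<phi> \<gamma>)) * cnj (T \<alpha> v)) = cnj (?h (y v) \<phi>)" for v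
      unfolding 1[symmetric] by simp
    have "(\<Sum>\<beta><m. (\<Sum>\<gamma><m. h' \<beta> \<gamma> * cnj (\<phi> \<gamma>)) * \<phi> \<beta>) = ?h \<phi> \<phi>"
      by (simp add: hform_def sum_distrib_left algebra_simps)
    also have "\<dots> = complex_of_real F" unfolding F_def by (rule hform_self_real[OF herm', symmetric])
    finally have 3: "(\<Sum>\<beta><m. (\<Sum>\<gamma><m. h' \<beta> \<gamma> * cnj (\<phi> \<gamma>)) * \<phi> \<beta>) = complex_of_real F" .
    have 4: "a - 1/2 * z - 1/2 * cnj z - b = a - complex_of_real (Re z) - b" for a b z
      by (simp add: complex_eq_iff)
    have "?B \<longleftrightarrow> (\<forall>v. complex_of_real (L' v) = complex_of_real (exp (- p) * (L v - S v - 1/2 * F * T0 v)))"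
      unfolding 1 2 3 4 S_def[symmetric] by simp
    also have "\<dots> \<longleftrightarrow> (\<forall>v. L' v = exp (- p) * (L v - S v - 1/2 * F * T0 v))"
      by (simp only: of_real_eq_iff)
    also have "\<dots> \<longleftrightarrow> (\<forall>v. L v = exp p * L' v + S v + F * T0 v / 2)"
      by (auto simp: exp_minus field_simps)
    finally show ?thesis .
  qed
  show ?thesis unfolding A B
  proof
    assume ?eq
    then have eq: "G u v = robinson_form m T0' T' L' h' u v" for u v by blast
    have h: "h \<alpha> \<beta> = transform m \<psi> h' \<alpha> \<beta>" if ab: "\<alpha> < m" "\<beta> < m" for \<alpha> \<beta>
    proof -
      have "Re (h \<alpha> \<beta> * a) = Re (transform m \<psi> h' \<alpha> \<beta> * a)" for a
      proof -
        let ?u = "\<lambda>\<gamma>. if \<gamma> = \<alpha> then a else 0" and ?v = "\<lambda>\<gamma>. if \<gamma> = \<beta> then 1 else 0 :: complex"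
        obtain u v where u: "T0 u = 0" "\<forall>\<gamma><m. T \<gamma> u = ?u \<gamma>" and v: "T0 v = 0" "\<forall>\<gamma><m. T \<gamma> v = ?v \<gamma>"
          using solve0[of 0 ?u] solve0[of 0 ?v] by (elim exE conjE)
        have H: "hform m k (\<lambda>\<alpha>. T \<alpha> u) (\<lambda>\<alpha>. T \<alpha> v) = k \<alpha> \<beta> * a" for k
          unfolding hform_basis[OF ab, symmetric] by (rule hform_cong) (use u v in auto)
        show ?thesis using eq[of u v] unfolding G' yy H by (simp add: robinson_form_def u(1) v(1) H)
      qed
      (* the real part alone determines the entry, as it may be multiplied by i *)
      from this[of 1] this[of "\<i>"] show ?thesis by (simp add: complex_eq_iff)
    qed
    obtain l where l: "T0 l = 1" "\<forall>\<alpha><m. T \<alpha> l = 0" using solve0[of 1 "\<lambda>_. 0"] by (elim exE conjE)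
    have yl: "hform m k (\<lambda>\<alpha>. T \<alpha> l) w = 0" for k w by (rule hform_zero_left) (use l in simp)
    have "S l = 0" using l by (simp add: S_def hform_zero_left y_def)
    then have *: "L v + L l * T0 v = exp p * (L' v + L' l * T0 v) + S v + T0 v * F" for v
      using eq[of l v] unfolding G' yy yl by (simp add: robinson_form_def l(1) yl)
    have "L v = exp p * L' v + S v + F * T0 v / 2" for v
    proof -
      have "L l = exp p * L' l + F / 2" using *[of l] l \<open>S l = 0\<close> by simp
      then show ?thesis using *[of v] by (simp add: algebra_simps)
    qed
    with h show "(\<forall>\<alpha><m. \<forall>\<beta><m. h \<alpha> \<beta> = transform m \<psi> h' \<alpha> \<beta>) \<and> (\<forall>v. L v = exp p * L' v + S v + F * T0 v / 2)"
      by blast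
  next
    assume R: "(\<forall>\<alpha><m. \<forall>\<beta><m. h \<alpha> \<beta> = transform m \<psi> h' \<alpha> \<beta>) \<and> (\<forall>v. L v = exp p * L' v + S v + F * T0 v / 2)"
    then have "hform m h z w = hform m (transform m \<psi> h') z w" for z w
      unfolding hform_def by (intro sum.cong refl) simp
    then show ?eq
      unfolding G' yy using R by (simp add: robinson_form_def algebra_simps)
  qed
qed

end

section \<open>The lifted metric, its orientation and its time-orientation\<close>

text \<open>The situation of the theorem: an oriented almost CR manifold with a triplet.\<close>
locale robinson_setup = line_mfd c
  for c :: "('a::{t2_space, second_countable_topology}, 'e::euclidean_space) atlas" +
  fixes m :: nat
    and ori :: "'a \<Rightarrow> ((nat \<Rightarrow> 'e) \<Rightarrow> real) set"
    and H :: "'a \<Rightarrow> 'e set" and J :: "'a \<Rightarrow> 'e \<Rightarrow> 'e" and A :: "'a \<Rightarrow> ('e \<Rightarrow> real) set"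
    and \<theta>0 :: "'a \<Rightarrow> 'e \<Rightarrow> real" and \<theta> :: "nat \<Rightarrow> 'a \<Rightarrow> 'e \<Rightarrow> complex"
    and h :: "nat \<Rightarrow> nat \<Rightarrow> real \<times> 'a \<Rightarrow> complex"
    and lam :: "real \<times> 'a \<Rightarrow> real \<times> 'e \<Rightarrow> real"
  assumes cr: "oriented_almost_cr_manifold c m ori H J A"
    and triplet: "robinson_triplet c m H J A \<theta>0 \<theta> h lam"
begin

text \<open>The total space, the pulled back coframe, the metric, and the vertical vector.\<close>
abbreviation "M \<equiv> line_bundle c"
abbreviation "T0 \<equiv> lift_form c \<theta>0"
abbreviation "T x \<equiv> (\<lambda>\<alpha>. lift_form c (\<theta> \<alpha>) x)"
abbreviation "g \<equiv> robinson_metric c m \<theta>0 \<theta> h lam"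
abbreviation vertical :: "real \<times> 'e" where "vertical \<equiv> (1, 0)"

lemma dim_base: "DIM('e) = 2 * m + 1" and ori: "orientation c ori"
  using cr by (simp_all add: oriented_almost_cr_manifold_def)

lemma theta0_form: "one_form_on c UNIV \<theta>0"
  and theta_form: "\<alpha> < m \<Longrightarrow> one_form_on c UNIV (\<theta> \<alpha>)"
  and theta_coframe: "coframe m (\<theta>0 p) (\<lambda>\<alpha>. \<theta> \<alpha> p)"
  and h_smooth: "\<alpha> < m \<Longrightarrow> \<beta> < m \<Longrightarrow> smooth_fun M (h \<alpha> \<beta>)"
  and h_herm: "pos_def_hermitian m (\<lambda>\<alpha> \<beta>. h \<alpha> \<beta> x)"
  and lam_form: "one_form_on M UNIV lam"
  using triplet unfolding robinson_triplet_def cr_coframe_def by blast+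

lemma theta0_linear: "linear (\<theta>0 p)" and theta_linear: "\<alpha> < m \<Longrightarrow> linear (\<theta> \<alpha> p)"
  and lam_linear: "linear (lam x)"
  by (rule one_form_on_linear[OF theta0_form UNIV_I], erule one_form_on_linear[OF theta_form UNIV_I],
      rule line.one_form_on_linear[OF lam_form UNIV_I])

lemma T0_form: "one_form_on M UNIV T0"
  using one_form_on_lift[OF open_UNIV theta0_form] by simp

lemma T_form: "\<alpha> < m \<Longrightarrow> one_form_on M UNIV (lift_form c (\<theta> \<alpha>))"
  using one_form_on_lift[OF open_UNIV theta_form] by simp

text \<open>The coframe provides a nowhere vanishing form of top degree on the base.\<close>
lemma top_form_exists: "\<exists>\<epsilon>. nform_on c (2 * m + 1) UNIV \<epsilon> \<and> (\<forall>p. \<epsilon> p \<noteq> (\<lambda>_. 0))"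
proof -
  define \<eta> where "\<eta> i p = real_coframe (\<theta>0 p) (\<lambda>\<alpha>. \<theta> \<alpha> p) i" for i p
  have form: "one_form_on c UNIV (\<eta> i)" if i: "i < 2 * m + 1" for i
    unfolding one_form_on_def
  proof (intro conjI ballI allI)
    show "linear (\<eta> i p)" for p
      unfolding \<eta>_def by (rule real_coframe_linear[OF theta0_linear theta_linear i])
    fix p u
    let ?S = "cmap c p ` (cdom c p \<inter> UNIV)"
    have op: "open ?S" by (rule open_cmap_image) simp
    define k where "k = (i - 1) div 2"
    have "smooth_on ?S (\<lambda>y. \<theta>0 (cinv c p y) (tchange c p (cinv c p y) (cinv c p y) u))"
      using theta0_form by (simp add: one_form_on_def Let_def)
    moreover have "smooth_on ?S (\<lambda>y. Re (\<theta> k (cinv c p y) (tchange c p (cinv c p y) (cinv c p y) u)))"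
      "smooth_on ?S (\<lambda>y. Im (\<theta> k (cinv c p y) (tchange c p (cinv c p y) (cinv c p y) u)))" if "i \<noteq> 0"
    proof -
      have "k < m" using i that by (auto simp: k_def)
      then have "smooth_on ?S (\<lambda>y. \<theta> k (cinv c p y) (tchange c p (cinv c p y) (cinv c p y) u))"
        using theta_form by (simp add: one_form_on_def Let_def)
      then show "smooth_on ?S (\<lambda>y. Re (\<theta> k (cinv c p y) (tchange c p (cinv c p y) (cinv c p y) u)))"
        "smooth_on ?S (\<lambda>y. Im (\<theta> k (cinv c p y) (tchange c p (cinv c p y) (cinv c p y) u)))"
        by (rule smooth_on_Re[OF op], rule smooth_on_Im[OF op])
    qed
    ultimately show "smooth_on ?S (\<lambda>y. let r = cinv c p y in \<eta> i r (tchange c p r r u))"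
      unfolding \<eta>_def real_coframe_def Let_def k_def[symmetric]
      by (cases "i = 0"; cases "odd i") simp_all
  qed
  have "iterated_wedge (2 * m + 1) (\<lambda>i. \<eta> i p) \<noteq> (\<lambda>_. 0)" for p
  proof -
    have "\<exists>v. \<forall>i<2 * m + 1. \<eta> i p v = (if i = j then 1 else 0)" for j
      unfolding \<eta>_def by (rule real_coframe_dual[OF theta_coframe theta0_linear theta_linear])
    then obtain f where "\<And>j i. i < 2 * m + 1 \<Longrightarrow> \<eta> i p (f j) = (if i = j then 1 else 0)" by metis
    from iterated_wedge_dual[of "2 * m + 1" "\<lambda>i. \<eta> i p" f, OF this]
    show ?thesis by (auto dest: fun_cong)
  qed
  moreover have "nform_on c (2 * m + 1) UNIV (\<lambda>p. iterated_wedge (2 * m + 1) (\<lambda>i. \<eta> i p))"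
    by (rule nform_on_iterated_wedge[OF open_UNIV form])
  ultimately show ?thesis by blast
qed

text \<open>If \<open>lam\<close> vanished on the vertical direction, \<open>lam \<and> \<epsilon>\<close> would be the pullback of a form
  of degree \<open>2 m + 2\<close> on the base, of dimension \<open>2 m + 1\<close>.\<close>
lemma lam_vertical: "lam x vertical \<noteq> 0"
proof
  assume 0: "lam x vertical = 0"
  obtain \<epsilon> where \<epsilon>: "nform_on c (2 * m + 1) UNIV \<epsilon>" "\<forall>p. \<epsilon> p \<noteq> (\<lambda>_. 0)" using top_form_exists by blast
  have lam0: "lam x v = lam x (0, snd v)" for v
  proof -
    have "v = fst v *\<^sub>R vertical + (0, snd v)" by (cases v) simp
    then show ?thesis by (metis 0 add_0 linear_add[OF lam_linear] linear_cmul[OF lam_linear] scaleR_zero_right)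
  qed
  have "linear (\<lambda>u. lam x (0, u))"
    using linear_compose[OF _ lam_linear[of x], of "\<lambda>u. (0, u)"]
    by (simp add: o_def linear_iff)
  then have alt: "alternating_form (Suc (2 * m + 1)) (wedge1 (2 * m + 1) (\<lambda>u. lam x (0, u)) (\<epsilon> (snd x)))"
    using \<epsilon>(1) by (intro wedge1_alternating) (auto simp: nform_on_def)
  have "wedge1 (2 * m + 1) (lam x) (form_pullback M c snd x (\<epsilon> (snd x))) v = 0" for v
  proof -
    have "wedge1 (2 * m + 1) (lam x) (form_pullback M c snd x (\<epsilon> (snd x))) v =
        wedge1 (2 * m + 1) (\<lambda>u. lam x (0, u)) (\<epsilon> (snd x)) (\<lambda>i. snd (v i))"
      unfolding wedge1_def form_pullback_line
      by (intro sum.cong refl arg_cong2[of _ _ _ _ "(*)"] lam0 arg_cong[of _ _ "\<epsilon> (snd x)"] ext) simp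
    also have "\<dots> = 0" by (rule alternating_form_above_dim[OF alt]) (simp add: dim_base)
    finally show ?thesis .
  qed
  then have "wedge1 (2 * m + 1) (lam x) (form_pullback M c snd x (\<epsilon> (snd x))) = (\<lambda>_. 0)" by blast
  moreover have "wedge1 (2 * m + 1) (lam x) (form_pullback M c snd x (\<epsilon> (snd x))) \<noteq> (\<lambda>_. 0)"
    using triplet \<epsilon> unfolding robinson_triplet_def by blast
  ultimately show False by blast
qed

text \<open>At every point, the lifted data satisfy the assumptions of the pointwise analysis.\<close>
lemma robinson_point: "robinson_point m (T0 x) (T x) (lam x) (\<lambda>\<alpha> \<beta>. h \<alpha> \<beta> x) vertical"
proof (rule robinson_point.intro)
  show "linear (T0 x)" by (rule line.one_form_on_linear[OF T0_form UNIV_I])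
  show "linear (T x \<alpha>)" if "\<alpha> < m" for \<alpha> by (rule line.one_form_on_linear[OF T_form[OF that] UNIV_I])
  show "linear (lam x)" by (rule lam_linear)
  show "pos_def_hermitian m (\<lambda>\<alpha> \<beta>. h \<alpha> \<beta> x)" by (rule h_herm)
  show "T0 x vertical = 0" by (simp add: lift_form_apply linear_0[OF theta0_linear])
  show "T x \<alpha> vertical = 0" if "\<alpha> < m" for \<alpha> by (simp add: lift_form_apply linear_0[OF theta_linear[OF that]])
  show "lam x vertical \<noteq> 0" by (rule lam_vertical)
  show "\<exists>s. v = s *\<^sub>R vertical" if "T0 x v = 0" "\<And>\<alpha>. \<alpha> < m \<Longrightarrow> T x \<alpha> v = 0" for v
  proof -
    have "snd v = 0"
      by (rule coframe_inj[OF theta_coframe[of "snd x"]]) (use that in \<open>auto simp: lift_form_apply\<close>)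
    then show ?thesis by (intro exI[of _ "fst v"]) (simp add: prod_eq_iff)
  qed
  show "\<exists>v. T0 x v = a0 \<and> (\<forall>\<alpha><m. T x \<alpha> v = a \<alpha>)" for a0 a
  proof -
    obtain u where "\<theta>0 (snd x) u = a0 \<and> (\<forall>\<alpha><m. \<theta> \<alpha> (snd x) u = a \<alpha>)"
      using coframe_solve[OF theta_coframe theta0_linear theta_linear] by (rule exE)
    then show ?thesis by (intro exI[of _ "(0, u)"]) (simp add: lift_form_apply)
  qed
qed

sublocale point: robinson_point m "T0 x" "T x" "lam x" "\<lambda>\<alpha> \<beta>. h \<alpha> \<beta> x" vertical for x
  by (rule robinson_point)

lemma tensor_eq: "robinson_tensor c m \<theta>0 \<theta> h lam x u v =
    complex_of_real (robinson_form m (T0 x) (T x) (lam x) (\<lambda>\<alpha> \<beta>. h \<alpha> \<beta> x) u v)"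
  unfolding robinson_tensor_def by (rule robinson_form_tensor[OF h_herm])

lemma metric_eq: "g x = robinson_form m (T0 x) (T x) (lam x) (\<lambda>\<alpha> \<beta>. h \<alpha> \<beta> x)"
  by (intro ext) (simp add: robinson_metric_def tensor_eq)

lemma metric_real: "complex_of_real (g x u v) = robinson_tensor c m \<theta>0 \<theta> h lam x u v"
  by (simp add: metric_eq tensor_eq)

text \<open>The metric is built from smooth 1-forms and the smooth functions \<open>h \<alpha> \<beta>\<close>.\<close>
lemma metric_apply_smooth:
  assumes U: "open U" and X: "vector_field_on M U X" and Y: "vector_field_on M U Y"
  shows "line.smooth_fun_on U (\<lambda>r. g r (X r) (Y r))"
proof -
  note form = line.one_form_apply_smooth[OF U line.one_form_on_subset[OF _ subset_UNIV]]
  note lin = line.smooth_fun_on_linear[OF U] and mult = line.smooth_fun_on_mult[OF U]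
  have hh: "line.smooth_fun_on U (\<lambda>r. \<Sum>\<alpha><m. \<Sum>\<beta><m. h \<alpha> \<beta> r * T r \<alpha> (X r) * cnj (T r \<beta> (Y r)))"
  proof (rule line.smooth_fun_on_sum[OF U], rule line.smooth_fun_on_sum[OF U])
    fix \<alpha> \<beta> assume ab: "\<alpha> \<in> {..<m}" "\<beta> \<in> {..<m}"
    have "line.smooth_fun_on U (h \<alpha> \<beta>)"
      by (rule line.smooth_fun_on_subset[OF line.smooth_fun_imp_on[OF h_smooth]]) (use ab in auto)
    moreover have "line.smooth_fun_on U (\<lambda>r. T r \<alpha> (X r))"
      by (rule form[OF T_form X]) (use ab in simp)
    moreover have "line.smooth_fun_on U (\<lambda>r. cnj (T r \<beta> (Y r)))"
      by (rule lin[OF bounded_linear_cnj form[OF T_form Y]]) (use ab in simp)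
    ultimately show "line.smooth_fun_on U (\<lambda>r. h \<alpha> \<beta> r * T r \<alpha> (X r) * cnj (T r \<beta> (Y r)))"
      by (intro mult)
  qed
  have "line.smooth_fun_on U (\<lambda>r. 2 * (T0 r (X r) * lam r (Y r) + lam r (X r) * T0 r (Y r)) +
      2 * Re (\<Sum>\<alpha><m. \<Sum>\<beta><m. h \<alpha> \<beta> r * T r \<alpha> (X r) * cnj (T r \<beta> (Y r))))"
    by (intro line.smooth_fun_on_add[OF U] lin[OF bounded_linear_mult_right] mult
      lin[OF bounded_linear_Re hh] form[OF T0_form X] form[OF T0_form Y] form[OF lam_form X] form[OF lam_form Y])
  then show ?thesis by (simp add: metric_eq robinson_form_def hform_def)
qed

lemma metric_lorentzian: "lorentzian_metric M g"
  unfolding lorentzian_metric_def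
proof (intro conjI allI)
  show "lorentzian_form (g p)" for p unfolding metric_eq by (rule point.G_lorentzian)
  fix p u v
  have "line.smooth_fun_on (cdom M p) (\<lambda>r. g r (tchange M p r r u) (tchange M p r r v))"
    by (rule metric_apply_smooth[OF line.open_cdom line.constant_vector_field line.constant_vector_field])
  then have "smooth_on (cmap M p ` (cdom M p \<inter> cdom M p))
      (\<lambda>y. g (cinv M p y) (tchange M p (cinv M p y) (cinv M p y) u) (tchange M p (cinv M p y) (cinv M p y) v))"
    by (rule line.smooth_fun_onD)
  then show "smooth_on (cmap M p ` cdom M p) (gloc M g p u v)"
    unfolding gloc_def[abs_def] Let_def Int_absorb .
qed

text \<open>If \<open>\<omega>\<close> represents the orientation of the base, \<open>lam \<and> \<omega>\<close> represents that of the total space. It is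
  nonzero because \<open>lam\<close> is nonzero on the vertical direction, which \<open>\<omega>\<close> annihilates.\<close>
lemma total_orientation: "orientation M (total_orientation c ori lam)"
  unfolding orientation_def
proof
  fix x :: "real \<times> 'a"
  obtain U \<omega> where U: "open U" "snd x \<in> U" "nform_on c DIM('e) U \<omega>"
    and \<omega>': "\<forall>q\<in>U. \<omega> q \<noteq> (\<lambda>_. 0) \<and> ori q = {(\<lambda>v. r * \<omega> q v) |r. r > 0}"
    using ori[unfolded orientation_def, THEN spec, of "snd x"] by (elim exE conjE)
  note \<omega> = bspec[OF \<omega>']
  define \<Omega> where "\<Omega> y = wedge1 DIM('e) (lam y) (form_pullback M c snd y (\<omega> (snd y)))" for y
  have "nform_on M (Suc DIM('e)) (UNIV \<times> U) \<Omega>"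
    unfolding \<Omega>_def
    by (rule line.nform_on_wedge1[where lam = lam and \<omega> = "\<lambda>y. form_pullback M c snd y (\<omega> (snd y))",
          OF _ line.one_form_on_subset[OF lam_form] nform_on_lift[OF U(1,3)]])
      (auto simp: open_Times U)
  then have "nform_on M DIM(real \<times> 'e) (UNIV \<times> U) \<Omega>" by simp
  moreover have "\<Omega> y \<noteq> (\<lambda>_. 0) \<and> total_orientation c ori lam y = {(\<lambda>v. r * \<Omega> y v) |r. r > 0}"
    if y: "y \<in> UNIV \<times> U" for y
  proof
    have yU: "snd y \<in> U" using y by auto
    have alt: "alternating_form DIM('e) (\<omega> (snd y))" using U(3) yU by (auto simp: nform_on_def)
    obtain w where w: "\<omega> (snd y) w \<noteq> 0" using \<omega>[OF yU] by (auto simp: fun_eq_iff)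
    let ?v = "\<lambda>i. case i of 0 \<Rightarrow> vertical | Suc j \<Rightarrow> (0, w j)"
    have "\<Omega> y ?v = (\<Sum>i\<in>{0}. (-1) ^ i * lam y (?v i) * \<omega> (snd y) (\<lambda>j. snd (if j < i then ?v j else ?v (Suc j))))"
      unfolding \<Omega>_def wedge1_def form_pullback_line
    proof (rule sum.mono_neutral_right, goal_cases)
      case 3
      have "\<omega> (snd y) (\<lambda>j. snd (if j < i then ?v j else ?v (Suc j))) = 0" if i: "0 < i" for i
      proof -
        let ?w = "\<lambda>j. snd (if j < i then ?v j else ?v (Suc j))"
        have "linear (\<lambda>z. \<omega> (snd y) (?w(0 := z)))" by (rule alternating_form_linear[OF alt]) simp
        from linear_0[OF this] have "\<omega> (snd y) (?w(0 := 0)) = 0" .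
        moreover have "?w(0 := 0) = ?w" using i by auto
        ultimately show ?thesis by (simp only:)
      qed
      then show ?case by auto
    qed auto
    then have "\<Omega> y ?v = lam y vertical * \<omega> (snd y) w" by simp
    then have "\<Omega> y ?v \<noteq> 0" using w lam_vertical[of y] by simp
    then show "\<Omega> y \<noteq> (\<lambda>_. 0)" by metis
    have "wedge1 DIM('e) (lam y) (form_pullback M c snd y (\<lambda>v. r * \<omega> (snd y) v)) = (\<lambda>v. r * \<Omega> y v)" for r
      by (rule ext) (simp add: \<Omega>_def wedge1_def form_pullback_def sum_distrib_left algebra_simps)
    note scale = this
    have "ori (snd y) = (\<lambda>r v. r * \<omega> (snd y) v) ` {0<..}" using \<omega>[OF yU] by (auto simp: image_def)
    then have "total_orientation c ori lam y =
        (\<lambda>r. wedge1 DIM('e) (lam y) (form_pullback M c snd y (\<lambda>v. r * \<omega> (snd y) v))) ` {0<..}"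
      by (auto simp: total_orientation_def)
    also have "\<dots> = {(\<lambda>v. r * \<Omega> y v) |r. r > 0}" unfolding scale by auto
    finally show "total_orientation c ori lam y = {(\<lambda>v. r * \<Omega> y v) |r. r > 0}" .
  qed
  moreover have "open (UNIV \<times> U)" "x \<in> UNIV \<times> U" using U by (auto simp: open_Times mem_Times_iff)
  ultimately show "\<exists>U \<omega>. open U \<and> x \<in> U \<and> nform_on M DIM(real \<times> 'e) U \<omega> \<and>
     (\<forall>q\<in>U. \<omega> q \<noteq> (\<lambda>_. 0) \<and> total_orientation c ori lam q = {\<lambda>v. r * \<omega> q v |r. r > 0})"
    by blast
qed

text \<open>The future cones: timelike vectors on which \<open>\<theta>0\<close> is positive.\<close>
definition future :: "real \<times> 'a \<Rightarrow> (real \<times> 'e) set" where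
  "future x = {v. g x v v < 0 \<and> T0 x v > 0}"

text \<open>Being future directed is an open condition, so the constant extension, in a chart, of a future
  directed vector is a local section.\<close>
lemma time_orientation: "time_orientation M g future"
  unfolding time_orientation_def
proof (intro conjI allI)
  fix x
  obtain u where u: "T0 x u = 1" "g x u u < 0" using point.timelike_exists[of x] by (auto simp: metric_eq)
  have "future x = {v. g x v v < 0 \<and> g x u v < 0}"
    unfolding future_def metric_eq by (rule point.cone_eq) (use u in \<open>simp_all add: metric_eq\<close>)
  then show "\<exists>u. g x u u < 0 \<and> future x = {v. g x v v < 0 \<and> g x u v < 0}" using u by blast
  define X where "X r = tchange M x r r u" for r
  have X: "vector_field_on M (cdom M x) X" unfolding X_def by (rule line.constant_vector_field)
  have op: "open (cdom M x)" by (rule line.open_cdom)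
  define U where "U = (cdom M x \<inter> (\<lambda>r. g r (X r) (X r)) -` {..<0}) \<inter> (cdom M x \<inter> (\<lambda>r. T0 r (X r)) -` {0<..})"
  have "open U"
    unfolding U_def
    by (intro open_Int continuous_open_preimage line.smooth_fun_on_continuous[OF op] op
      metric_apply_smooth[OF op X X] open_lessThan open_greaterThan
      line.one_form_apply_smooth[OF op line.one_form_on_subset[OF T0_form subset_UNIV] X])
  moreover have "x \<in> U" using u by (simp add: U_def X_def line.tchange_self del: cdom_product)
  moreover have "vector_field_on M U X" by (rule line.vector_field_on_subset[OF X]) (auto simp: U_def)
  moreover have "\<forall>q\<in>U. X q \<in> future q" by (auto simp: U_def future_def)
  ultimately show "\<exists>U X. open U \<and> x \<in> U \<and> vector_field_on M U X \<and> (\<forall>q\<in>U. X q \<in> future q)" by blast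
qed

lemma lorentzian_manifold: "oriented_lorentzian_manifold M g (total_orientation c ori lam) future"
  unfolding oriented_lorentzian_manifold_def
  using line.mfd metric_lorentzian total_orientation time_orientation by blast

end

section \<open>Smooth frames of annihilators\<close>

text \<open>The family \<open>Z 0, \<dots>, Z (n - 1)\<close> is a complex basis of \<open>D\<close>.\<close>
definition cframe :: "nat \<Rightarrow> (nat \<Rightarrow> 'e::real_vector \<times> 'e) \<Rightarrow> ('e \<times> 'e) set \<Rightarrow> bool" where
  "cframe n Z D \<longleftrightarrow> (\<forall>w. w \<in> D \<longleftrightarrow> (\<exists>a. w = (\<Sum>i<n. cscale (a i) (Z i)))) \<and>
     (\<forall>a. (\<Sum>i<n. cscale (a i) (Z i)) = 0 \<longrightarrow> (\<forall>i<n. a i = 0))"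

lemma cframe_span:
  assumes "cframe n Z D"
  shows "D = cvec.span {Z i |i. i < n}" "cvec.subspace D" "cvec.dim D = n"
proof -
  have mem: "w \<in> D \<longleftrightarrow> (\<exists>a. w = (\<Sum>i<n. cscale (a i) (Z i)))" for w
    using assms unfolding cframe_def by blast
  have ind: "(\<Sum>i<n. cscale (a i) (Z i)) = 0 \<Longrightarrow> i < n \<Longrightarrow> a i = 0" for a i
    using assms unfolding cframe_def by blast
  have inj: "inj_on Z {..<n}"
  proof (rule inj_onI, rule ccontr)
    fix i j assume ij: "i \<in> {..<n}" "j \<in> {..<n}" "Z i = Z j" "i \<noteq> j"
    let ?a = "\<lambda>k. (if k = i then 1 else 0) - (if k = j then 1 else 0 :: complex)"
    have "(\<Sum>k<n. cscale (?a k) (Z k)) =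
        (\<Sum>k<n. (if k = i then Z k else 0)) - (\<Sum>k<n. (if k = j then Z k else 0))"
      unfolding sum_subtractf[symmetric]
      by (rule sum.cong) (auto simp: cvec.scale_left_diff_distrib cvec.scale_minus_left)
    also have "\<dots> = 0" using ij by simp
    finally have "?a i = 0" using ij by (intro ind[of ?a i]) auto
    then show False using ij by simp
  qed
  have set: "{Z i |i. i < n} = Z ` {..<n}" by auto
  have reindex: "(\<Sum>v\<in>Z ` {..<n}. cscale (u v) v) = (\<Sum>i<n. cscale (u (Z i)) (Z i))" for u
    by (simp add: sum.reindex[OF inj])
  show span: "D = cvec.span {Z i |i. i < n}"
    unfolding set cvec.span_finite[OF finite_imageI[OF finite_lessThan]] reindex
  proof (intro set_eqI iffI)
    fix w assume "w \<in> D"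
    then obtain a where w: "w = (\<Sum>i<n. cscale (a i) (Z i))" using mem by blast
    have "w = (\<Sum>i<n. cscale (a (inv_into {..<n} Z (Z i))) (Z i))"
      unfolding w by (rule sum.cong) (simp_all add: inv_into_f_f[OF inj])
    then show "w \<in> range (\<lambda>u. \<Sum>i<n. cscale (u (Z i)) (Z i))"
      by (intro image_eqI[of _ _ "\<lambda>v. a (inv_into {..<n} Z v)"]) auto
  next
    fix w assume "w \<in> range (\<lambda>u. \<Sum>i<n. cscale (u (Z i)) (Z i))"
    then obtain u where "w = (\<Sum>i<n. cscale (u (Z i)) (Z i))" by blast
    then show "w \<in> D" unfolding mem by (intro exI[of _ "\<lambda>i. u (Z i)"])
  qed
  show "cvec.subspace D" unfolding span by (rule cvec.subspace_span)
  have "cvec.independent (Z ` {..<n})"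
    unfolding cvec.dependent_explicit
  proof clarify
    fix t u v assume t: "finite t" "t \<subseteq> Z ` {..<n}" "(\<Sum>v\<in>t. cscale (u v) v) = 0" and v: "v \<in> t" "u v \<noteq> 0"
    let ?u = "\<lambda>v. if v \<in> t then u v else 0"
    have "(\<Sum>v\<in>Z ` {..<n}. cscale (?u v) v) = (\<Sum>v\<in>t. cscale (u v) v)"
      by (rule sum.mono_neutral_cong_right) (use t in auto)
    then have 0: "(\<Sum>i<n. cscale (?u (Z i)) (Z i)) = 0" unfolding reindex t(3) .
    obtain i where "i < n" "v = Z i" using t(2) v by auto
    then show False using ind[of "\<lambda>i. ?u (Z i)" i, OF 0] v by simp
  qed
  then show "cvec.dim D = n"
    unfolding span set using cvec.dim_span_eq_card_independent[of "Z ` {..<n}"] card_image[OF inj] by simp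
qed

lemma cext_add:
  assumes "linear \<theta>"
  shows "cext \<theta> (w + z) = cext \<theta> w + cext \<theta> z"
  by (simp add: cext_def linear_add[OF assms] algebra_simps)

lemma cext_cscale:
  assumes "linear \<theta>"
  shows "cext \<theta> (cscale a w) = a * cext \<theta> w"
proof -
  have "complex_of_real (Re a) + \<i> * complex_of_real (Im a) = a" by (rule complex_eq[symmetric])
  moreover have "cext \<theta> (cscale a w) = (complex_of_real (Re a) + \<i> * complex_of_real (Im a)) * cext \<theta> w"
    by (simp add: cext_def cscale_def linear_add[OF assms] linear_diff[OF assms] linear_cmul[OF assms]
      scaleR_conv_of_real algebra_simps)
  ultimately show ?thesis by simp
qed

lemma cext_sum:
  assumes "linear \<theta>"
  shows "cext \<theta> (\<Sum>i\<in>I. cscale (a i) (Z i)) = (\<Sum>i\<in>I. a i * cext \<theta> (Z i))"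
proof (induction I rule: infinite_finite_induct)
  case (insert i I)
  then show ?case by (simp add: cext_add[OF assms] cext_cscale[OF assms])
qed (simp_all add: cext_def linear_0[OF assms])

text \<open>A basis of \<open>D\<close> yields a basis of a hyperplane in \<open>D\<close> by elimination of one of its members.\<close>
lemma cframe_eliminate:
  assumes fr: "cframe (Suc n) Z D" and lin: "linear \<theta>" and nz: "cext \<theta> (Z n) \<noteq> 0"
  shows "cframe n (\<lambda>i. Z i - cscale (cext \<theta> (Z i) * inverse (cext \<theta> (Z n))) (Z n)) {w \<in> D. cext \<theta> w = 0}"
proof -
  define k where "k i = cext \<theta> (Z i) * inverse (cext \<theta> (Z n))" for i
  have mem: "w \<in> D \<longleftrightarrow> (\<exists>a. w = (\<Sum>i<Suc n. cscale (a i) (Z i)))" for w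
    using fr unfolding cframe_def by blast
  have ind: "(\<Sum>i<Suc n. cscale (a i) (Z i)) = 0 \<Longrightarrow> i < Suc n \<Longrightarrow> a i = 0" for a i
    using fr unfolding cframe_def by blast
  (* the last coefficient of an element of the hyperplane is determined by the others *)
  define ext where "ext a i = (if i < n then a i else - (\<Sum>i<n. a i * k i))" for a i
  have eq: "(\<Sum>i<n. cscale (a i) (Z i - cscale (k i) (Z n))) = (\<Sum>i<Suc n. cscale (ext a i) (Z i))" for a
    by (simp add: ext_def cvec.scale_right_diff_distrib sum_subtractf cvec.scale_sum_left)
  have 0: "cext \<theta> (\<Sum>i<Suc n. cscale (ext a i) (Z i)) = 0" for a
    using nz by (simp add: cext_sum[OF lin] ext_def k_def sum_distrib_right mult.assoc del: sum.lessThan_Suc)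
      (simp add: ext_def k_def sum_distrib_right mult.assoc)
  show ?thesis
    unfolding cframe_def k_def[symmetric] eq
  proof (intro conjI allI impI)
    fix w
    show "w \<in> {w \<in> D. cext \<theta> w = 0} \<longleftrightarrow> (\<exists>a. w = (\<Sum>i<Suc n. cscale (ext a i) (Z i)))"
    proof
      assume w: "w \<in> {w \<in> D. cext \<theta> w = 0}"
      then obtain a where a: "w = (\<Sum>i<Suc n. cscale (a i) (Z i))" using mem by blast
      have "(\<Sum>i<n. a i * cext \<theta> (Z i)) + a n * cext \<theta> (Z n) = 0"
        using w cext_sum[OF lin, of a Z "{..<Suc n}"] unfolding a[symmetric] by simp
      then have an: "a n * cext \<theta> (Z n) = - (\<Sum>i<n. a i * cext \<theta> (Z i))"
        by (simp add: eq_neg_iff_add_eq_0 add.commute)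
      have "a n = a n * cext \<theta> (Z n) * inverse (cext \<theta> (Z n))" using nz by simp
      also have "\<dots> = - (\<Sum>i<n. a i * k i)"
        unfolding an by (simp add: k_def sum_distrib_right mult.assoc)
      finally have "a n = - (\<Sum>i<n. a i * k i)" .
      then have "w = (\<Sum>i<Suc n. cscale (ext a i) (Z i))" unfolding a by (simp add: ext_def)
      then show "\<exists>a. w = (\<Sum>i<Suc n. cscale (ext a i) (Z i))" by (rule exI[of _ a])
    next
      assume "\<exists>a. w = (\<Sum>i<Suc n. cscale (ext a i) (Z i))"
      then show "w \<in> {w \<in> D. cext \<theta> w = 0}" using 0 mem by auto
    qed
  next
    fix a i assume "(\<Sum>i<Suc n. cscale (ext a i) (Z i)) = 0" "i < n"
    then show "a i = 0" using ind[of "ext a" i] by (simp add: ext_def)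
  qed
qed

lemma cframe_permute:
  assumes "cframe n Z D" "bij_betw \<pi> {..<n} {..<n}"
  shows "cframe n (\<lambda>i. Z (\<pi> i)) D"
proof -
  let ?\<rho> = "inv_into {..<n} \<pi>"
  have \<pi>: "\<pi> i < n" "?\<rho> (\<pi> i) = i" if "i < n" for i
    using that assms(2) bij_betw_inv_into_left[OF assms(2), of i] by (auto dest: bij_betwE)
  have \<rho>: "?\<rho> i < n" if "i < n" for i
    using that bij_betw_inv_into[OF assms(2)] by (auto dest: bij_betwE)
  have eq: "(\<Sum>i<n. cscale (a i) (Z (\<pi> i))) = (\<Sum>i<n. cscale (a (?\<rho> i)) (Z i))" for a
  proof -
    have "(\<Sum>i<n. cscale (a (?\<rho> i)) (Z i)) = (\<Sum>i<n. cscale (a (?\<rho> (\<pi> i))) (Z (\<pi> i)))"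
      by (rule sum.reindex_bij_betw[OF assms(2), symmetric])
    also have "\<dots> = (\<Sum>i<n. cscale (a i) (Z (\<pi> i)))"
      by (rule sum.cong) (simp_all add: \<pi>)
    finally show ?thesis by (rule sym)
  qed
  show ?thesis
    unfolding cframe_def
  proof (intro conjI allI impI)
    fix w
    have "(\<exists>a. w = (\<Sum>i<n. cscale (a i) (Z i))) \<longleftrightarrow> (\<exists>a. w = (\<Sum>i<n. cscale (a i) (Z (\<pi> i))))"
    proof
      assume "\<exists>a. w = (\<Sum>i<n. cscale (a i) (Z i))"
      then obtain a where a: "w = (\<Sum>i<n. cscale (a i) (Z i))" ..
      have "w = (\<Sum>i<n. cscale (a (\<pi> i)) (Z (\<pi> i)))"
        unfolding a by (rule sum.reindex_bij_betw[OF assms(2), symmetric])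
      then show "\<exists>a. w = (\<Sum>i<n. cscale (a i) (Z (\<pi> i)))" by (intro exI[of _ "\<lambda>i. a (\<pi> i)"])
    next
      assume "\<exists>a. w = (\<Sum>i<n. cscale (a i) (Z (\<pi> i)))"
      then show "\<exists>a. w = (\<Sum>i<n. cscale (a i) (Z i))" unfolding eq by (elim exE) (rule exI)
    qed
    then show "w \<in> D \<longleftrightarrow> (\<exists>a. w = (\<Sum>i<n. cscale (a i) (Z (\<pi> i))))"
      using assms(1) unfolding cframe_def by blast
  next
    fix a i assume "(\<Sum>i<n. cscale (a i) (Z (\<pi> i))) = 0" "i < n"
    then have "(\<Sum>i<n. cscale (a (?\<rho> i)) (Z i)) = 0" "\<pi> i < n" using \<pi> unfolding eq by auto
    then have "a (?\<rho> (\<pi> i)) = 0"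
      using assms(1)[unfolded cframe_def, THEN conjunct2, rule_format, of "\<lambda>i. a (?\<rho> i)" "\<pi> i"] by simp
    then show "a i = 0" using \<pi>(2)[OF \<open>i < n\<close>] by simp
  qed
qed

context smooth_mfd
begin

lemma cvector_field_on_subset: "cvector_field_on c U Z \<Longrightarrow> V \<subseteq> U \<Longrightarrow> cvector_field_on c V Z"
  using vector_field_on_subset by (auto simp: cvector_field_on_def)

lemma cvector_field_on_diff_cscale:
  assumes U: "open U" and a: "smooth_fun_on U a" and Z: "cvector_field_on c U Z" and W: "cvector_field_on c U W"
  shows "cvector_field_on c U (\<lambda>q. Z q - cscale (a q) (W q))"
proof -
  note sc = vector_field_on_scaleR[OF U] and add = vector_field_on_add[OF U]
  note lin = smooth_fun_on_linear[OF U _ a]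
  have Re: "smooth_fun_on U (\<lambda>q. Re (a q))" "smooth_fun_on U (\<lambda>q. - Re (a q))"
    and Im: "smooth_fun_on U (\<lambda>q. Im (a q))" "smooth_fun_on U (\<lambda>q. - Im (a q))"
    by (rule lin, intro bounded_linear_intros bounded_linear_Re bounded_linear_Im bounded_linear_minus)+
  have ZW: "vector_field_on c U (\<lambda>q. fst (Z q))" "vector_field_on c U (\<lambda>q. snd (Z q))"
    "vector_field_on c U (\<lambda>q. fst (W q))" "vector_field_on c U (\<lambda>q. snd (W q))"
    using Z W by (auto simp: cvector_field_on_def)
  have "vector_field_on c U (\<lambda>q. fst (Z q) + (- Re (a q) *\<^sub>R fst (W q) + Im (a q) *\<^sub>R snd (W q)))"
    "vector_field_on c U (\<lambda>q. snd (Z q) + (- Re (a q) *\<^sub>R snd (W q) + - Im (a q) *\<^sub>R fst (W q)))"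
    by (intro add sc Re Im ZW)+
  then show ?thesis by (simp add: cvector_field_on_def cscale_def algebra_simps)
qed

lemma cext_apply_smooth:
  assumes U: "open U" and \<theta>: "one_form_on c U \<theta>" and Z: "cvector_field_on c U Z"
  shows "smooth_fun_on U (\<lambda>q. cext (\<theta> q) (Z q))"
proof -
  have "smooth_fun_on U (\<lambda>q. \<theta> q (fst (Z q)))" "smooth_fun_on U (\<lambda>q. \<theta> q (snd (Z q)))"
    using one_form_apply_smooth[OF U \<theta>] Z by (auto simp: cvector_field_on_def)
  then show ?thesis
    unfolding cext_def
    by (intro smooth_fun_on_add[OF U] smooth_fun_on_linear[OF U bounded_linear_mult_right])
qed

text \<open>The components in the chart at \<open>p\<close> identify the complexified tangent spaces near \<open>p\<close> with
  the complexified model space, and a basis of the latter gives a frame.\<close>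
lemma coordinate_frame:
  "\<exists>Z. (\<forall>i<DIM('e). cvector_field_on c (cdom c p) (Z i)) \<and>
       (\<forall>q\<in>cdom c p. cframe DIM('e) (\<lambda>i. Z i q) UNIV)"
proof -
  obtain b where b: "bij_betw b {..<DIM('e)} (Basis :: 'e set)"
    using ex_bij_betw_nat_finite[OF finite_Basis] by (auto simp: atLeast0LessThan)
  have rep: "(\<Sum>i<DIM('e). (v \<bullet> b i) *\<^sub>R b i) = v" for v :: 'e
    using sum.reindex_bij_betw[OF b, of "\<lambda>b. (v \<bullet> b) *\<^sub>R b"] by (simp add: euclidean_representation)
  define Z where "Z i q = (tchange c p q q (b i), 0 :: 'e)" for i q
  have "cvector_field_on c (cdom c p) (Z i)" for i
  proof -
    have "vector_field_on c (cdom c p) (\<lambda>r. 0 *\<^sub>R tchange c p r r (b i))"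
      by (rule vector_field_on_scaleR[OF open_cdom _ constant_vector_field])
        (auto simp: smooth_fun_on_def intro!: smooth_on_const open_cmap_image open_cdom)
    then show ?thesis
      using constant_vector_field[of p "b i"] by (simp add: cvector_field_on_def Z_def)
  qed
  moreover have "cframe DIM('e) (\<lambda>i. Z i q) UNIV" if q: "q \<in> cdom c p" for q
  proof -
    let ?T = "tchange c p q q" and ?S = "tchange c q p q"
    have lin: "linear ?T" by (rule tchange_linear[OF q mem_cdom])
    have TS: "?T (?S v) = v" and ST: "?S (?T v) = v" for v
      using q by (simp_all add: tchange_trans tchange_self)
    have sum: "(\<Sum>i<DIM('e). cscale (a i) (Z i q)) =
        (?T (\<Sum>i<DIM('e). Re (a i) *\<^sub>R b i), ?T (\<Sum>i<DIM('e). Im (a i) *\<^sub>R b i))" for a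
      by (simp add: Z_def cscale_def linear_sum[OF lin] linear_cmul[OF lin] prod_eq_iff fst_sum snd_sum)
    show ?thesis
      unfolding cframe_def sum
    proof (intro conjI allI impI)
      fix w
      have "w = (?T (\<Sum>i<DIM('e). (?S (fst w) \<bullet> b i) *\<^sub>R b i), ?T (\<Sum>i<DIM('e). (?S (snd w) \<bullet> b i) *\<^sub>R b i))"
        unfolding rep TS by simp
      then have "\<exists>a. w = (?T (\<Sum>i<DIM('e). Re (a i) *\<^sub>R b i), ?T (\<Sum>i<DIM('e). Im (a i) *\<^sub>R b i))"
        by (intro exI[of _ "\<lambda>i. Complex (?S (fst w) \<bullet> b i) (?S (snd w) \<bullet> b i)"]) simp
      then show "w \<in> UNIV \<longleftrightarrow> (\<exists>a. w = (?T (\<Sum>i<DIM('e). Re (a i) *\<^sub>R b i), ?T (\<Sum>i<DIM('e). Im (a i) *\<^sub>R b i)))"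
        by simp
    next
      fix a j assume a: "(?T (\<Sum>i<DIM('e). Re (a i) *\<^sub>R b i), ?T (\<Sum>i<DIM('e). Im (a i) *\<^sub>R b i)) = 0" and j: "j < DIM('e)"
      have zero: "v = 0" if "?T v = 0" for v using ST[of v] that linear_0[OF tchange_linear[OF mem_cdom q]] by simp
      have coeff: "(\<Sum>i<DIM('e). f i *\<^sub>R b i) \<bullet> b j = f j" for f
      proof -
        have bb: "b i \<bullet> b j = (if i = j then 1 else 0)" if "i < DIM('e)" for i
        proof -
          have "b i \<in> Basis" "b j \<in> Basis" "b i = b j \<longleftrightarrow> i = j"
            using b that j by (auto simp: bij_betw_def inj_on_def)
          then show ?thesis by (simp add: inner_Basis)
        qed
        have "(\<Sum>i<DIM('e). f i *\<^sub>R b i) \<bullet> b j = (\<Sum>i<DIM('e). if i = j then f i else 0)"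
          unfolding inner_sum_left by (rule sum.cong) (auto simp: bb)
        then show ?thesis using j by simp
      qed
      have "(\<Sum>i<DIM('e). Re (a i) *\<^sub>R b i) = 0" "(\<Sum>i<DIM('e). Im (a i) *\<^sub>R b i) = 0"
        by (rule zero, use a in \<open>simp add: zero_prod_def\<close>)+
      then show "a j = 0" using coeff[of "\<lambda>i. Re (a i)"] coeff[of "\<lambda>i. Im (a i)"] by (simp add: complex_eq_iff)
    qed
  qed
  ultimately show ?thesis by blast
qed

text \<open>The common annihilator of smooth complex 1-forms that are independent at \<open>p\<close> has a smooth frame
  near \<open>p\<close>: the 1-forms are imposed one after the other, and each of them eliminates one member of the
  frame that is available at this stage.\<close>
lemma annihilator_frame:
  fixes \<theta> :: "nat \<Rightarrow> 'a \<Rightarrow> 'e \<Rightarrow> complex"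
  assumes "\<And>j. j < r \<Longrightarrow> one_form_on c UNIV (\<theta> j)"
    and "\<And>j. j < r \<Longrightarrow> \<exists>w. \<forall>i<r. cext (\<theta> i p) w = (if i = j then 1 else 0)"
  shows "r \<le> DIM('e) \<and> (\<exists>U Z. open U \<and> p \<in> U \<and> (\<forall>i<DIM('e) - r. cvector_field_on c U (Z i)) \<and>
     (\<forall>q\<in>U. cframe (DIM('e) - r) (\<lambda>i. Z i q) {w. \<forall>j<r. cext (\<theta> j q) w = 0}))"
  using assms
proof (induction r)
  case 0
  obtain Z where "\<forall>i<DIM('e). cvector_field_on c (cdom c p) (Z i)"
    "\<forall>q\<in>cdom c p. cframe DIM('e) (\<lambda>i. Z i q) UNIV" using coordinate_frame by blast
  then show ?case by (auto intro!: exI[of _ "cdom c p"] exI[of _ Z] open_cdom)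
next
  case (Suc r)
  have "\<exists>w. \<forall>i<r. cext (\<theta> i p) w = (if i = j then 1 else 0)" if "j < r" for j
    using Suc.prems(2)[of j] that by (meson less_SucI)
  with Suc.prems(1) obtain U Z where r: "r \<le> DIM('e)" and U: "open U" "p \<in> U"
    and Z': "\<forall>i<DIM('e) - r. cvector_field_on c U (Z i)"
    and fr': "\<forall>q\<in>U. cframe (DIM('e) - r) (\<lambda>i. Z i q) {w. \<forall>j<r. cext (\<theta> j q) w = 0}"
    using Suc.IH by auto
  note Z = Z'[rule_format] and fr = bspec[OF fr']
  have form: "one_form_on c V (\<theta> r)" for V by (rule one_form_on_subset[OF Suc.prems(1)]) auto
  have lin: "linear (\<theta> r q)" for q by (rule one_form_on_linear[OF form UNIV_I])
  obtain w where w: "\<forall>i<Suc r. cext (\<theta> i p) w = (if i = r then 1 else 0)" using Suc.prems(2)[of r] by auto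
  then have "w \<in> {w. \<forall>j<r. cext (\<theta> j p) w = 0}" by auto
  then obtain a where a: "w = (\<Sum>i<DIM('e) - r. cscale (a i) (Z i p))" using fr[OF U(2)] unfolding cframe_def by blast
  have "(\<Sum>i<DIM('e) - r. a i * cext (\<theta> r p) (Z i p)) = 1"
  proof -
    have "cext (\<theta> r p) w = 1" using w by simp
    then show ?thesis unfolding a cext_sum[OF lin] .
  qed
  then have "\<exists>j<DIM('e) - r. cext (\<theta> r p) (Z j p) \<noteq> 0"
    by (rule contrapos_pp) simp
  then obtain j where j: "j < DIM('e) - r" "cext (\<theta> r p) (Z j p) \<noteq> 0" by blast
  then have r': "Suc r \<le> DIM('e)" by simp
  define n where "n = DIM('e) - Suc r"
  have n: "DIM('e) - r = Suc n" using r' by (simp add: n_def)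
  (* the member of the frame on which the new form does not vanish is moved to the last place *)
  define \<pi> where "\<pi> i = (if i = j then n else if i = n then j else i)" for i
  define Y where "Y i = Z (\<pi> i)" for i
  have \<pi>: "bij_betw \<pi> {..<Suc n} {..<Suc n}"
    using j n by (intro bij_betw_byWitness[where f' = \<pi>]) (auto simp: \<pi>_def)
  have Yfr: "cframe (Suc n) (\<lambda>i. Y i q) {w. \<forall>j<r. cext (\<theta> j q) w = 0}" if "q \<in> U" for q
    using cframe_permute[OF fr[OF that, unfolded n] \<pi>] by (simp add: Y_def)
  have Y: "cvector_field_on c U (Y i)" if "i < Suc n" for i
    unfolding Y_def using Z j n that by (auto simp: \<pi>_def)
  define f where "f i q = cext (\<theta> r q) (Y i q)" for i q
  have f: "smooth_fun_on U (f i)" if "i < Suc n" for i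
    unfolding f_def[abs_def] by (rule cext_apply_smooth[OF U(1) form Y[OF that]])
  define V where "V = U \<inter> f n -` (- {0})"
  have V: "open V" unfolding V_def
    by (rule continuous_open_preimage[OF smooth_fun_on_continuous[OF U(1) f] U(1)]) auto
  have VU: "V \<subseteq> U" by (auto simp: V_def)
  have "p \<in> V" using j(2) U(2) by (simp add: V_def f_def Y_def \<pi>_def)
  define X where "X i q = Y i q - cscale (f i q * inverse (f n q)) (Y n q)" for i q
  have "cvector_field_on c V (X i)" if i: "i < n" for i
    unfolding X_def
  proof (rule cvector_field_on_diff_cscale[OF V])
    show "cvector_field_on c V (Y i)" "cvector_field_on c V (Y n)"
      using i by (auto intro!: cvector_field_on_subset[OF Y VU])
    show "smooth_fun_on V (\<lambda>q. f i q * inverse (f n q))"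
      by (intro smooth_fun_on_mult[OF V] smooth_fun_on_inverse[OF V] smooth_fun_on_subset[OF f VU])
        (use i in \<open>auto simp: V_def\<close>)
  qed
  moreover have "cframe n (\<lambda>i. X i q) {w. \<forall>j<Suc r. cext (\<theta> j q) w = 0}" if q: "q \<in> V" for q
  proof -
    have "cframe n (\<lambda>i. X i q) {w \<in> {w. \<forall>j<r. cext (\<theta> j q) w = 0}. cext (\<theta> r q) w = 0}"
      unfolding X_def f_def
      by (rule cframe_eliminate[OF Yfr lin]) (use q in \<open>auto simp: V_def f_def\<close>)
    also have "{w \<in> {w. \<forall>j<r. cext (\<theta> j q) w = 0}. cext (\<theta> r q) w = 0} = {w. \<forall>j<Suc r. cext (\<theta> j q) w = 0}"
      by (auto simp: less_Suc_eq)
    finally show ?thesis .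
  qed
  ultimately show ?case using r' V \<open>p \<in> V\<close> unfolding n_def[symmetric] by blast
qed

end

section \<open>The nearly Robinson structure\<close>

lemma has_derivative_imp_vector_derivative:
  assumes "(f has_derivative f') (at s)"
  shows "(f has_vector_derivative f' 1) (at s)"
proof -
  have "f' r = r *\<^sub>R f' 1" for r
    using linear_cmul[OF has_derivative_linear[OF assms], of r 1] by (simp only: real_scaleR_def mult_1_right)
  then have "f' = (\<lambda>r. r *\<^sub>R f' 1)" by (rule ext)
  with assms show ?thesis unfolding has_vector_derivative_def by (rule subst[rotated])
qed

lemma line_has_derivative: "((\<lambda>t. y + t *\<^sub>R v) has_derivative (\<lambda>t. t *\<^sub>R v)) (at t0)"
  by (auto intro!: derivative_eq_intros)

context robinson_setup
begin

text \<open>The complex 1-forms \<open>\<theta>0\<close>, \<open>\<theta> 0\<close>, \<dots>, \<open>\<theta> (m - 1)\<close> on the base, as a sequence.\<close>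
definition base_form :: "nat \<Rightarrow> 'a \<Rightarrow> 'e \<Rightarrow> complex" where
  "base_form j = (if j = 0 then (\<lambda>p v. complex_of_real (\<theta>0 p v)) else \<theta> (j - 1))"

text \<open>The distributions of the almost Robinson structure.\<close>
abbreviation "N \<equiv> robinson_N c m \<theta>0 \<theta>"
abbreviation "K \<equiv> robinson_K c \<theta>0 g"

lemma base_form_form: "j < Suc m \<Longrightarrow> one_form_on c UNIV (base_form j)"
  unfolding base_form_def using one_form_on_of_real[OF open_UNIV theta0_form] theta_form
  by (cases j) auto

lemma base_form_linear: "j < Suc m \<Longrightarrow> linear (base_form j p)"
  by (rule one_form_on_linear[OF base_form_form UNIV_I])

lemma all_less_Suc_iff: "(\<forall>j<Suc m. P j) \<longleftrightarrow> P 0 \<and> (\<forall>\<alpha><m. P (Suc \<alpha>))"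
  using less_Suc_eq_0_disj by auto

lemma N_eq: "N x = {w. \<forall>j<Suc m. cext (lift_form c (base_form j) x) w = 0}"
  unfolding robinson_N_def all_less_Suc_iff base_form_def by (simp add: lift_form_apply cext_def)

lemma mem_N_iff:
  "w \<in> N x \<longleftrightarrow> (\<forall>j<Suc m. base_form j (snd x) (snd (fst w)) + \<i> * base_form j (snd x) (snd (snd w)) = 0)"
  by (simp add: N_eq cext_def lift_form_apply)

lemma mem_K_iff: "k \<in> K x \<longleftrightarrow> (\<exists>s. k = s *\<^sub>R vertical)"
  using point.orthogonal_annihilator[of x k] by (simp add: robinson_K_def metric_eq)

text \<open>The \<open>m + 1\<close> independent forms that define \<open>N\<close> leave a distribution of rank \<open>(2 m + 2) - (m + 1)\<close>.\<close>
lemma N_distribution: "complex_distribution M (m + 1) N"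
proof -
  have frame: "\<exists>U Z. open U \<and> x \<in> U \<and> (\<forall>i<m + 1. cvector_field_on M U (Z i)) \<and>
     (\<forall>q\<in>U. cframe (m + 1) (\<lambda>i. Z i q) (N q))" for x
  proof -
    let ?\<theta> = "\<lambda>j. lift_form c (base_form j)"
    have 1: "one_form_on M UNIV (?\<theta> j)" if "j < Suc m" for j
      using one_form_on_lift[OF open_UNIV base_form_form[OF that]] by simp
    have 2: "\<exists>w. \<forall>i<Suc m. cext (?\<theta> i x) w = (if i = j then 1 else 0)" if "j < Suc m" for j
    proof -
      have "\<exists>u. \<theta>0 (snd x) u = (if j = 0 then 1 else 0) \<and>
          (\<forall>\<alpha><m. \<theta> \<alpha> (snd x) u = (if Suc \<alpha> = j then 1 else 0))"
        by (rule coframe_solve[OF theta_coframe theta0_linear theta_linear])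
      then obtain u where u: "\<theta>0 (snd x) u = (if j = 0 then 1 else 0)"
        "\<forall>\<alpha><m. \<theta> \<alpha> (snd x) u = (if Suc \<alpha> = j then 1 else 0)"
        by (elim exE conjE)
      have "\<forall>i<Suc m. cext (?\<theta> i x) ((0, u), 0) = (if i = j then 1 else 0)"
        unfolding all_less_Suc_iff using u
        by (auto simp: cext_def lift_form_apply base_form_def linear_0[OF theta0_linear] linear_0[OF theta_linear])
      then show ?thesis by blast
    qed
    have "DIM(real \<times> 'e) - Suc m = m + 1" by (simp add: dim_base)
    then show ?thesis
      using line.annihilator_frame[of "Suc m" ?\<theta> x, OF 1 2] unfolding N_eq by simp
  qed
  show ?thesis
    unfolding complex_distribution_def
  proof (intro conjI allI)
    fix x
    obtain U Z where UZ: "open U" "x \<in> U" "\<forall>i<m + 1. cvector_field_on M U (Z i)"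
      "\<forall>q\<in>U. cframe (m + 1) (\<lambda>i. Z i q) (N q)" using frame by blast
    then have "cframe (m + 1) (\<lambda>i. Z i x) (N x)" by blast
    then show "cvec.subspace (N x)" "cvec.dim (N x) = m + 1" by (rule cframe_span)+
    show "\<exists>U Z. open U \<and> x \<in> U \<and> (\<forall>i<m + 1. cvector_field_on M U (Z i)) \<and>
        (\<forall>q\<in>U. N q = cvec.span {Z i q |i. i < m + 1})"
      by (intro exI[of _ U] exI[of _ Z]) (use UZ cframe_span(1) in blast)
  qed
qed

text \<open>The vertical field has the components \<open>(1, 0)\<close> in every product chart.\<close>
lemma tchange_vertical:
  assumes "snd r \<in> cdom c (snd p)" "snd r \<in> cdom c (snd q)"
  shows "tchange M p q r (s *\<^sub>R vertical) = s *\<^sub>R vertical"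
  using assms by (simp add: tchange_line linear_0[OF tchange_linear] prod_eq_iff)

lemma vertical_field: "vector_field_on M U (\<lambda>_. vertical)" if "open U"
  unfolding vector_field_on_def
proof
  fix p
  have op: "open (cmap M p ` (cdom M p \<inter> U))" by (rule line.open_cmap_image[OF that])
  show "smooth_on (cmap M p ` (cdom M p \<inter> U)) (vloc M p (\<lambda>_. vertical))"
  proof (rule smooth_on_cong[OF op _ smooth_on_const[OF op, of vertical]])
    fix y assume "y \<in> cmap M p ` (cdom M p \<inter> U)"
    then obtain r where "r \<in> cdom M p" "y = cmap M p r" by blast
    then show "vertical = vloc M p (\<lambda>_. vertical) y"
      using tchange_vertical[of r r p 1] by (simp add: line.vloc_eq mem_Times_iff del: cmap_product)
  qed
qed

lemma K_distribution: "real_distribution M 1 K"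
proof -
  have K: "K x = span {vertical}" for x by (auto simp: mem_K_iff span_singleton)
  show ?thesis
    unfolding real_distribution_def
  proof (intro conjI allI)
    fix x
    show "subspace (K x)" unfolding K by (rule subspace_span)
    show "dim (K x) = 1" unfolding K
      by (subst dim_span_eq_card_independent) (auto simp: zero_prod_def)
    show "\<exists>U X. open U \<and> x \<in> U \<and> (\<forall>i<1. vector_field_on M U (X i)) \<and> (\<forall>q\<in>U. K q = span {X i q |i::nat. i < 1})"
      by (intro exI[of _ UNIV] exI[of _ "\<lambda>i q. vertical"]) (auto simp: K vertical_field)
  qed
qed

lemma N_null: "w \<in> N x \<Longrightarrow> z \<in> N x \<Longrightarrow> cext2 (g x) w z = 0"
  unfolding metric_eq robinson_N_def by (rule point.annihilator_null) auto

lemma K_times_K: "K x \<times> K x = N x \<inter> cconj ` N x"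
proof (intro set_eqI iffI)
  fix w assume "w \<in> K x \<times> K x"
  then have "snd (fst w) = 0" "snd (snd w) = 0" by (auto simp: mem_K_iff)
  then have "w \<in> N x" "cconj w \<in> N x" by (simp_all add: mem_N_iff cconj_def linear_0[OF base_form_linear])
  moreover have "w = cconj (cconj w)" by (simp add: cconj_def)
  ultimately show "w \<in> N x \<inter> cconj ` N x" by blast
next
  fix w assume w: "w \<in> N x \<inter> cconj ` N x"
  then have "cconj w \<in> N x" by (auto simp: cconj_def)
  then have 1: "base_form j (snd x) (snd (fst w)) = 0 \<and> base_form j (snd x) (snd (snd w)) = 0" if "j < Suc m" for j
    using w that by (simp add: mem_N_iff cconj_def linear_neg[OF base_form_linear])
  have zero: "v = 0" if "\<forall>j<Suc m. base_form j (snd x) v = 0" for v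
    by (rule coframe_inj[OF theta_coframe[of "snd x"]])
      (use that in \<open>auto simp: all_less_Suc_iff base_form_def\<close>)
  have "snd (fst w) = 0" "snd (snd w) = 0" by (rule zero, use 1 in blast)+
  then have "fst w = fst (fst w) *\<^sub>R vertical" "snd w = fst (snd w) *\<^sub>R vertical" by (simp_all add: prod_eq_iff)
  then show "w \<in> K x \<times> K x" unfolding mem_Times_iff mem_K_iff by blast
qed

text \<open>In the chart at \<open>q\<close> a section of \<open>K\<close> is \<open>f \<partial>\<^sub>t\<close>, and the equations that define \<open>N\<close> do not depend
  on \<open>t\<close>, so that they survive differentiation along \<open>\<partial>\<^sub>t\<close>.\<close>
lemma bracket_K_N:
  assumes U: "open U" and k: "vector_field_on M U k" "\<forall>q\<in>U. k q \<in> K q"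
    and Z: "cvector_field_on M U Z" "\<forall>q\<in>U. Z q \<in> N q" and q: "q \<in> U"
  shows "(lie_bracket M k (\<lambda>p. fst (Z p)) q, lie_bracket M k (\<lambda>p. snd (Z p)) q) \<in> N q"
proof -
  let ?S = "cmap M q ` (cdom M q \<inter> U)" and ?y = "cmap M q q"
  let ?X = "\<lambda>p. fst (Z p)" and ?Y = "\<lambda>p. snd (Z p)"
  have op: "open ?S" by (rule line.open_cmap_image[OF U])
  have y: "?y \<in> ?S" using q by (intro imageI IntI line.mem_cdom)
  have der: "(vloc M q V has_derivative frechet_derivative (vloc M q V) (at ?y)) (at ?y)"
    if "vector_field_on M U V" for V
    by (rule smooth_on_has_derivative[OF line.vector_field_onD[OF that] y])
  have XY: "vector_field_on M U ?X" "vector_field_on M U ?Y" using Z(1) by (auto simp: cvector_field_on_def)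
  obtain s where s: "k q = s *\<^sub>R vertical" using k(2) q by (auto simp: mem_K_iff)
  have Dk: "snd (frechet_derivative (vloc M q k) (at ?y) v) = 0" for v
  proof -
    have 1: "((\<lambda>y. snd (vloc M q k y)) has_derivative (\<lambda>v. snd (frechet_derivative (vloc M q k) (at ?y) v))) (at ?y)"
      by (rule has_derivative_snd[OF der[OF k(1)]])
    have "((\<lambda>y. snd (vloc M q k y)) has_derivative (\<lambda>v. 0)) (at ?y)"
    proof (rule has_derivative_transform_within_open[OF has_derivative_const op y])
      fix z assume "z \<in> ?S"
      then obtain r where r: "r \<in> cdom M q" "r \<in> U" "z = cmap M q r" by blast
      then obtain a where "k r = a *\<^sub>R vertical" using k(2) by (auto simp: mem_K_iff)
      then show "0 = snd (vloc M q k z)"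
        using r tchange_vertical[of r r q a] by (simp add: line.vloc_eq mem_Times_iff del: cmap_product)
    qed
    from has_derivative_unique[OF 1 this] show ?thesis by (rule fun_cong)
  qed
  have N: "base_form j (snd q) (snd (frechet_derivative (vloc M q ?X) (at ?y) vertical)) +
      \<i> * base_form j (snd q) (snd (frechet_derivative (vloc M q ?Y) (at ?y) vertical)) = 0" if j: "j < Suc m" for j
  proof -
    let ?\<theta> = "base_form j (snd q)"
    have lin: "bounded_linear ?\<theta>" using base_form_linear[OF j] by (simp add: linear_conv_bounded_linear)
    note bl = bounded_linear.has_derivative[OF lin has_derivative_snd[OF der]]
    have D: "((\<lambda>y. ?\<theta> (snd (vloc M q ?X y)) + \<i> * ?\<theta> (snd (vloc M q ?Y y))) has_derivative
        (\<lambda>v. ?\<theta> (snd (frechet_derivative (vloc M q ?X) (at ?y) v)) +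
             \<i> * ?\<theta> (snd (frechet_derivative (vloc M q ?Y) (at ?y) v)))) (at ?y)"
      by (rule has_derivative_add[OF bl[OF XY(1)] has_derivative_mult_right[OF bl[OF XY(2)]]])
    define l where "l t = ?y + t *\<^sub>R vertical" for t :: real
    have l: "(l has_derivative (\<lambda>t. t *\<^sub>R vertical)) (at 0)"
      unfolding l_def by (rule line_has_derivative)
    have l0: "l 0 = ?y" unfolding l_def scaleR_zero_left by (rule add_0_right)
    have D': "((\<lambda>t. ?\<theta> (snd (vloc M q ?X (l t))) + \<i> * ?\<theta> (snd (vloc M q ?Y (l t)))) has_derivative
        (\<lambda>t. ?\<theta> (snd (frechet_derivative (vloc M q ?X) (at ?y) (t *\<^sub>R vertical))) +
             \<i> * ?\<theta> (snd (frechet_derivative (vloc M q ?Y) (at ?y) (t *\<^sub>R vertical))))) (at 0)"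
      by (rule has_derivative_compose[OF l]) (use D l0 in simp)
    have "continuous_on UNIV l" unfolding l_def by (intro continuous_intros)
    then have opl: "open (l -` ?S)" using op by (simp add: continuous_on_open_vimage)
    have "((\<lambda>t. ?\<theta> (snd (vloc M q ?X (l t))) + \<i> * ?\<theta> (snd (vloc M q ?Y (l t)))) has_derivative (\<lambda>t. 0)) (at 0)"
    proof (rule has_derivative_transform_within_open[OF has_derivative_const opl])
      show "0 \<in> l -` ?S" using y l0 by simp
      fix t assume "t \<in> l -` ?S"
      then obtain r where r: "r \<in> cdom M q" "r \<in> U" "l t = cmap M q r" by blast
      have "cmap c (snd q) (snd r) = cmap c (snd q) (snd q)"
        using r(3) by (cases r; cases q) (simp add: l_def)
      then have "cinv c (snd q) (cmap c (snd q) (snd r)) = cinv c (snd q) (cmap c (snd q) (snd q))" by simp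
      then have rq: "snd r = snd q" using r(1) by (simp add: mem_Times_iff)
      have "snd (vloc M q V (l t)) = snd (V r)" for V
        using r rq by (simp add: line.vloc_eq tchange_line tchange_self mem_Times_iff del: cmap_product)
      moreover have "?\<theta> (snd (?X r)) + \<i> * ?\<theta> (snd (?Y r)) = 0"
        using bspec[OF Z(2) r(2)] j rq by (simp add: mem_N_iff)
      ultimately show "0 = ?\<theta> (snd (vloc M q ?X (l t))) + \<i> * ?\<theta> (snd (vloc M q ?Y (l t)))" by simp
    qed
    from fun_cong[OF has_derivative_unique[OF D' this], of 1] show ?thesis by simp
  qed
  have lie: "snd (lie_bracket M k V q) = s *\<^sub>R snd (frechet_derivative (vloc M q V) (at ?y) vertical)"
    if "vector_field_on M U V" for V
    using linear_cmul[OF has_derivative_linear[OF der[OF that]], of s vertical] Dk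
    by (simp add: lie_bracket_def s del: scaleR_Pair)
  show ?thesis
    unfolding mem_N_iff
  proof (intro allI impI)
    fix j assume j: "j < Suc m"
    let ?\<theta> = "base_form j (snd q)"
    let ?A = "snd (frechet_derivative (vloc M q ?X) (at ?y) vertical)"
      and ?B = "snd (frechet_derivative (vloc M q ?Y) (at ?y) vertical)"
    have "?\<theta> (s *\<^sub>R ?A) + \<i> * ?\<theta> (s *\<^sub>R ?B) = complex_of_real s * (?\<theta> ?A + \<i> * ?\<theta> ?B)"
      by (simp add: linear_cmul[OF base_form_linear[OF j]] scaleR_conv_of_real algebra_simps)
    also have "\<dots> = 0" unfolding N[OF j] by simp
    finally show "?\<theta> (snd (fst (lie_bracket M k ?X q, lie_bracket M k ?Y q))) +
        \<i> * ?\<theta> (snd (snd (lie_bracket M k ?X q, lie_bracket M k ?Y q))) = 0"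
      by (simp add: lie[OF XY(1)] lie[OF XY(2)])
  qed
qed

lemma nearly_robinson: "nearly_robinson M m g (total_orientation c ori lam) future N K"
proof -
  have "DIM(real \<times> 'e) = 2 * m + 2" by (simp add: dim_base)
  then show ?thesis
    unfolding nearly_robinson_def almost_robinson_def
    using lorentzian_manifold N_distribution K_distribution N_null K_times_K bracket_K_N by blast
qed

section \<open>The congruence of null geodesics\<close>

text \<open>In the chart at \<open>q\<close>, the components \<open>g(\<partial>\<^sub>t, \<partial>\<^sub>t)\<close> vanish and \<open>g(\<partial>\<^sub>t, w)\<close> is the product of \<open>2 lam(\<partial>\<^sub>t)\<close>
  with \<open>\<theta>0(w)\<close>, which does not depend on \<open>t\<close>. Hence \<open>\<partial>\<^sub>t g(\<partial>\<^sub>t, w)\<close> is a multiple of \<open>g(\<partial>\<^sub>t, w)\<close>.\<close>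
lemma christoffel_vertical: "\<exists>b. christoffel M g q (a *\<^sub>R vertical) (a *\<^sub>R vertical) = b *\<^sub>R vertical"
proof -
  let ?k = "a *\<^sub>R vertical" and ?S = "cmap M q ` cdom M q" and ?y = "cmap M q q"
  have op: "open ?S" by (rule line.open_cmap_cdom)
  have y: "?y \<in> ?S" by (intro imageI line.mem_cdom)
  have sm: "smooth_on ?S (gloc M g q u v)" for u v
    using metric_lorentzian unfolding lorentzian_metric_def by blast
  have gk: "gloc M g q ?k v (cmap M q r) = 2 * a * lam r vertical * T0 r (tchange M q r r v)" if "r \<in> cdom M q" for r v
  proof -
    have "tchange M q r r ?k = ?k" using that by (intro tchange_vertical) (auto simp: mem_Times_iff)
    moreover have "cinv M q (cmap M q r) = r" using that by (rule line.cinv_cmap)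
    ultimately show ?thesis
      unfolding gloc_def Let_def by (simp only: metric_eq point.G_scale point.G_e)
  qed
  have kk: "metric_deriv M g q w ?k ?k = 0" for w
  proof -
    have "(gloc M g q ?k ?k has_derivative (\<lambda>v. 0)) (at ?y)"
    proof (rule has_derivative_transform_within_open[OF has_derivative_const op y])
      fix z assume "z \<in> ?S"
      then obtain r where r: "r \<in> cdom M q" "z = cmap M q r" by blast
      then have "tchange M q r r ?k = ?k" by (intro tchange_vertical) (auto simp: mem_Times_iff)
      then show "0 = gloc M g q ?k ?k z"
        using point.T0_e[of r] unfolding r(2) gk[OF r(1)] by (simp add: linear_cmul[OF point.lin_T0] del: scaleR_Pair)
    qed
    then show ?thesis unfolding metric_deriv_def by (simp add: frechet_derivative_at[symmetric])
  qed
  define ell where "ell y = lam (cinv M q y) (tchange M q (cinv M q y) (cinv M q y) vertical)" for y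
  have ell: "smooth_on ?S ell"
    using lam_form unfolding one_form_on_def Let_def Int_UNIV_right ell_def[abs_def] by blast
  have ell_eq: "ell (cmap M q r) = lam r vertical" if "r \<in> cdom M q" for r
    using that tchange_vertical[of r q r 1] by (simp add: ell_def line.cinv_cmap mem_Times_iff del: cmap_product)
  let ?D = "frechet_derivative ell (at ?y) vertical"
  have kw: "metric_deriv M g q ?k ?k w = 2 * a * a * ?D * T0 q w" for w
  proof -
    define l where "l t = ?y + t *\<^sub>R vertical" for t :: real
    have l: "(l has_derivative (\<lambda>t. t *\<^sub>R vertical)) (at 0)"
      unfolding l_def by (rule line_has_derivative)
    have l0: "l 0 = ?y" unfolding l_def scaleR_zero_left by (rule add_0_right)
    have "continuous_on UNIV l" unfolding l_def by (intro continuous_intros)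
    then have opl: "open (l -` ?S)" using op by (simp add: continuous_on_open_vimage)
    have comp: "((\<lambda>t. f (l t)) has_derivative (\<lambda>t. frechet_derivative f (at ?y) (t *\<^sub>R vertical))) (at 0)"
      if "smooth_on ?S f" for f :: "real \<times> 'e \<Rightarrow> real"
      by (rule has_derivative_compose[OF l]) (use smooth_on_has_derivative[OF that y] l0 in simp)
    have "((\<lambda>t. 2 * a * T0 q w * ell (l t)) has_derivative
        (\<lambda>t. 2 * a * T0 q w * frechet_derivative ell (at ?y) (t *\<^sub>R vertical))) (at 0)"
      by (rule has_derivative_mult_right[OF comp[OF ell]])
    then have "((\<lambda>t. gloc M g q ?k w (l t)) has_derivative
        (\<lambda>t. 2 * a * T0 q w * frechet_derivative ell (at ?y) (t *\<^sub>R vertical))) (at 0)"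
    proof (rule has_derivative_transform_within_open[OF _ opl])
      show "0 \<in> l -` ?S" using y l0 by simp
      fix t assume "t \<in> l -` ?S"
      then obtain r where r: "r \<in> cdom M q" "l t = cmap M q r" by blast
      have "cmap c (snd q) (snd r) = cmap c (snd q) (snd q)"
        using r(2) by (cases r; cases q) (simp add: l_def)
      then have "cinv c (snd q) (cmap c (snd q) (snd r)) = cinv c (snd q) (cmap c (snd q) (snd q))" by simp
      then have rq: "snd r = snd q" using r(1) by (simp add: mem_Times_iff)
      have "T0 r (tchange M q r r w) = T0 q w"
        using rq by (simp add: lift_form_apply tchange_line tchange_self)
      then show "2 * a * T0 q w * ell (l t) = gloc M g q ?k w (l t)"
        unfolding r(2) gk[OF r(1)] ell_eq[OF r(1)] by simp
    qed
    from fun_cong[OF has_derivative_unique[OF comp[OF sm] this], of 1]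
    have 1: "frechet_derivative (gloc M g q ?k w) (at ?y) vertical = 2 * a * T0 q w * ?D" by simp
    have "linear (frechet_derivative (gloc M g q ?k w) (at ?y))"
      by (rule has_derivative_linear[OF smooth_on_has_derivative[OF sm y]])
    from linear_cmul[OF this, of a vertical] 1 show ?thesis by (simp add: metric_deriv_def)
  qed
  let ?b = "a * a * ?D / lam q vertical"
  have "christoffel M g q ?k ?k = ?b *\<^sub>R vertical"
    unfolding christoffel_def kk kw
  proof (rule the_equality)
    have gb: "g q (?b *\<^sub>R vertical) w = 2 * a * a * ?D * T0 q w" for w
      unfolding metric_eq point.G_scale point.G_e using lam_vertical[of q] by simp
    show "\<forall>w. 2 * g q (?b *\<^sub>R vertical) w = 2 * a * a * ?D * T0 q w + 2 * a * a * ?D * T0 q w - 0"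
      unfolding gb by simp
    fix z assume z: "\<forall>w. 2 * g q z w = 2 * a * a * ?D * T0 q w + 2 * a * a * ?D * T0 q w - 0"
    have "g q (z + (-1) *\<^sub>R (?b *\<^sub>R vertical)) w = 0" for w
      using spec[OF z, of w] gb[of w] unfolding metric_eq point.G_add point.G_scale[of _ "-1"] by linarith
    then have "z + (-1) *\<^sub>R (?b *\<^sub>R vertical) = 0"
      unfolding metric_eq by (rule point.nondegenerate)
    then show "z = ?b *\<^sub>R vertical" by (simp add: add_eq_0_iff del: scaleR_Pair)
  qed
  then show ?thesis by blast
qed

end

context smooth_mfd
begin

text \<open>A smooth curve in the chart at \<open>q\<close>, on the open set of parameters for which it stays in that chart.\<close>
lemma curve_chart:
  assumes sm: "smooth_map_on euclidean_manifold c I \<gamma>" and I: "open I"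
  shows "open (I \<inter> \<gamma> -` cdom c q)" "smooth_on (I \<inter> \<gamma> -` cdom c q) (\<lambda>s. cmap c q (\<gamma> s))"
proof -
  show "open (I \<inter> \<gamma> -` cdom c q)"
    using sm I open_cdom unfolding smooth_map_on_def by (intro continuous_open_preimage) auto
  show "smooth_on (I \<inter> \<gamma> -` cdom c q) (\<lambda>s. cmap c q (\<gamma> s))"
    using sm unfolding smooth_map_on_def by (simp add: o_def)
qed

text \<open>The derivative of a curve in the chart at \<open>q\<close> is its velocity, expressed in that chart.\<close>
lemma curve_has_derivative:
  assumes sm: "smooth_map_on euclidean_manifold c I \<gamma>" and I: "open I"
    and s: "s \<in> I" "\<gamma> s \<in> cdom c q"
  shows "((\<lambda>s. cmap c q (\<gamma> s)) has_vector_derivative tchange c (\<gamma> s) q (\<gamma> s) (velocity c \<gamma> s)) (at s)"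
proof -
  let ?J = "I \<inter> \<gamma> -` cdom c (\<gamma> s)"
  have sJ: "s \<in> ?J" using s by simp
  have d: "((\<lambda>r. cmap c (\<gamma> s) (\<gamma> r)) has_derivative frechet_derivative (\<lambda>r. cmap c (\<gamma> s) (\<gamma> r)) (at s)) (at s)"
    by (rule smooth_on_has_derivative[OF curve_chart(2)[OF sm I] sJ])
  have v: "velocity c \<gamma> s = frechet_derivative (\<lambda>r. cmap c (\<gamma> s) (\<gamma> r)) (at s) 1"
    by (simp add: velocity_def mderiv_def o_def)
  have "((\<lambda>r. cmap c q (cinv c (\<gamma> s) (cmap c (\<gamma> s) (\<gamma> r)))) has_derivative
     (\<lambda>r. tchange c (\<gamma> s) q (\<gamma> s) (frechet_derivative (\<lambda>r. cmap c (\<gamma> s) (\<gamma> r)) (at s) r))) (at s)"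
    by (rule has_derivative_compose[OF d transition_has_derivative[OF mem_cdom s(2)]])
  then have "((\<lambda>r. cmap c q (\<gamma> r)) has_derivative
     (\<lambda>r. tchange c (\<gamma> s) q (\<gamma> s) (frechet_derivative (\<lambda>r. cmap c (\<gamma> s) (\<gamma> r)) (at s) r))) (at s)"
    by (rule has_derivative_transform_within_open[OF _ curve_chart(1)[OF sm I, of "\<gamma> s"] sJ]) simp
  moreover have "tchange c (\<gamma> s) q (\<gamma> s) (frechet_derivative (\<lambda>r. cmap c (\<gamma> s) (\<gamma> r)) (at s) r) =
      r *\<^sub>R tchange c (\<gamma> s) q (\<gamma> s) (velocity c \<gamma> s)" for r
    using linear_cmul[OF has_derivative_linear[OF d], of r 1]
    by (simp add: v linear_cmul[OF tchange_linear[OF mem_cdom s(2)]])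
  ultimately show ?thesis by (simp add: has_vector_derivative_def)
qed

end

context robinson_setup
begin

lemma integral_curve_derivative:
  assumes \<gamma>: "integral_curve M K I \<gamma>" and s: "s \<in> I" "\<gamma> s \<in> cdom M q"
  shows "\<exists>a. ((\<lambda>s. cmap M q (\<gamma> s)) has_vector_derivative a *\<^sub>R vertical) (at s)"
proof -
  have "velocity M \<gamma> s \<in> K (\<gamma> s)" using \<gamma> s by (simp add: integral_curve_def)
  then obtain a where a: "velocity M \<gamma> s = a *\<^sub>R vertical" by (auto simp: mem_K_iff)
  have "tchange M (\<gamma> s) q (\<gamma> s) (a *\<^sub>R vertical) = a *\<^sub>R vertical"
    by (rule tchange_vertical) (use s in \<open>auto simp: mem_Times_iff\<close>)
  then have "((\<lambda>s. cmap M q (\<gamma> s)) has_vector_derivative a *\<^sub>R vertical) (at s)"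
    using line.curve_has_derivative[of I \<gamma> s q] \<gamma> s a by (simp add: integral_curve_def regular_curve_def)
  then show ?thesis by blast
qed

text \<open>In a chart, the first derivative of the curve is vertical for all parameters near \<open>t\<close>, hence so is
  the second derivative at \<open>t\<close>; and the Christoffel term is vertical as well.\<close>
lemma null_geodesic:
  assumes \<gamma>: "integral_curve M K I \<gamma>"
  shows "null_geodesic M g I \<gamma>"
proof -
  have reg: "regular_curve M I \<gamma>" and I: "open I" and sm: "smooth_map_on euclidean_manifold M I \<gamma>"
    using \<gamma> by (simp_all add: integral_curve_def regular_curve_def)
  have "g (\<gamma> t) (velocity M \<gamma> t) (velocity M \<gamma> t) = 0 \<and> (\<exists>f. acceleration M g \<gamma> t = f *\<^sub>R velocity M \<gamma> t)"
    if t: "t \<in> I" for t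
  proof -
    obtain a where a: "velocity M \<gamma> t = a *\<^sub>R vertical" and "velocity M \<gamma> t \<noteq> 0"
      using \<gamma> t unfolding integral_curve_def regular_curve_def mem_K_iff by blast
    then have a0: "a \<noteq> 0" by (auto simp: zero_prod_def)
    have null: "g (\<gamma> t) (velocity M \<gamma> t) (velocity M \<gamma> t) = 0"
      unfolding a metric_eq point.G_scale point.G_e linear_cmul[OF point.lin_T0] point.T0_e by simp
    define \<phi> where "\<phi> s = cmap M (\<gamma> t) (\<gamma> s)" for s
    let ?J = "I \<inter> \<gamma> -` cdom M (\<gamma> t)"
    have tJ: "t \<in> ?J" using t line.mem_cdom by blast
    have op: "open ?J" and \<phi>: "smooth_on ?J \<phi>"
      unfolding \<phi>_def using line.curve_chart[OF sm I] by auto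
    define \<phi>' where "\<phi>' s = vector_derivative \<phi> (at s)" for s
    have eq: "frechet_derivative \<phi> (at s) 1 = \<phi>' s" if "s \<in> ?J" for s
    proof -
      have d: "(\<phi> has_derivative frechet_derivative \<phi> (at s)) (at s)" by (rule smooth_on_has_derivative[OF \<phi> that])
      then have "(\<phi> has_vector_derivative frechet_derivative \<phi> (at s) 1) (at s)"
        by (rule has_derivative_imp_vector_derivative)
      then show ?thesis unfolding \<phi>'_def by (rule vector_derivative_at[symmetric])
    qed
    have \<phi>': "smooth_on ?J \<phi>'"
      by (rule smooth_on_cong[OF op eq smooth_on_directional[OF \<phi>]])
    have snd: "snd (\<phi>' s) = 0" if s: "s \<in> ?J" for s
    proof -
      obtain b where "(\<phi> has_vector_derivative b *\<^sub>R vertical) (at s)"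
        using integral_curve_derivative[OF \<gamma>, of s "\<gamma> t"] s unfolding \<phi>_def by auto
      then have "\<phi>' s = b *\<^sub>R vertical" unfolding \<phi>'_def by (rule vector_derivative_at)
      then show ?thesis by simp
    qed
    let ?A = "frechet_derivative \<phi>' (at t)"
    have d: "(\<phi>' has_derivative ?A) (at t)" by (rule smooth_on_has_derivative[OF \<phi>' tJ])
    have "((\<lambda>s. snd (\<phi>' s)) has_derivative (\<lambda>r. 0)) (at t)"
      by (rule has_derivative_transform_within_open[OF has_derivative_const op tJ]) (simp add: snd)
    from has_derivative_unique[OF has_derivative_snd[OF d] this]
    have A0: "snd (?A r) = 0" for r by (rule fun_cong)
    have "(\<phi>' has_vector_derivative ?A 1) (at t)"
      by (rule has_derivative_imp_vector_derivative[OF d])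
    then have "vector_derivative \<phi>' (at t) = ?A 1" by (rule vector_derivative_at)
    also have "\<dots> = fst (?A 1) *\<^sub>R vertical" using A0[of 1] by (simp add: prod_eq_iff)
    finally have acc: "vector_derivative \<phi>' (at t) = fst (?A 1) *\<^sub>R vertical" .
    obtain b where b: "christoffel M g (\<gamma> t) (a *\<^sub>R vertical) (a *\<^sub>R vertical) = b *\<^sub>R vertical"
      using christoffel_vertical by blast
    have "(\<lambda>s. vector_derivative (cmap M (\<gamma> t) \<circ> \<gamma>) (at s)) = \<phi>'"
      by (simp add: \<phi>'_def[abs_def] \<phi>_def[abs_def] o_def)
    then have "acceleration M g \<gamma> t = (fst (?A 1) + b) *\<^sub>R vertical"
      unfolding acceleration_def a b by (simp only: acc scaleR_add_left)
    also have "\<dots> = ((fst (?A 1) + b) / a) *\<^sub>R velocity M \<gamma> t" using a0 unfolding a by simp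
    finally show ?thesis using null by blast
  qed
  then show ?thesis unfolding null_geodesic_def using reg by blast
qed

text \<open>The projection of an integral curve to the base has derivative zero in charts, so it is locally
  constant.\<close>
lemma integral_curve_projection:
  assumes \<gamma>: "integral_curve M K I \<gamma>" and st: "s \<in> I" "t \<in> I"
  shows "snd (\<gamma> s) = snd (\<gamma> t)"
proof -
  have I: "open I" "is_interval I" and sm: "smooth_map_on euclidean_manifold M I \<gamma>"
    using \<gamma> by (simp_all add: integral_curve_def regular_curve_def)
  have "(\<lambda>s. snd (\<gamma> s)) constant_on I"
  proof (rule locally_constant_imp_constant[OF is_interval_connected[OF I(2)]])
    fix t assume t: "t \<in> I"
    let ?J = "I \<inter> \<gamma> -` cdom M (\<gamma> t)"
    have "open ?J" "t \<in> ?J" using line.curve_chart(1)[OF sm I(1)] t line.mem_cdom by blast+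
    then obtain e where e: "e > 0" "ball t e \<subseteq> ?J" by (meson open_contains_ball)
    have "((\<lambda>s. snd (cmap M (\<gamma> t) (\<gamma> s))) has_derivative (\<lambda>r. 0)) (at s within ball t e)" if s: "s \<in> ball t e" for s
    proof -
      obtain a where a: "((\<lambda>s. cmap M (\<gamma> t) (\<gamma> s)) has_vector_derivative a *\<^sub>R vertical) (at s)"
        using integral_curve_derivative[OF \<gamma>, of s "\<gamma> t"] s e(2) by blast
      have "((\<lambda>s. snd (cmap M (\<gamma> t) (\<gamma> s))) has_derivative (\<lambda>r. snd (r *\<^sub>R a *\<^sub>R vertical))) (at s)"
        by (rule has_derivative_snd[OF a[unfolded has_vector_derivative_def]])
      then have "((\<lambda>s. snd (cmap M (\<gamma> t) (\<gamma> s))) has_derivative (\<lambda>r. 0)) (at s)" by simp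
      then show ?thesis by (rule has_derivative_at_withinI)
    qed
    then have chart: "snd (cmap M (\<gamma> t) (\<gamma> s)) = snd (cmap M (\<gamma> t) (\<gamma> t))" if "s \<in> ball t e" for s
      by (rule has_derivative_zero_unique[OF convex_ball _ that]) (use e(1) in simp_all)
    have "snd (\<gamma> s) = snd (\<gamma> t)" if s: "s \<in> ball t e" for s
    proof -
      have dom: "snd (\<gamma> s) \<in> cdom c (snd (\<gamma> t))" using s e(2) by (auto simp: mem_Times_iff)
      have "cmap c (snd (\<gamma> t)) (snd (\<gamma> s)) = cmap c (snd (\<gamma> t)) (snd (\<gamma> t))"
        using chart[OF s] by simp
      then have "cinv c (snd (\<gamma> t)) (cmap c (snd (\<gamma> t)) (snd (\<gamma> s))) = cinv c (snd (\<gamma> t)) (cmap c (snd (\<gamma> t)) (snd (\<gamma> t)))"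
        by simp
      then show ?thesis using dom by simp
    qed
    moreover have "openin (top_of_set I) (ball t e)" using e(2) I(1) by (simp add: openin_open_eq)
    moreover have "t \<in> ball t e" using e(1) by simp
    ultimately show "\<exists>T. openin (top_of_set I) T \<and> t \<in> T \<and> (\<forall>x\<in>T. snd (\<gamma> x) = snd (\<gamma> t))"
      by blast
  qed
  then obtain p where "\<forall>s\<in>I. snd (\<gamma> s) = p" unfolding constant_on_def by blast
  then show ?thesis using st by simp
qed

lemma fibre_integral_curve: "integral_curve M K UNIV (\<lambda>s. (s, p))"
proof -
  have sm: "smooth_map_on euclidean_manifold M UNIV (\<lambda>s. (s, p))"
    unfolding smooth_map_on_def
  proof (intro conjI allI)
    show "continuous_on UNIV (\<lambda>s::real. (s, p))" by (intro continuous_intros)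
    fix q' :: real and q :: "real \<times> 'a"
    have "open (if p \<in> cdom c (snd q) then UNIV else {} :: real set)" by simp
    then have "smooth_on (if p \<in> cdom c (snd q) then UNIV else {}) (\<lambda>s::real. (s, cmap c (snd q) p))"
      by (intro smooth_on_Pair smooth_on_bounded_linear[OF _ bounded_linear_ident] smooth_on_const)
    then show "smooth_on (cmap euclidean_manifold q' ` (cdom euclidean_manifold q' \<inter> UNIV \<inter> (\<lambda>s. (s, p)) -` cdom M q))
        (cmap M q \<circ> (\<lambda>s. (s, p)) \<circ> cinv euclidean_manifold q')"
      by (cases "p \<in> cdom c (snd q)") (simp_all add: o_def vimage_def)
  qed
  have v: "velocity M (\<lambda>s. (s, p)) t = vertical" for t
  proof -
    have "((\<lambda>s. (s, cmap c p p)) has_derivative (\<lambda>s. (s, 0))) (at t)"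
      by (intro has_derivative_Pair has_derivative_ident has_derivative_const)
    then have "frechet_derivative (\<lambda>s. (s, cmap c p p)) (at t) = (\<lambda>s. (s, 0))"
      by (rule frechet_derivative_at[symmetric])
    then show ?thesis by (simp add: velocity_def mderiv_def o_def)
  qed
  have "vertical \<in> K x" for x unfolding mem_K_iff by (rule exI[of _ 1]) simp
  then show ?thesis
    unfolding integral_curve_def regular_curve_def v using sm by (simp add: zero_prod_def)
qed

lemma leaf_space: "leaf_space M K c snd"
  unfolding leaf_space_def
proof (intro conjI allI)
  show "smooth_map_on M c UNIV snd"
    unfolding smooth_map_on_def
  proof (intro conjI allI)
    show "continuous_on UNIV (snd :: real \<times> 'a \<Rightarrow> 'a)" by (intro continuous_intros)
    fix p :: "real \<times> 'a" and q :: 'a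
    have eq: "cdom M p \<inter> UNIV \<inter> snd -` cdom c q = cdom M p \<inter> (UNIV \<times> cdom c q)" by auto
    show "smooth_on (cmap M p ` (cdom M p \<inter> UNIV \<inter> snd -` cdom c q)) (cmap c q \<circ> snd \<circ> cinv M p)"
      unfolding eq
      by (rule smooth_on_cong[OF _ _ smooth_on_line[OF open_cdom transition_smooth]])
        (auto intro!: open_cmap_image open_Times open_cdom simp: line_chart_image simp del: cdom_product cmap_product)
  qed
  show "surj (snd :: real \<times> 'a \<Rightarrow> 'a)" by (auto simp: surj_def)
  show "surj (mderiv M c snd x)" for x unfolding mderiv_snd by (auto simp: surj_def)
  fix x y :: "real \<times> 'a"
  show "snd x = snd y \<longleftrightarrow> same_leaf M K x y"
  proof
    assume "snd x = snd y"
    then have "x \<in> range (\<lambda>s. (s, snd x))" "y \<in> range (\<lambda>s. (s, snd x))" by (auto simp: image_iff prod_eq_iff)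
    then show "same_leaf M K x y" unfolding same_leaf_def using fibre_integral_curve[of "snd x"] by blast
  next
    assume "same_leaf M K x y"
    then show "snd x = snd y" unfolding same_leaf_def using integral_curve_projection by blast
  qed
qed

section \<open>Triplets that define the same metric\<close>

lemma same_metric_iff:
  assumes t: "robinson_triplet c m H J A \<theta>0' \<theta>' h' lam'"
    and r: "coframes_related c m \<phi>0 \<phi> \<psi> \<psi>i \<theta>0 \<theta> \<theta>0' \<theta>'"
  shows "g = robinson_metric c m \<theta>0' \<theta>' h' lam' \<longleftrightarrow>
     (\<forall>x. \<forall>\<alpha><m. \<forall>\<beta><m. h' \<alpha> \<beta> x = (\<Sum>\<gamma><m. \<Sum>\<delta><m. h \<gamma> \<delta> x * \<psi>i \<alpha> \<gamma> (snd x) * cnj (\<psi>i \<beta> \<delta> (snd x)))) \<and>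
     (\<forall>x v. complex_of_real (lam' x v) = complex_of_real (exp (- \<phi>0 (snd x))) *
        (complex_of_real (lam x v)
         - 1/2 * (\<Sum>\<alpha><m. \<Sum>\<beta><m. \<psi> \<alpha> \<beta> (snd x) * lower_index m h' \<phi> \<beta> x * lift_form c (\<theta> \<alpha>) x v)
         - 1/2 * (\<Sum>\<alpha><m. \<Sum>\<beta><m. cnj (\<psi> \<alpha> \<beta> (snd x)) * cnj (lower_index m h' \<phi> \<beta> x) * cnj (lift_form c (\<theta> \<alpha>) x v))
         - 1/2 * (\<Sum>\<beta><m. lower_index m h' \<phi> \<beta> x * \<phi> \<beta> (snd x)) * complex_of_real (lift_form c \<theta>0 x v)))"
proof -
  interpret other: robinson_setup c m ori H J A \<theta>0' \<theta>' h' lam'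
    by unfold_locales (rule cr, rule t)
  have "(\<forall>u v. g x u v = robinson_metric c m \<theta>0' \<theta>' h' lam' x u v) \<longleftrightarrow>
     (\<forall>\<alpha><m. \<forall>\<beta><m. h' \<alpha> \<beta> x = (\<Sum>\<gamma><m. \<Sum>\<delta><m. h \<gamma> \<delta> x * \<psi>i \<alpha> \<gamma> (snd x) * cnj (\<psi>i \<beta> \<delta> (snd x)))) \<and>
     (\<forall>v. complex_of_real (lam' x v) = complex_of_real (exp (- \<phi>0 (snd x))) *
        (complex_of_real (lam x v)
         - 1/2 * (\<Sum>\<alpha><m. \<Sum>\<beta><m. \<psi> \<alpha> \<beta> (snd x) * lower_index m h' \<phi> \<beta> x * lift_form c (\<theta> \<alpha>) x v)
         - 1/2 * (\<Sum>\<alpha><m. \<Sum>\<beta><m. cnj (\<psi> \<alpha> \<beta> (snd x)) * cnj (lower_index m h' \<phi> \<beta> x) * cnj (lift_form c (\<theta> \<alpha>) x v))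
         - 1/2 * (\<Sum>\<beta><m. lower_index m h' \<phi> \<beta> x * \<phi> \<beta> (snd x)) * complex_of_real (lift_form c \<theta>0 x v)))" for x
    unfolding metric_eq other.metric_eq lower_index_def
  proof (rule point.robinson_form_eq_iff[where x = x and h' = "\<lambda>\<alpha> \<beta>. h' \<alpha> \<beta> x" and p = "\<phi>0 (snd x)"
      and \<psi> = "\<lambda>\<beta> \<alpha>. \<psi> \<beta> \<alpha> (snd x)" and \<psi>i = "\<lambda>\<beta> \<alpha>. \<psi>i \<beta> \<alpha> (snd x)" and \<phi> = "\<lambda>\<gamma>. \<phi> \<gamma> (snd x)"
      and T0' = "other.T0 x" and T' = "other.T x" and L' = "lam' x", OF other.h_herm])
    show "inverse_matrices m (\<lambda>\<beta> \<alpha>. \<psi> \<beta> \<alpha> (snd x)) (\<lambda>\<beta> \<alpha>. \<psi>i \<beta> \<alpha> (snd x))"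
      using r by (simp add: coframes_related_def)
    show "other.T0 x v = exp (\<phi>0 (snd x)) * T0 x v" for v
      using r by (simp add: coframes_related_def lift_form_apply)
    show "other.T x \<alpha> v = (\<Sum>\<beta><m. \<psi> \<beta> \<alpha> (snd x) * T x \<beta> v) + \<phi> \<alpha> (snd x) * complex_of_real (T0 x v)"
      if "\<alpha> < m" for \<alpha> v
      using r that by (simp add: coframes_related_def lift_form_apply)
  qed
  then show ?thesis unfolding fun_eq_iff by blast
qed

end

theorem proposition4p18:
  fixes c :: "('a::{t2_space, second_countable_topology}, 'e::euclidean_space) atlas"
    and m :: nat
    and ori :: "'a \<Rightarrow> ((nat \<Rightarrow> 'e) \<Rightarrow> real) set"
    and H :: "'a \<Rightarrow> 'e set" and J :: "'a \<Rightarrow> 'e \<Rightarrow> 'e" and A :: "'a \<Rightarrow> ('e \<Rightarrow> real) set"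
    and \<theta>0 :: "'a \<Rightarrow> 'e \<Rightarrow> real" and \<theta> :: "nat \<Rightarrow> 'a \<Rightarrow> 'e \<Rightarrow> complex"
    and h :: "nat \<Rightarrow> nat \<Rightarrow> real \<times> 'a \<Rightarrow> complex"
    and lam :: "real \<times> 'a \<Rightarrow> real \<times> 'e \<Rightarrow> real"
    and g :: "real \<times> 'a \<Rightarrow> real \<times> 'e \<Rightarrow> real \<times> 'e \<Rightarrow> real"
    and N :: "real \<times> 'a \<Rightarrow> ((real \<times> 'e) \<times> (real \<times> 'e)) set"
    and K :: "real \<times> 'a \<Rightarrow> (real \<times> 'e) set"
  assumes "oriented_almost_cr_manifold c m ori H J A"
    and "robinson_triplet c m H J A \<theta>0 \<theta> h lam"
    and "g = robinson_metric c m \<theta>0 \<theta> h lam"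
    and "N = robinson_N c m \<theta>0 \<theta>"
    and "K = robinson_K c \<theta>0 g"
  shows
    "(\<forall>x u v. complex_of_real (g x u v) = robinson_tensor c m \<theta>0 \<theta> h lam x u v) \<and>
     (\<exists>\<tau>. oriented_lorentzian_manifold (line_bundle c) g (total_orientation c ori lam) \<tau> \<and>
          nearly_robinson (line_bundle c) m g (total_orientation c ori lam) \<tau> N K) \<and>
     (\<forall>I \<gamma>. integral_curve (line_bundle c) K I \<gamma> \<longrightarrow> null_geodesic (line_bundle c) g I \<gamma>) \<and>
     leaf_space (line_bundle c) K c snd \<and>
     (\<forall>\<theta>0' \<theta>' h' lam' \<phi>0 \<phi> \<psi> \<psi>i.
        robinson_triplet c m H J A \<theta>0' \<theta>' h' lam' \<and>
        coframes_related c m \<phi>0 \<phi> \<psi> \<psi>i \<theta>0 \<theta> \<theta>0' \<theta>' \<longrightarrow>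
        (g = robinson_metric c m \<theta>0' \<theta>' h' lam' \<longleftrightarrow>
           (\<forall>x. \<forall>\<alpha><m. \<forall>\<beta><m. h' \<alpha> \<beta> x =
              (\<Sum>\<gamma><m. \<Sum>\<delta><m. h \<gamma> \<delta> x * \<psi>i \<alpha> \<gamma> (snd x) * cnj (\<psi>i \<beta> \<delta> (snd x)))) \<and>
           (\<forall>x v. complex_of_real (lam' x v) = complex_of_real (exp (- \<phi>0 (snd x))) *
              (complex_of_real (lam x v)
               - 1/2 * (\<Sum>\<alpha><m. \<Sum>\<beta><m. \<psi> \<alpha> \<beta> (snd x) * lower_index m h' \<phi> \<beta> x * lift_form c (\<theta> \<alpha>) x v)
               - 1/2 * (\<Sum>\<alpha><m. \<Sum>\<beta><m. cnj (\<psi> \<alpha> \<beta> (snd x)) * cnj (lower_index m h' \<phi> \<beta> x) *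
                          cnj (lift_form c (\<theta> \<alpha>) x v))
               - 1/2 * (\<Sum>\<beta><m. lower_index m h' \<phi> \<beta> x * \<phi> \<beta> (snd x)) *
                       complex_of_real (lift_form c \<theta>0 x v)))))"
proof -
  interpret smooth_mfd c
    using assms(1) by unfold_locales (simp add: oriented_almost_cr_manifold_def)
  interpret line_mfd c by (rule line_mfd)
  interpret robinson_setup c m ori H J A \<theta>0 \<theta> h lam
    by unfold_locales (rule assms(1), rule assms(2))
  show ?thesis
    unfolding assms(3-5)
    using metric_real lorentzian_manifold nearly_robinson null_geodesic leaf_space same_metric_iff by blast
qed

end
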